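(* Let $x^*$ be a feasible solution of the LP described in the context, let $\epsilon\ge 0$, and let $S_1,\ldots,S_r\in\mathcal{S}$ be such that $x:=\frac{1}{r}\sum_{j=1}^r\chi^{S_j}$ satisfies $x(\delta(s))=x(\delta(t))=1$ and $x^*(F)-\epsilon\le x(F)\le x^*(F)+\epsilon$ for all $F\subseteq E$. Then one can find, in polynomial time, $\hat S_1,\ldots,\hat S_r\in\mathcal{S}$ such that $x=\frac{1}{r}\sum_{j=1}^r\chi^{\hat S_j}$ and for every narrow cut $C\in\mathcal{C}$ there exists $h\in\{1,\ldots,r\}$ with $\frac{h}{r}\ge 2-x^*(C)-\epsilon$ and $|C\cap\hat S_j|=1$ for all $j=1,\ldots,h$.
   Context: $V$ is a finite set, $s,t\in V$ with $s\neq t$, and $E$ is the edge set of the complete graph on $V$. For $U\subseteq V$, $\delta(U)$ is the set of edges with exactly one endpoint in $U$, and $\delta(v):=\delta(\{v\})$. For $x\in\mathbb{R}^E$ and $F\subseteq E$, $x(F):=\sum_{e\in F}x_e$; $\chi^F\in\{0,1\}^E$ is the characteristic vector of $F$. The LP has variables $x\in\mathbb{R}^E$ and constraints: $x(\delta(U))\ge 2$ for all $\emptyset\ne U\subsetneq V$ with $|U\cap\{s,t\}|$ even; $x(\delta(U))\ge 1$ for all $\emptyset\ne U\subsetneq V$ with $|U\cap\{s,t\}|$ odd; $x(\delta(v))=2$ for $v\in V\setminus\{s,t\}$; $x(\delta(v))=1$ for $v\in\{s,t\}$; $x_e\ge 0$ for $e\in E$. $\mathcal{S}$ denotes the set of edge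 sets of spanning trees of $(V,E)$. A narrow cut (with respect to $x^*$) is a set $C=\delta(U)$, $\emptyset\neq U\subsetneq V$, with $x^*(C)<2$; $\mathcal{C}$ is the set of narrow cuts.
   Formalization: The index h may also be 0, which is possible only for narrow cuts C with 2 − x*(C) − ε ≤ 0; requiring h ≥ 1 there is false (r = 1, ε = 2, x* the path s-a-b-t, S_1 the path s-b-a-t, C = δ({s,a})). *)

theory Defs
  imports "HOL-Analysis.Analysis" "HOL-Library.Log_Nat" "HOL-Computational_Algebra.Polynomial"
begin

section \<open>Cuts, the linear program, spanning trees\<close>

definition complete_edges :: "'a set \<Rightarrow> 'a set set" where
  "complete_edges V = {{u, v} | u v. u \<in> V \<and> v \<in> V \<and> u \<noteq> v}"

definition cut :: "'a set \<Rightarrow> 'a set \<Rightarrow> 'a set set" where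
  "cut V U = {e \<in> complete_edges V. card (e \<inter> U) = 1}"

text \<open>A vector indexed by the edges is a function on all vertex sets; only its values on
  \<^term>\<open>complete_edges V\<close> are ever used.  Thus \<open>x(F)\<close> is \<^term>\<open>sum x F\<close> and the characteristic
  vector of \<open>F\<close> is \<^term>\<open>indicator F\<close>.\<close>

definition lp_feasible :: "'a set \<Rightarrow> 'a \<Rightarrow> 'a \<Rightarrow> ('a set \<Rightarrow> real) \<Rightarrow> bool" where
  "lp_feasible V s t x \<longleftrightarrow>
     (\<forall>U. U \<noteq> {} \<and> U \<subset> V \<and> even (card (U \<inter> {s, t})) \<longrightarrow> sum x (cut V U) \<ge> 2) \<and>
     (\<forall>U. U \<noteq> {} \<and> U \<subset> V \<and> odd (card (U \<inter> {s, t})) \<longrightarrow> sum x (cut V U) \<ge> 1) \<and>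
     (\<forall>v \<in> V - {s, t}. sum x (cut V {v}) = 2) \<and>
     (\<forall>v \<in> {s, t}. sum x (cut V {v}) = 1) \<and>
     (\<forall>e \<in> complete_edges V. x e \<ge> 0)"

definition narrow_cuts :: "'a set \<Rightarrow> ('a set \<Rightarrow> real) \<Rightarrow> 'a set set set" where
  "narrow_cuts V x = {cut V U | U. U \<noteq> {} \<and> U \<subset> V \<and> sum x (cut V U) < 2}"

definition connected_on :: "'a set \<Rightarrow> 'a set set \<Rightarrow> bool" where
  "connected_on V T \<longleftrightarrow> (\<forall>u \<in> V. \<forall>v \<in> V. (u, v) \<in> {(a, b). {a, b} \<in> T}\<^sup>*)"

definition has_cycle :: "'a set set \<Rightarrow> bool" where
  "has_cycle T \<longleftrightarrow> (\<exists>vs. length vs \<ge> 3 \<and> distinct vs \<and>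
     (\<forall>i < length vs. {vs ! i, vs ! (Suc i mod length vs)} \<in> T))"

definition spanning_trees :: "'a set \<Rightarrow> 'a set set set" where
  "spanning_trees V = {T. T \<subseteq> complete_edges V \<and> connected_on V T \<and> \<not> has_cycle T}"

definition tree_average :: "nat \<Rightarrow> (nat \<Rightarrow> 'a set set) \<Rightarrow> 'a set \<Rightarrow> real" where
  "tree_average r S = (\<lambda>e. (1 / real r) * (\<Sum>j = 1..r. indicator (S j) e))"

definition reassembly_instance ::
  "'a set \<Rightarrow> 'a \<Rightarrow> 'a \<Rightarrow> ('a set \<Rightarrow> real) \<Rightarrow> real \<Rightarrow> nat \<Rightarrow> (nat \<Rightarrow> 'a set set) \<Rightarrow> bool" where
  "reassembly_instance V s t xstar eps r S \<longleftrightarrow>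
     finite V \<and> s \<in> V \<and> t \<in> V \<and> s \<noteq> t \<and>
     lp_feasible V s t xstar \<and> eps \<ge> 0 \<and> r \<ge> 1 \<and>
     (\<forall>j \<in> {1..r}. S j \<in> spanning_trees V) \<and>
     sum (tree_average r S) (cut V {s}) = 1 \<and>
     sum (tree_average r S) (cut V {t}) = 1 \<and>
     (\<forall>F \<subseteq> complete_edges V.
        sum xstar F - eps \<le> sum (tree_average r S) F \<and>
        sum (tree_average r S) F \<le> sum xstar F + eps)"

text \<open>The value \<open>h = 0\<close> is admitted. It is possible only for narrow cuts \<open>C\<close> with
  \<open>2 - x\<^sup>*(C) - \<epsilon> \<le> 0\<close>, for which nothing is claimed. Demanding \<open>h \<ge> 1\<close> for these as well would
  make the result false: for \<open>V = {s, a, b, t}\<close>, \<open>r = 1\<close>, \<open>\<epsilon> = 2\<close>, let \<open>x\<^sup>*\<close> be the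
  characteristic vector of the path \<open>s a b t\<close> and \<open>S\<^sub>1\<close> the path \<open>s b a t\<close>, which crosses
  the narrow cut of \<open>{s, a}\<close> three times.\<close>

definition reassembled ::
  "'a set \<Rightarrow> ('a set \<Rightarrow> real) \<Rightarrow> real \<Rightarrow> nat \<Rightarrow> (nat \<Rightarrow> 'a set set) \<Rightarrow> (nat \<Rightarrow> 'a set set) \<Rightarrow> bool" where
  "reassembled V xstar eps r S S' \<longleftrightarrow>
     (\<forall>j \<in> {1..r}. S' j \<in> spanning_trees V) \<and>
     (\<forall>e \<in> complete_edges V. tree_average r S e = tree_average r S' e) \<and>
     (\<forall>C \<in> narrow_cuts V xstar. \<exists>h \<in> {0..r}.
        real h / real r \<ge> 2 - sum xstar C - eps \<and> (\<forall>j \<in> {1..h}. card (C \<inter> S' j) = 1))"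


section \<open>A random access machine with step counting\<close>

text \<open>Programs work on named integer arrays, unbounded in both directions; a scalar is cell
  \<open>0\<close> of an array. The only arithmetic is addition and subtraction, so \<open>k\<close> steps
  lengthen the binary representation of the numbers in the store by \<open>O(k)\<close> bits and touch \<open>O(k)\<close>
  cells. Therefore charging one unit per assignment or test (whose expressions have a size
  bounded by a constant of the program) gives the same notion of polynomial time as Turing
  machines. Multiplication is omitted because iterated squaring would break this.\<close>

datatype aexp = Const int | Cell string aexp | Add aexp aexp | Sub aexp aexp

datatype bexp = Less aexp aexp | Neg bexp | Conj bexp bexp

datatype com =
    Skip
  | Assign string aexp aexp
  | Seq com com
  | Cond bexp com com
  | Loop bexp com

type_synonym store = "string \<Rightarrow> int \<Rightarrow> int"

fun aval :: "aexp \<Rightarrow> store \<Rightarrow> int" where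
  "aval (Const k) \<sigma> = k"
| "aval (Cell A i) \<sigma> = \<sigma> A (aval i \<sigma>)"
| "aval (Add a b) \<sigma> = aval a \<sigma> + aval b \<sigma>"
| "aval (Sub a b) \<sigma> = aval a \<sigma> - aval b \<sigma>"

fun bval :: "bexp \<Rightarrow> store \<Rightarrow> bool" where
  "bval (Less a b) \<sigma> \<longleftrightarrow> aval a \<sigma> < aval b \<sigma>"
| "bval (Neg b) \<sigma> \<longleftrightarrow> \<not> bval b \<sigma>"
| "bval (Conj b c) \<sigma> \<longleftrightarrow> bval b \<sigma> \<and> bval c \<sigma>"

text \<open>\<open>exec c \<sigma> k \<tau>\<close>: started in \<open>\<sigma>\<close>, the program \<open>c\<close> halts after \<open>k\<close> steps in \<open>\<tau>\<close>.\<close>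

inductive exec :: "com \<Rightarrow> store \<Rightarrow> nat \<Rightarrow> store \<Rightarrow> bool" where
  exec_Skip: "exec Skip \<sigma> 1 \<sigma>"
| exec_Assign:
    "exec (Assign A i a) \<sigma> 1 (\<sigma>(A := (\<sigma> A)(aval i \<sigma> := aval a \<sigma>)))"
| exec_Seq: "exec c \<sigma> k \<rho> \<Longrightarrow> exec d \<rho> l \<tau> \<Longrightarrow> exec (Seq c d) \<sigma> (k + l) \<tau>"
| exec_CondT: "bval b \<sigma> \<Longrightarrow> exec c \<sigma> k \<tau> \<Longrightarrow> exec (Cond b c d) \<sigma> (1 + k) \<tau>"
| exec_CondF: "\<not> bval b \<sigma> \<Longrightarrow> exec d \<sigma> k \<tau> \<Longrightarrow> exec (Cond b c d) \<sigma> (1 + k) \<tau>"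
| exec_LoopF: "\<not> bval b \<sigma> \<Longrightarrow> exec (Loop b c) \<sigma> 1 \<sigma>"
| exec_LoopT:
    "bval b \<sigma> \<Longrightarrow> exec c \<sigma> k \<rho> \<Longrightarrow> exec (Loop b c) \<rho> l \<tau> \<Longrightarrow>
     exec (Loop b c) \<sigma> (1 + k + l) \<tau>"

definition input_store :: "int list \<Rightarrow> store" where
  "input_store w = (\<lambda>A i.
     if A = ''in'' \<and> 0 \<le> i \<and> i < int (length w) then w ! nat i
     else if A = ''inlen'' \<and> i = 0 then int (length w)
     else 0)"

definition computes :: "com \<Rightarrow> int list \<Rightarrow> int list \<Rightarrow> nat \<Rightarrow> bool" where
  "computes c w w' k \<longleftrightarrow> (\<exists>\<tau>. exec c (input_store w) k \<tau> \<and>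
     \<tau> ''outlen'' 0 = int (length w') \<and> (\<forall>i < length w'. \<tau> ''out'' (int i) = w' ! i))"

definition word_bits :: "int list \<Rightarrow> nat" where
  "word_bits w = (\<Sum>z\<leftarrow>w. 2 + nat (bitlen \<bar>z\<bar>))"


section \<open>Encoding of instances on the vertex set \<^term>\<open>{..<n::nat}\<close>\<close>

definition enc_edge_vector :: "nat \<Rightarrow> (nat set \<Rightarrow> int) \<Rightarrow> int list" where
  "enc_edge_vector n f =
     concat (map (\<lambda>u. map (\<lambda>v. if u = v then 0 else f {u, v}) [0..<n]) [0..<n])"

definition enc_trees :: "nat \<Rightarrow> nat \<Rightarrow> (nat \<Rightarrow> nat set set) \<Rightarrow> int list" where
  "enc_trees n r S = concat (map (\<lambda>j. enc_edge_vector n (indicator (S j))) [1..<Suc r])"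

text \<open>The rational data \<open>x\<^sup>* = a / D\<close> and \<open>\<epsilon> = b / D\<close> are given over a common denominator.
  As the bit length of a product is at most the sum of the bit lengths of the factors, this is
  polynomially equivalent to listing all fractions separately.\<close>

definition enc_instance ::
  "nat \<Rightarrow> nat \<Rightarrow> nat \<Rightarrow> int \<Rightarrow> (nat set \<Rightarrow> int) \<Rightarrow> int \<Rightarrow> nat \<Rightarrow> (nat \<Rightarrow> nat set set) \<Rightarrow> int list" where
  "enc_instance n s t D a b r S =
     [int n, int s, int t, int r, D, b] @ enc_edge_vector n a @ enc_trees n r S"

end

theory Submission
  imports Defs
begin

text \<open>
  A cut with \<open>x\<^sup>* < 2 - \<epsilon>\<close> is called relevant for the tree with number \<open>j\<close> if that tree has to cross it
  exactly once, i.e. if \<open>j - 1 < r (2 - x\<^sup>*(C) - \<epsilon>)\<close>. By uncrossing, the relevant cuts are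
  \<open>\<delta>(L\<^sub>1), \<dots>, \<delta>(L\<^sub>q)\<close> for a chain \<open>L\<^sub>1 \<subset> \<dots> \<subset> L\<^sub>q\<close> of sets containing \<open>s\<close>. The trees are treated
  one after the other, and for each tree the chain is scanned from left to right; tree \<open>j\<close> is
  improved by exchanging one edge with a later tree such that both remain spanning trees.
  When the cuts up to \<open>L\<^sub>p\<close> are crossed once, four kinds of exchanges are exhausted in turn. They
  make \<open>L\<^bsub>p+1\<^esub> - L\<^sub>p\<close> connected in tree \<open>j\<close>, then \<open>L\<^bsub>p+1\<^esub> - L\<^bsub>p-1\<^esub>\<close>; then they remove the edges
  jumping from \<open>L\<^sub>p\<close> over \<open>L\<^bsub>p+1\<^esub> - L\<^sub>p\<close>, so that \<open>L\<^sub>p\<close> is again crossed once; and finally they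
  reduce the number of edges leaving \<open>L\<^bsub>p+1\<^esub>\<close> to one.

  A later tree with the property needed for an exchange exists by counting. Each property fails
  in tree \<open>k\<close> only if a natural number \<open>g k\<close> is nonzero, where \<open>g k\<close> is \<open>|S\<^sub>k \<inter> C| - 1\<close>, the number of
  jumping edges, or the number of edges missing to a spanning tree of \<open>M = L\<^sub>b - L\<^sub>a\<close>. The linear program
  gives \<open>\<Sum>k. g k < r - (j - 1)\<close> for every choice of trees with average \<open>x\<close>, so if \<open>g j\<close> is nonzero,
  some \<open>g k\<close> with \<open>k > j\<close> vanishes.

  For the algorithm, no minimum cuts have to be computed: a relevant cut satisfies
  \<open>x(C) < 2\<close>, so some input tree crosses it once, and it is a fundamental cut of that tree.
\<close>

section \<open>Connectivity and forests\<close>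

text \<open>An exchange must not spoil cuts that tree \<open>j\<close> already crosses once. Hence
  every phase restricts both edges: the new one lies inside \<open>X\<close>, the old one runs from
  \<open>Y\<close> to \<open>Z\<close>. A cut of a set disjoint from \<open>X\<close> gains no edge,
  and a set disjoint from \<open>Y\<close> or from \<open>Z\<close> loses no inner edge, so facts
  about such sets survive the phase. Reducing the crossings of the next set needs that set to be
  connected in tree \<open>j\<close>. Connecting it in one go would allow new edges across all
  earlier cuts; connecting only its two top layers endangers the single cut of
  \<open>lev j p\<close>, and the result overlaps \<open>lev j p\<close>, which is connected
  already, in a layer. The damage is repairable because the top layer alone was made connected
  beforehand and stays so. The tolerance \<epsilon> enters each count only once, since the
  approximation is assumed for arbitrary edge sets; this is the \<epsilon> subtracted in the
  relevance condition. Where a bound involves two nested sets, the mean of their two relevance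
  conditions is used.\<close>

definition joined :: "'a set set \<Rightarrow> 'a \<Rightarrow> 'a \<Rightarrow> bool" where
  "joined T u v \<longleftrightarrow> (u, v) \<in> {(a, b). {a, b} \<in> T}\<^sup>*"

lemma connected_on_joined: "connected_on V T \<longleftrightarrow> (\<forall>u \<in> V. \<forall>v \<in> V. joined T u v)"
  by (simp add: connected_on_def joined_def)

lemma joined_refl [simp]: "joined T u u"
  by (simp add: joined_def)

lemma joined_edge: "{u, v} \<in> T \<Longrightarrow> joined T u v"
  by (auto simp: joined_def)

lemma joined_trans: "joined T u v \<Longrightarrow> joined T v w \<Longrightarrow> joined T u w"
  by (auto simp: joined_def)

lemma joined_sym: "joined T u v \<Longrightarrow> joined T v u"
proof -
  have "sym {(a, b). {a, b} \<in> T}"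
    by (auto simp: sym_def insert_commute)
  then show "joined T u v \<Longrightarrow> joined T v u"
    unfolding joined_def by (meson sym_rtrancl symD)
qed

lemma joined_mono: "joined T u v \<Longrightarrow> T \<subseteq> T' \<Longrightarrow> joined T' u v"
  unfolding joined_def by (erule rtrancl_mono[THEN subsetD, rotated]) auto

lemma joined_induct [consumes 1, case_names refl step]:
  assumes "joined T u v" "P u"
    and "\<And>y z. joined T u y \<Longrightarrow> {y, z} \<in> T \<Longrightarrow> P y \<Longrightarrow> P z"
  shows "P v"
  using assms(1) unfolding joined_def
  by (induction rule: rtrancl_induct) (use assms in \<open>auto simp: joined_def\<close>)

lemma joined_crossing:
  assumes "joined T u v" "u \<in> A" "v \<notin> A"
  obtains c d where "{c, d} \<in> T" "c \<in> A" "d \<notin> A"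
proof -
  have "v \<in> A" if "\<not> (\<exists>c d. {c, d} \<in> T \<and> c \<in> A \<and> d \<notin> A)"
    using assms(1) by (induction rule: joined_induct) (use that assms(2) in auto)
  then show ?thesis using assms(3) that by blast
qed

text \<open>One traversal of the new edge is enough: a walk that uses it more often can be
  shortened, which leaves only its direction to distinguish.\<close>

lemma joined_insert:
  "joined (insert {a, b} T) u v \<longleftrightarrow>
     joined T u v \<or> joined T u a \<and> joined T b v \<or> joined T u b \<and> joined T a v"
  (is "?L \<longleftrightarrow> ?R v")
proof
  assume ?L
  then show "?R v"
  proof (induction rule: joined_induct)
    case (step y z)
    consider "{y, z} \<in> T" | "y = a" "z = b" | "y = b" "z = a"
      using step(2) by (auto simp: doubleton_eq_iff)
    then show ?case
    proof cases
      case 1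
      then show ?thesis using step(3) joined_edge joined_trans by metis
    qed (use step(3) joined_sym joined_trans joined_refl in metis)+
  qed simp
next
  have "joined (insert {a, b} T) a b" by (simp add: joined_edge)
  then show "?R v \<Longrightarrow> ?L"
    by (meson joined_mono joined_sym joined_trans subset_insertI)
qed

text \<open>Every edge is a bridge. This form of acyclicity suits exchange arguments;
  \<open>forest_iff_no_cycle\<close> connects it with cycles given as vertex lists.\<close>

definition forest :: "'a set set \<Rightarrow> bool" where
  "forest T \<longleftrightarrow> (\<forall>c d. {c, d} \<in> T \<longrightarrow> \<not> joined (T - {{c, d}}) c d)"

lemma forest_mono: "forest T \<Longrightarrow> T' \<subseteq> T \<Longrightarrow> forest T'"
  unfolding forest_def by (meson Diff_mono joined_mono order_refl subsetD)

lemma finite_complete_edges: "finite V \<Longrightarrow> finite (complete_edges V)"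
  by (rule finite_subset[of _ "Pow V"]) (auto simp: complete_edges_def)

lemma complete_edges_iff: "{u, v} \<in> complete_edges V \<longleftrightarrow> u \<in> V \<and> v \<in> V \<and> u \<noteq> v"
  by (auto simp: complete_edges_def doubleton_eq_iff)

lemma complete_edgesE:
  assumes "e \<in> complete_edges V"
  obtains u v where "e = {u, v}" "u \<in> V" "v \<in> V" "u \<noteq> v"
  using assms by (auto simp: complete_edges_def)

lemma joined_in:
  assumes "T \<subseteq> complete_edges V" "joined T u v" "u \<in> V"
  shows "v \<in> V"
  using assms(2)
proof (induction rule: joined_induct)
  case (step y z)
  then have "{y, z} \<in> complete_edges V" using assms(1) by auto
  then show ?case by (simp add: complete_edges_iff)
qed (rule assms(3))

section \<open>Components, and the edge numbers of forests and connected graphs\<close>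

definition comps :: "'a set \<Rightarrow> 'a set set \<Rightarrow> 'a set set" where
  "comps V T = (\<lambda>v. {w \<in> V. joined T v w}) ` V"

lemma comp_eq_iff:
  assumes "u \<in> V" "v \<in> V"
  shows "{w \<in> V. joined T u w} = {w \<in> V. joined T v w} \<longleftrightarrow> joined T u v"
  using assms by (auto dest: joined_sym joined_trans)

text \<open>The classes of \<open>a\<close> and \<open>b\<close> merge into one, and all other
  classes stay as they are.\<close>

lemma card_comps_insert:
  assumes "finite V" "a \<in> V" "b \<in> V" "\<not> joined T a b"
  shows "card (comps V (insert {a, b} T)) + 1 = card (comps V T)"
proof -
  let ?c = "\<lambda>v. {w \<in> V. joined T v w}"
  let ?d = "\<lambda>v. {w \<in> V. joined (insert {a, b} T) v w}"
  have d: "?d v = (if joined T v a \<or> joined T v b then ?c a \<union> ?c b else ?c v)" for v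
    unfolding joined_insert by (auto intro: joined_sym joined_trans)
  have eq: "comps V (insert {a, b} T) = insert (?c a \<union> ?c b) (comps V T - {?c a, ?c b})"
  proof (intro equalityI subsetI)
    fix X assume "X \<in> comps V (insert {a, b} T)"
    then obtain v where v: "v \<in> V" "X = ?d v" by (auto simp: comps_def)
    then show "X \<in> insert (?c a \<union> ?c b) (comps V T - {?c a, ?c b})"
      using comp_eq_iff[OF v(1) assms(2), of T] comp_eq_iff[OF v(1) assms(3), of T]
      unfolding d by (auto simp: comps_def)
  next
    fix X assume X: "X \<in> insert (?c a \<union> ?c b) (comps V T - {?c a, ?c b})"
    show "X \<in> comps V (insert {a, b} T)"
    proof (cases "X = ?c a \<union> ?c b")
      case True
      then have "X = ?d a" by (simp only: d) simp
      then show ?thesis using assms(2) by (auto simp only: comps_def)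
    next
      case False
      then obtain v where v: "v \<in> V" "X = ?c v" "?c v \<noteq> ?c a" "?c v \<noteq> ?c b"
        using X by (auto simp: comps_def)
      then have "X = ?d v"
        using comp_eq_iff[OF v(1) assms(2), of T] comp_eq_iff[OF v(1) assms(3), of T]
        by (simp only: d) simp
      then show ?thesis using v(1) by (auto simp only: comps_def)
    qed
  qed
  have ne: "?c a \<noteq> ?c b"
    using comp_eq_iff[OF assms(2,3), of T] assms(4) by simp
  have fin: "finite (comps V T)"
    by (simp add: comps_def assms(1))
  \<comment> \<open>A class containing both vertices would join them, so the union is a new member
    and counts.\<close>
  have new: "?c a \<union> ?c b \<notin> comps V T - {?c a, ?c b}"
  proof
    assume "?c a \<union> ?c b \<in> comps V T - {?c a, ?c b}"
    then obtain v where v: "v \<in> V" "?c a \<union> ?c b = ?c v" by (auto simp: comps_def)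
    have "a \<in> ?c a \<union> ?c b" "b \<in> ?c a \<union> ?c b" using assms(2,3) by auto
    then have "joined T v a" "joined T v b" unfolding v(2) by auto
    then show False using assms(4) joined_sym joined_trans by metis
  qed
  have "card {?c a, ?c b} \<le> card (comps V T)"
    by (rule card_mono[OF fin]) (use assms in \<open>auto simp: comps_def\<close>)
  moreover have "card (comps V T - {?c a, ?c b}) = card (comps V T) - card {?c a, ?c b}"
    by (rule card_Diff_subset) (use assms in \<open>auto simp: comps_def\<close>)
  ultimately show ?thesis
    using new fin ne by (simp add: eq)
qed

lemma comps_empty: "card (comps V {}) = card V"
proof -
  have "joined {} v w \<longleftrightarrow> v = w" for v w :: 'a
    by (auto simp: joined_def)
  then have "comps V {} = (\<lambda>v. {v}) ` V"
    by (auto simp: comps_def)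
  then show ?thesis by (simp add: card_image)
qed

lemma comps_insert_joined:
  assumes "joined T a b"
  shows "comps V (insert {a, b} T) = comps V T"
proof -
  have "joined (insert {a, b} T) = joined T"
    by (intro ext) (use assms joined_insert joined_sym joined_trans in metis)
  then show ?thesis by (simp add: comps_def)
qed

text \<open>Adding an edge lowers the number of components by at most one, and the empty graph has
  one component per vertex. In a forest every edge lowers it, which gives the equality in
  \<open>forest_card_comps\<close>.\<close>

lemma card_le_comps:
  assumes "finite V" "T \<subseteq> complete_edges V"
  shows "card V \<le> card (comps V T) + card T"
  using finite_subset[OF assms(2) finite_complete_edges[OF assms(1)]] assms(2)
proof (induction T rule: finite_induct)
  case (insert e T)
  then obtain a b where e: "e = {a, b}" "a \<in> V" "b \<in> V"
    by (auto elim: complete_edgesE)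
  have IH: "card V \<le> card (comps V T) + card T" using insert by simp
  show ?case
  proof (cases "joined T a b")
    case True
    then show ?thesis using IH insert e comps_insert_joined by fastforce
  next
    case False
    then show ?thesis
      using IH insert e card_comps_insert[OF assms(1) e(2,3) False] by simp
  qed
qed (simp add: comps_empty)

lemma forest_card_comps:
  assumes "finite V" "T \<subseteq> complete_edges V" "forest T"
  shows "card V = card (comps V T) + card T"
  using finite_subset[OF assms(2) finite_complete_edges[OF assms(1)]] assms(2,3)
proof (induction T rule: finite_induct)
  case (insert e T)
  then obtain a b where e: "e = {a, b}" "a \<in> V" "b \<in> V"
    by (auto elim: complete_edgesE)
  have "forest T" using insert(5) by (rule forest_mono) auto
  moreover have "\<not> joined T a b"
    using insert(2,5) e(1) unfolding forest_def by (metis Diff_insert_absorb insertI1)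
  ultimately show ?case
    using insert e card_comps_insert[OF assms(1) e(2,3)] by simp
qed (simp add: comps_empty)

lemma card_comps_connected:
  assumes "finite V" "V \<noteq> {}"
  shows "card (comps V T) = 1 \<longleftrightarrow> connected_on V T"
proof
  assume "card (comps V T) = 1"
  then obtain X where X: "comps V T = {X}" by (auto simp: card_1_singleton_iff)
  have "joined T u v" if "u \<in> V" "v \<in> V" for u v
  proof -
    have "{w \<in> V. joined T u w} \<in> comps V T" "{w \<in> V. joined T v w} \<in> comps V T"
      using that by (auto simp: comps_def)
    then show ?thesis using comp_eq_iff[OF that, of T] X by simp
  qed
  then show "connected_on V T" by (simp add: connected_on_joined)
next
  assume c: "connected_on V T"
  have "comps V T = {V}"
    using assms(2) c by (auto simp: comps_def connected_on_joined)
  then show "card (comps V T) = 1" by simp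
qed

lemma comps_pos: "finite V \<Longrightarrow> V \<noteq> {} \<Longrightarrow> 1 \<le> card (comps V T)"
  by (simp add: comps_def Suc_le_eq card_gt_0_iff)

lemma connected_card_ge:
  assumes "finite V" "T \<subseteq> complete_edges V" "connected_on V T"
  shows "card V \<le> card T + 1"
proof (cases "V = {}")
  case False
  then show ?thesis
    using card_le_comps[OF assms(1,2)] card_comps_connected[OF assms(1) False, of T] assms(3) by simp
qed simp

text \<open>An edge that is not a bridge could be deleted, leaving a connected graph with too few
  edges.\<close>

lemma forest_if_card:
  assumes "finite V" "T \<subseteq> complete_edges V" "connected_on V T" "card T + 1 = card V"
  shows "forest T"
  unfolding forest_def
proof (intro allI impI notI)
  fix c d assume cd: "{c, d} \<in> T" "joined (T - {{c, d}}) c d"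
  have T: "T = insert {c, d} (T - {{c, d}})" using cd by auto
  have "joined T u v \<longleftrightarrow> joined (T - {{c, d}}) u v" for u v
    by (subst T, subst joined_insert) (use cd joined_sym joined_trans in metis)
  then have "connected_on V (T - {{c, d}})"
    using assms(3) by (simp add: connected_on_joined)
  then have "card V \<le> card (T - {{c, d}}) + 1"
    by (rule connected_card_ge[OF assms(1), rotated]) (use assms(2) in auto)
  moreover have "card (T - {{c, d}}) < card T"
    using cd finite_subset[OF assms(2) finite_complete_edges[OF assms(1)]]
    by (intro psubset_card_mono) auto
  ultimately show False using assms(4) by simp
qed

text \<open>The path grows along the walk; on reaching a vertex visited before, it is cut back to
  that vertex.\<close>

lemma joined_simple_path:
  assumes "joined T u v"
  obtains vs where "vs \<noteq> []" "hd vs = u" "last vs = v" "distinct vs"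
    "successively (\<lambda>a b. {a, b} \<in> T) vs"
proof -
  have "\<exists>vs. vs \<noteq> [] \<and> hd vs = u \<and> last vs = v \<and> distinct vs \<and>
      successively (\<lambda>a b. {a, b} \<in> T) vs"
    using assms
  proof (induction rule: joined_induct)
    case refl
    show ?case by (intro exI[of _ "[u]"]) simp
  next
    case (step y z)
    then obtain vs where vs: "vs \<noteq> []" "hd vs = u" "last vs = y" "distinct vs"
        "successively (\<lambda>a b. {a, b} \<in> T) vs" by blast
    show ?case
    proof (cases "z \<in> set vs")
      case True
      then obtain xs ys where xs: "vs = xs @ z # ys" by (meson split_list)
      then have "successively (\<lambda>a b. {a, b} \<in> T) (xs @ [z])"
        using vs(5) by (simp add: successively_append_iff)
      then show ?thesis
        using vs(2,4) xs by (intro exI[of _ "xs @ [z]"]) (cases xs; simp)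
    next
      case False
      then show ?thesis
        using vs step(2) by (intro exI[of _ "vs @ [z]"]) (auto simp: successively_append_iff)
    qed
  qed
  then show ?thesis using that by blast
qed

lemma forest_iff_no_cycle:
  assumes "T \<subseteq> complete_edges V"
  shows "forest T \<longleftrightarrow> \<not> has_cycle T"
proof
  assume f: "forest T"
  show "\<not> has_cycle T"
  proof
    assume "has_cycle T"
    then obtain vs where vs: "length vs \<ge> 3" "distinct vs"
        "\<And>i. i < length vs \<Longrightarrow> {vs ! i, vs ! (Suc i mod length vs)} \<in> T"
      by (auto simp: has_cycle_def)
    define l where "l = length vs - 1"
    have l: "length vs = Suc l" "l \<ge> 2" using vs(1) by (auto simp: l_def)
    \<comment> \<open>The closing edge of the cycle. As \<open>l \<ge> 2\<close>, it is not one of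
      the edges between consecutive positions, so these still join its ends.\<close>
    let ?e = "{vs ! 0, vs ! l}"
    have e: "?e \<in> T" using vs(3)[of l] l by (simp add: insert_commute)
    have "i \<le> l \<Longrightarrow> joined (T - {?e}) (vs ! 0) (vs ! i)" for i
    proof (induction i)
      case (Suc i)
      have "{vs ! i, vs ! Suc i} \<noteq> ?e"
        using nth_eq_iff_index_eq[OF vs(2)] l Suc(2) by (auto simp: doubleton_eq_iff)
      then have "{vs ! i, vs ! Suc i} \<in> T - {?e}"
        using vs(3)[of i] Suc(2) l by simp
      then have "joined (T - {?e}) (vs ! i) (vs ! Suc i)" by (rule joined_edge)
      moreover have "joined (T - {?e}) (vs ! 0) (vs ! i)" using Suc by simp
      ultimately show ?case using joined_trans by metis
    qed simp
    then show False using f e unfolding forest_def by blast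
  qed
next
  assume nc: "\<not> has_cycle T"
  show "forest T"
    unfolding forest_def
  proof (intro allI impI notI)
    fix c d assume cd: "{c, d} \<in> T" "joined (T - {{c, d}}) c d"
    have "{c, d} \<in> complete_edges V" using cd(1) assms by auto
    then have "c \<noteq> d" by (simp add: complete_edges_iff)
    obtain vs where vs: "vs \<noteq> []" "hd vs = c" "last vs = d" "distinct vs"
      "successively (\<lambda>a b. {a, b} \<in> T - {{c, d}}) vs"
      by (rule joined_simple_path[OF cd(2)])
    \<comment> \<open>A path avoiding the edge \<open>{c, d}\<close> between its two distinct ends
      has at least three vertices, as \<open>has_cycle\<close> demands.\<close>
    have "length vs \<noteq> 1" using \<open>c \<noteq> d\<close> vs(2,3) by (cases vs) auto
    moreover have "length vs \<noteq> 2" using vs(2,3,5) by (cases vs; cases "tl vs") auto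
    ultimately have l: "length vs \<ge> 3" using vs(1) by (cases "length vs") auto
    have "{vs ! i, vs ! (Suc i mod length vs)} \<in> T" if "i < length vs" for i
    proof (cases "Suc i < length vs")
      case True
      then show ?thesis using vs(5) by (auto simp: successively_conv_nth)
    next
      case False
      then have "Suc i = length vs" using that by simp
      then have "vs ! i = d" "vs ! (Suc i mod length vs) = c"
        using vs(1-3) by (auto simp: last_conv_nth hd_conv_nth simp flip: \<open>Suc i = length vs\<close>)
      then show ?thesis using cd(1) by (simp add: insert_commute)
    qed
    then show False using nc l vs(4) unfolding has_cycle_def by blast
  qed
qed

text \<open>Replaces acyclicity by an edge count. Swapping edges keeps the count, so afterwards only
  connectivity has to be examined, in the proofs as well as by the program.\<close>

lemma spanning_tree_iff:
  assumes "finite V" "V \<noteq> {}"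
  shows "T \<in> spanning_trees V \<longleftrightarrow>
    T \<subseteq> complete_edges V \<and> connected_on V T \<and> card T + 1 = card V"
proof (cases "T \<subseteq> complete_edges V \<and> connected_on V T")
  case True
  then have T: "T \<subseteq> complete_edges V" "connected_on V T" by auto
  have "forest T \<longleftrightarrow> card T + 1 = card V"
    using forest_card_comps[OF assms(1) T(1)] forest_if_card[OF assms(1) T]
      card_comps_connected[OF assms, of T] T(2) by auto
  then show ?thesis
    using T forest_iff_no_cycle[OF T(1)] by (simp add: spanning_trees_def)
qed (auto simp: spanning_trees_def)

lemma spanning_treeD:
  assumes "finite V" "V \<noteq> {}" "T \<in> spanning_trees V"
  shows "T \<subseteq> complete_edges V" "connected_on V T" "card T + 1 = card V" "forest T" "finite T"
    "u \<in> V \<Longrightarrow> v \<in> V \<Longrightarrow> joined T u v"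
proof -
  show *: "T \<subseteq> complete_edges V" "connected_on V T" "card T + 1 = card V"
    using assms spanning_tree_iff by auto
  then show "forest T" using forest_if_card[OF assms(1)] by blast
  show "finite T" using * finite_subset finite_complete_edges[OF assms(1)] by blast
  show "u \<in> V \<Longrightarrow> v \<in> V \<Longrightarrow> joined T u v" using * by (auto simp: connected_on_joined)
qed

section \<open>Induced subgraphs and cuts of spanning trees\<close>

definition induced :: "'a set set \<Rightarrow> 'a set \<Rightarrow> 'a set set" where
  "induced T W = {e \<in> T. e \<subseteq> W}"

lemma induced_complete: "T \<subseteq> complete_edges V \<Longrightarrow> induced T W \<subseteq> complete_edges W"
proof
  fix e assume T: "T \<subseteq> complete_edges V" and "e \<in> induced T W"
  then have e: "e \<in> complete_edges V" "e \<subseteq> W" by (auto simp: induced_def)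
  from e(1) obtain u v where "e = {u, v}" "u \<noteq> v" by (rule complete_edgesE)
  then show "e \<in> complete_edges W" using e(2) by (simp add: complete_edges_iff)
qed

text \<open>In a forest, the number of edges missing to a spanning tree of \<open>W\<close> is the
  number of components of \<open>W\<close> minus one. This deficit is the quantity counted in
  \<open>pick_connected\<close>.\<close>

lemma forest_card_induced:
  assumes "finite W" "W \<noteq> {}" "forest T" "T \<subseteq> complete_edges V"
  shows "card (induced T W) + 1 \<le> card W"
    and "card (induced T W) + 1 = card W \<longleftrightarrow> connected_on W (induced T W)"
proof -
  have "forest (induced T W)"
    using assms(3) by (rule forest_mono) (auto simp: induced_def)
  then have "card W = card (comps W (induced T W)) + card (induced T W)"
    using forest_card_comps[OF assms(1) induced_complete[OF assms(4)]] by simp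
  then show "card (induced T W) + 1 \<le> card W"
    "card (induced T W) + 1 = card W \<longleftrightarrow> connected_on W (induced T W)"
    using comps_pos[OF assms(1,2), of "induced T W"]
      card_comps_connected[OF assms(1,2), of "induced T W"] by linarith+
qed

lemma card_edge_cut:
  assumes "u \<noteq> v"
  shows "card ({u, v} \<inter> U) = 1 \<longleftrightarrow> (u \<in> U) \<noteq> (v \<in> U)"
  using assms by (cases "u \<in> U"; cases "v \<in> U") (auto simp: Int_insert_left)

lemma edge_in_cut_iff: "{u, v} \<in> cut V U \<longleftrightarrow> u \<in> V \<and> v \<in> V \<and> (u \<in> U) \<noteq> (v \<in> U)"
proof (cases "u = v")
  case True
  then show ?thesis using complete_edges_iff[of v v V] by (auto simp: cut_def)
next
  case False
  then show ?thesis using card_edge_cut[OF False, of U] by (simp add: cut_def complete_edges_iff)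
qed

lemma cut_subset: "cut V U \<subseteq> complete_edges V"
  by (auto simp: cut_def)

lemma cutE:
  assumes "e \<in> cut V U"
  obtains u v where "e = {u, v}" "u \<in> V" "v \<in> V" "u \<in> U" "v \<notin> U"
proof -
  obtain u v where uv: "e = {u, v}" "u \<in> V" "v \<in> V" "u \<noteq> v"
    using assms by (auto simp: cut_def complete_edges_def)
  then show ?thesis
    using assms that[of u v] that[of v u] by (auto simp: edge_in_cut_iff insert_commute)
qed

lemma cut_complement: "U \<subseteq> V \<Longrightarrow> cut V (V - U) = cut V U"
proof -
  have "e \<in> cut V (V - U) \<longleftrightarrow> e \<in> cut V U" if "e \<in> complete_edges V" for e
  proof -
    from that obtain u v where "e = {u, v}" "u \<in> V" "v \<in> V" by (rule complete_edgesE)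
    then show ?thesis by (auto simp: edge_in_cut_iff)
  qed
  then show "cut V (V - U) = cut V U"
    using cut_subset[of V U] cut_subset[of V "V - U"] by blast
qed

lemma tree_meets_cut:
  assumes "finite V" "T \<in> spanning_trees V" "U \<noteq> {}" "U \<subset> V"
  shows "T \<inter> cut V U \<noteq> {}"
proof -
  obtain u v where uv: "u \<in> U" "v \<in> V - U" using assms(3,4) by auto
  have V: "V \<noteq> {}" using assms(4) by auto
  then have "joined T u v" using spanning_treeD(6)[OF assms(1) V assms(2)] uv assms(4) by auto
  then obtain c d where "{c, d} \<in> T" "c \<in> U" "d \<notin> U"
    using joined_crossing[of T u v U] uv by blast
  then have "{c, d} \<in> T \<inter> cut V U"
    using spanning_treeD(1)[OF assms(1) V assms(2)] by (auto simp: edge_in_cut_iff complete_edges_iff)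
  then show ?thesis by blast
qed

lemma tree_split_cut:
  assumes "finite V" "T \<in> spanning_trees V" "U \<subseteq> V" "V \<noteq> {}"
  shows "card T = card (induced T U) + card (induced T (V - U)) + card (T \<inter> cut V U)"
proof -
  note T = spanning_treeD[OF assms(1,4,2)]
  have "T = induced T U \<union> induced T (V - U) \<union> (T \<inter> cut V U)"
  proof (intro equalityI subsetI)
    fix e assume "e \<in> T"
    then obtain u v where "e = {u, v}" "u \<in> V" "v \<in> V" "u \<noteq> v"
      using T(1) by (auto simp: complete_edges_def)
    then show "e \<in> induced T U \<union> induced T (V - U) \<union> (T \<inter> cut V U)"
      using \<open>e \<in> T\<close> by (auto simp: induced_def edge_in_cut_iff)
  qed (auto simp: induced_def)
  \<comment> \<open>An empty edge would lie inside both sides.\<close>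
  moreover have "{} \<notin> T"
    using T(1) by (auto elim: complete_edgesE)
  then have "induced T U \<inter> induced T (V - U) = {}"
    by (auto simp: induced_def) (metis DiffD2 all_not_in_conv subsetD)
  moreover have "(induced T U \<union> induced T (V - U)) \<inter> (T \<inter> cut V U) = {}"
    by (auto simp: induced_def elim!: cutE)
  moreover have "finite (induced T U)" "finite (induced T (V - U))"
    using T(5) by (auto simp: induced_def)
  ultimately show ?thesis
    using T(5) by (metis card_Un_disjoint finite_Int finite_Un)
qed

text \<open>With one edge in the cut, the two sides share \<open>card V - 2\<close> edges, which is
  the most that a forest can have on them together; so both sides carry spanning trees.\<close>

lemma tree_one_crossing:
  assumes "finite V" "T \<in> spanning_trees V" "U \<noteq> {}" "U \<subset> V" "card (T \<inter> cut V U) = 1"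
  shows "connected_on U (induced T U)" "connected_on (V - U) (induced T (V - U))"
proof -
  have V: "V \<noteq> {}" "V - U \<noteq> {}" "U \<subseteq> V" using assms(4) by auto
  note T = spanning_treeD[OF assms(1) V(1) assms(2)]
  have fin: "finite U" using finite_subset[OF V(3) assms(1)] .
  have "card V = card U + card (V - U)"
    using V(3) assms(1) fin by (simp add: card_Diff_subset card_mono)
  then have "card (induced T U) + card (induced T (V - U)) + 2 = card U + card (V - U)"
    using tree_split_cut[OF assms(1,2) V(3,1)] T(3) assms(5) by simp
  moreover have "card (induced T U) + 1 \<le> card U"
    by (rule forest_card_induced(1)[OF fin assms(3) T(4,1)])
  moreover have "card (induced T (V - U)) + 1 \<le> card (V - U)"
    by (rule forest_card_induced(1)[OF _ V(2) T(4,1)]) (use assms in simp)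
  ultimately have "card (induced T U) + 1 = card U" "card (induced T (V - U)) + 1 = card (V - U)"
    by auto
  then show "connected_on U (induced T U)" "connected_on (V - U) (induced T (V - U))"
    using forest_card_induced(2)[OF fin assms(3) T(4,1)]
      forest_card_induced(2)[OF _ V(2) T(4,1)] assms(1) by auto
qed

section \<open>Exchanging edges between two spanning trees\<close>

lemma joined_delete_edge:
  assumes "joined T u v"
  shows "joined (T - {{a, b}}) u v \<or> joined (T - {{a, b}}) u a \<and> joined (T - {{a, b}}) b v \<or>
    joined (T - {{a, b}}) u b \<and> joined (T - {{a, b}}) a v"
proof -
  have "joined (insert {a, b} (T - {{a, b}})) u v"
    by (rule joined_mono[OF assms]) auto
  then show ?thesis unfolding joined_insert .
qed

text \<open>The component of \<open>u\<close> does not contain \<open>a\<close>, hence no walk from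
  \<open>u\<close> can use the edge.\<close>

lemma joined_avoid:
  assumes "joined T u v" "\<not> joined T u a" "{a, b} \<in> T"
  shows "joined (T - {{a, b}}) u v"
proof -
  have m: "joined T x y" if "joined (T - {{a, b}}) x y" for x y
    using that by (rule joined_mono) auto
  have "\<not> joined T u b"
    using assms(2) joined_trans[of T u b a] joined_sym[OF joined_edge[OF assms(3)]] by blast
  then show ?thesis
    using joined_delete_edge[OF assms(1), of a b] assms(2) m by blast
qed

text \<open>Deleting the old edge leaves two sides, and the new edge joins them again. The new edge
  is absent from the remainder, as the edge count demands, because otherwise \<open>a\<close> and
  \<open>b\<close> would still be joined.\<close>

lemma spanning_tree_swap:
  assumes "finite V" "T \<in> spanning_trees V" "{a, b} \<in> T" "{c, d} \<in> complete_edges V"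
    and c: "joined (T - {{a, b}}) a c" and d: "joined (T - {{a, b}}) b d"
  shows "insert {c, d} (T - {{a, b}}) \<in> spanning_trees V"
proof -
  have V: "V \<noteq> {}" using assms(4) by (auto simp: complete_edges_iff)
  note T = spanning_treeD[OF assms(1) V assms(2)]
  let ?F = "T - {{a, b}}"
  have ab: "\<not> joined ?F a b" using T(4) assms(3) by (auto simp: forest_def)
  have notin: "{c, d} \<notin> ?F"
    using ab joined_trans[OF c joined_trans[OF joined_edge joined_sym[OF d]]] by blast
  have "joined (insert {c, d} ?F) u v" if "u \<in> V" "v \<in> V" for u v
  proof -
    have m: "joined (insert {c, d} ?F) x y" if "joined ?F x y" for x y
      using that by (rule joined_mono) auto
    have "joined (insert {c, d} ?F) c d" by (simp add: joined_edge)
    then have ab: "joined (insert {c, d} ?F) a b"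
      by (rule joined_trans[OF m[OF c] joined_trans[OF _ joined_sym[OF m[OF d]]]])
    show ?thesis
      using joined_delete_edge[OF T(6)[OF that], of a b]
        joined_trans[OF m joined_trans[OF ab m]]
        joined_trans[OF m joined_trans[OF joined_sym[OF ab] m]] m by blast
  qed
  then have "connected_on V (insert {c, d} ?F)" by (simp add: connected_on_joined)
  moreover have "card (insert {c, d} ?F) = card T"
    using notin T(5) card_Suc_Diff1[OF T(5) assms(3)] by (simp del: card_Diff_insert)
  ultimately show ?thesis
    using T(1,3) assms(4) by (auto simp: spanning_tree_iff[OF assms(1) V])
qed

text \<open>A subset of \<open>F\<close> with fewest edges that joins \<open>x\<close> and
  \<open>y\<close> is a path, each of whose edges separates \<open>x\<close> from \<open>y\<close>
  in it; one of them leaves \<open>A\<close>. The last property holds for every larger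
  \<open>T\<close>, because the rest of the path survives in \<open>T\<close>.\<close>

lemma separating_edge:
  assumes "finite F" "joined F x y" "x \<in> A" "y \<notin> A"
  obtains c d where "{c, d} \<in> F" "c \<in> A" "d \<notin> A"
    "\<And>T. F \<subseteq> T \<Longrightarrow> joined (T - {{c, d}}) x c \<and> joined (T - {{c, d}}) y d \<or>
       joined (T - {{c, d}}) x d \<and> joined (T - {{c, d}}) y c"
proof -
  define P where "P G \<longleftrightarrow> G \<subseteq> F \<and> joined G x y" for G
  have "P F" using assms(2) by (simp add: P_def)
  then obtain G where G: "P G" "\<And>H. P H \<Longrightarrow> card G \<le> card H"
    using ex_has_least_nat[of P F card] by blast
  then have G': "G \<subseteq> F" "joined G x y" by (auto simp: P_def)
  obtain c d where cd: "{c, d} \<in> G" "c \<in> A" "d \<notin> A"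
    using joined_crossing[OF G'(2) assms(3,4)] by blast
  have fin: "finite G" using G'(1) assms(1) finite_subset by blast
  have "\<not> joined (G - {{c, d}}) x y"
  proof
    assume "joined (G - {{c, d}}) x y"
    then have "P (G - {{c, d}})" using G'(1) by (auto simp: P_def)
    then have "card G \<le> card (G - {{c, d}})" by (rule G(2))
    moreover have "card (G - {{c, d}}) < card G"
      using cd(1) fin by (rule card_Diff1_less[rotated])
    ultimately show False by simp
  qed
  then have *: "joined (G - {{c, d}}) x c \<and> joined (G - {{c, d}}) y d \<or>
       joined (G - {{c, d}}) x d \<and> joined (G - {{c, d}}) y c"
    using joined_delete_edge[OF G'(2), of c d] by (auto dest: joined_sym)
  have "joined (T - {{c, d}}) x c \<and> joined (T - {{c, d}}) y d \<or>
       joined (T - {{c, d}}) x d \<and> joined (T - {{c, d}}) y c" if "F \<subseteq> T" for T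
  proof -
    have "G - {{c, d}} \<subseteq> T - {{c, d}}" using that G'(1) by auto
    then show ?thesis using * joined_mono[of "G - {{c, d}}" _ _ "T - {{c, d}}"] by blast
  qed
  then show ?thesis using cd G'(1) that by blast
qed

text \<open>In \<open>T'\<close> there is a walk from \<open>a\<close> to \<open>b\<close> that runs
  outside \<open>F\<close> to \<open>x\<close>, through \<open>F\<close> to \<open>y\<close>, and
  outside \<open>F\<close> to \<open>b\<close>. Since \<open>x\<close> and \<open>y\<close> lie on
  different sides of \<open>T\<close> without \<open>{a, b}\<close>, its middle part has an edge
  between the sides; this edge can replace \<open>{a, b}\<close> in \<open>T\<close> and be replaced
  by it in \<open>T'\<close>. Choosing \<open>F\<close> controls where the new edge lies.\<close>

lemma tree_exchange:
  assumes "finite V" and T: "T \<in> spanning_trees V" and T': "T' \<in> spanning_trees V"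
    and ab: "{a, b} \<in> T" and F: "F \<subseteq> T'" "joined F x y"
    and gate: "joined (T' - F) a x" "joined (T' - F) b y"
    and side: "joined (T - {{a, b}}) a x" "\<not> joined (T - {{a, b}}) a y"
  obtains c d where "{c, d} \<in> F" "joined (T - {{a, b}}) a c" "\<not> joined (T - {{a, b}}) a d"
    "insert {c, d} (T - {{a, b}}) \<in> spanning_trees V"
    "insert {a, b} (T' - {{c, d}}) \<in> spanning_trees V"
proof -
  have V: "V \<noteq> {}" using T ab by (auto simp: spanning_trees_def complete_edges_def)
  note dT = spanning_treeD[OF assms(1) V T] and dT' = spanning_treeD[OF assms(1) V T']
  have "finite F" using F(1) dT'(5) finite_subset by blast
  then obtain c d where cd: "{c, d} \<in> F" "joined (T - {{a, b}}) a c" "\<not> joined (T - {{a, b}}) a d"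
    and sep: "\<And>T. F \<subseteq> T \<Longrightarrow> joined (T - {{c, d}}) x c \<and> joined (T - {{c, d}}) y d \<or>
       joined (T - {{c, d}}) x d \<and> joined (T - {{c, d}}) y c"
    using separating_edge[OF _ F(2), of "{z. joined (T - {{a, b}}) a z}"] side by auto
  have abV: "{a, b} \<in> complete_edges V" using ab dT(1) by auto
  have cdV: "{c, d} \<in> complete_edges V" using cd(1) F(1) dT'(1) by auto
  have "joined (T - {{a, b}}) b d"
    using joined_delete_edge[OF dT(6), of a d a b] cd(3) abV cdV
    by (auto simp: complete_edges_iff)
  then have 1: "insert {c, d} (T - {{a, b}}) \<in> spanning_trees V"
    by (rule spanning_tree_swap[OF assms(1) T ab cdV cd(2)])
  have cdT': "{c, d} \<in> T'" using cd(1) F(1) by auto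
  have sub: "T' - F \<subseteq> T' - {{c, d}}" using cd(1) by auto
  have g: "joined (T' - {{c, d}}) a x" "joined (T' - {{c, d}}) b y"
    using joined_mono[OF gate(1) sub] joined_mono[OF gate(2) sub] .
  \<comment> \<open>The direction in which the path passes \<open>{c, d}\<close> is unknown, so both
    assignments of its ends occur.\<close>
  from sep[OF F(1)] have 2: "insert {a, b} (T' - {{c, d}}) \<in> spanning_trees V"
  proof
    assume "joined (T' - {{c, d}}) x c \<and> joined (T' - {{c, d}}) y d"
    then have "joined (T' - {{c, d}}) c a" "joined (T' - {{c, d}}) d b"
      using g joined_sym[of "T' - {{c, d}}"] joined_trans[of "T' - {{c, d}}"] by blast+
    then show ?thesis by (rule spanning_tree_swap[OF assms(1) T' cdT' abV])
  next
    assume "joined (T' - {{c, d}}) x d \<and> joined (T' - {{c, d}}) y c"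
    then have "joined (T' - {{c, d}}) c b" "joined (T' - {{c, d}}) d a"
      using g joined_sym[of "T' - {{c, d}}"] joined_trans[of "T' - {{c, d}}"] by blast+
    moreover have "{b, a} \<in> complete_edges V" using abV by (simp add: insert_commute)
    ultimately have "insert {b, a} (T' - {{c, d}}) \<in> spanning_trees V"
      by (intro spanning_tree_swap[OF assms(1) T' cdT'])
    then show ?thesis by (simp add: insert_commute)
  qed
  show ?thesis using that[OF cd 1 2] .
qed

text \<open>The gate is the last vertex of \<open>W\<close> on a walk from \<open>w\<close> to
  \<open>z\<close>: from there on, no edge lies inside \<open>W\<close>.\<close>

lemma gate_exists:
  assumes "joined T z w" "w \<in> W"
  obtains g where "g \<in> W" "joined (T - induced T W) z g"
proof -
  have "joined T w z" using assms(1) by (rule joined_sym)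
  then have "\<exists>g \<in> W. joined (T - induced T W) z g"
  proof (induction rule: joined_induct)
    case refl
    show ?case by (rule bexI[of _ w]) (simp_all add: assms(2))
  next
    case (step y z)
    show ?case
    proof (cases "z \<in> W")
      case False
      then have "{z, y} \<in> T - induced T W" using step(2) by (auto simp: induced_def insert_commute)
      then show ?thesis using step(3) joined_trans[OF joined_edge, of z y] by blast
    qed (auto intro!: bexI[of _ z])
  qed
  then show ?thesis using that by blast
qed

text \<open>The condition in \<open>move\<close> says that the edge is passed in the direction away
  from \<open>u\<close>. For a forest this describes the walks inside \<open>Z\<close> that never
  turn back, and the induction rule supplies each step together with its direction.\<close>

inductive_set away :: "'a set set \<Rightarrow> 'a set \<Rightarrow> 'a \<Rightarrow> 'a set" for T Z u where
  start: "u \<in> away T Z u"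
| move: "a \<in> away T Z u \<Longrightarrow> {a, b} \<in> induced T Z \<Longrightarrow> joined (T - {{a, b}}) u a \<Longrightarrow> b \<in> away T Z u"

text \<open>Only a step towards \<open>u\<close> needs an argument: in a forest it has to undo the
  step by which \<open>a\<close> was reached, so it ends in a vertex that is already in the
  set.\<close>

lemma joined_away:
  assumes "forest T" "joined (induced T Z) u v"
  shows "v \<in> away T Z u"
  using assms(2)
proof (induction rule: joined_induct)
  case (step a b)
  have ab: "{a, b} \<in> T" using step(2) by (simp add: induced_def)
  show ?case
  proof (cases "joined (T - {{a, b}}) u a")
    case True
    then show ?thesis using away.move[OF step(3,2)] by blast
  next
    case False
    from step(3) show ?thesis
    proof cases
      case start
      then show ?thesis using False by simp
    next
      case (move a')
      show ?thesis
      proof (cases "{a', a} = {a, b}")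
        case True
        then show ?thesis using move(1) by (auto simp: doubleton_eq_iff)
      next
        case ne: False
        have "{a', a} \<in> T" using move(2) by (simp add: induced_def)
        then have a: "\<not> joined (T - {{a', a}}) u a"
          using assms(1) joined_trans[OF joined_sym[OF move(3)]] unfolding forest_def by blast
        have "joined (T - {{a', a}} - {{a, b}}) u a'"
          by (rule joined_avoid[OF move(3) a]) (simp add: ab ne[symmetric])
        then have "joined (T - {{a, b}}) u a'" by (rule joined_mono) auto
        moreover have "joined (T - {{a, b}}) a' a"
          using ne \<open>{a', a} \<in> T\<close> by (intro joined_edge) auto
        ultimately have "joined (T - {{a, b}}) u a" by (rule joined_trans)
        with False show ?thesis ..
      qed
    qed
  qed
qed (rule away.start)

text \<open>Contract each part of \<open>T'\<close> hanging off \<open>W\<close> to its attachment vertex, the gate. If no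
  exchange were possible, then moving in \<open>T\<close> away from a vertex \<open>u\<close> of \<open>W\<close>, the gate would stay
  on the side of \<open>u\<close> from the first edge not inside \<open>W\<close> on, so one could never return to \<open>W\<close>.\<close>

lemma connecting_exchange:
  assumes "finite V" and T: "T \<in> spanning_trees V" and T': "T' \<in> spanning_trees V"
    and WZ: "W \<subseteq> Z" "Z \<subseteq> V" and W': "connected_on W (induced T' W)"
    and Z: "connected_on Z (induced T Z)" and W: "\<not> connected_on W (induced T W)"
  obtains a b c d where "{a, b} \<in> induced T Z" "\<not> {a, b} \<subseteq> W" "{c, d} \<in> induced T' W"
    "insert {c, d} (T - {{a, b}}) \<in> spanning_trees V"
    "insert {a, b} (T' - {{c, d}}) \<in> spanning_trees V"
proof -
  obtain u v where uv: "u \<in> W" "v \<in> W" "\<not> joined (induced T W) u v"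
    using W by (auto simp: connected_on_joined)
  have V: "V \<noteq> {}" using uv WZ by auto
  note dT = spanning_treeD[OF assms(1) V T] and dT' = spanning_treeD[OF assms(1) V T']
  have "\<exists>g. g \<in> W \<and> joined (T' - induced T' W) z g \<and> (z \<in> W \<longrightarrow> g = z)" if "z \<in> V" for z
  proof (cases "z \<in> W")
    case True
    then show ?thesis by (intro exI[of _ z]) simp
  next
    case False
    have "u \<in> V" using uv(1) WZ by auto
    then have zu: "joined T' z u" by (rule dT'(6)[OF that])
    obtain h where "h \<in> W" "joined (T' - induced T' W) z h"
      by (rule gate_exists[OF zu uv(1)])
    then show ?thesis using False by blast
  qed
  then obtain g where g: "\<And>z. z \<in> V \<Longrightarrow> g z \<in> W" "\<And>z. z \<in> V \<Longrightarrow> joined (T' - induced T' W) z (g z)"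
    "\<And>z. z \<in> V \<Longrightarrow> z \<in> W \<Longrightarrow> g z = z" by metis
  have "\<exists>a b. {a, b} \<in> induced T Z \<and> \<not> {a, b} \<subseteq> W \<and>
      joined (T - {{a, b}}) a (g a) \<and> \<not> joined (T - {{a, b}}) a (g b)"
  proof (rule ccontr)
    assume contr: "\<not> ?thesis"
    \<comment> \<open>Invariant while moving away from \<open>u\<close>: either \<open>b\<close> is
      joined to \<open>u\<close> inside \<open>W\<close>, or the gate of \<open>b\<close> lies on
      the side of \<open>u\<close> of the last edge.\<close>
    define H where "H b \<longleftrightarrow> b \<in> W \<and> joined (induced T W) u b \<or>
      (\<exists>a. {a, b} \<in> T \<and> joined (T - {{a, b}}) u a \<and> joined (T - {{a, b}}) u (g b))" for b
    have "b \<in> away T Z u \<Longrightarrow> H b" for b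
    proof (induction rule: away.induct)
      case start
      then show ?case by (simp add: H_def uv(1))
    next
      case (move a b)
      have ab: "{a, b} \<in> T" "a \<in> V" "b \<in> V"
        using move(2) WZ by (auto simp: induced_def)
      have ua: "joined (T - {{a, b}}) u x \<longleftrightarrow> joined (T - {{a, b}}) a x" for x
        using joined_trans[OF move(3)] joined_trans[OF joined_sym[OF move(3)]] by blast
      \<comment> \<open>As no exchange is possible at \<open>{a, b}\<close>, the gate of
        \<open>b\<close> is on the side of \<open>a\<close> whenever the gate of \<open>a\<close>
        is.\<close>
      have next_gate: "H b" if "joined (T - {{a, b}}) u (g a)" "\<not> {a, b} \<subseteq> W"
        using contr move(2,3) ab that ua unfolding H_def by blast
      show ?case
      proof (cases "a \<in> W \<and> joined (induced T W) u a")
        case True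
        show ?thesis
        proof (cases "{a, b} \<subseteq> W")
          case True
          then have "joined (induced T W) a b" using ab by (intro joined_edge) (simp add: induced_def)
          then show ?thesis
            using True \<open>a \<in> W \<and> joined (induced T W) u a\<close> joined_trans[of "induced T W" u a b]
            unfolding H_def by blast
        next
          case False
          then show ?thesis using next_gate True g(3)[OF ab(2)] move(3) by simp
        qed
      next
        case False
        then obtain a' where a': "{a', a} \<in> T" "joined (T - {{a', a}}) u a'"
            "joined (T - {{a', a}}) u (g a)"
          using move(4) unfolding H_def by blast
        have a: "\<not> joined (T - {{a', a}}) u a"
          using a'(1) dT(4) joined_trans[OF joined_sym[OF a'(2)]] unfolding forest_def by blast
        \<comment> \<open>A vertex of \<open>W\<close> is its own gate, and \<open>a\<close> is
          beyond the last edge, not on the side of \<open>u\<close>.\<close>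
        have aW: "a \<notin> W"
        proof
          assume "a \<in> W"
          then have "g a = a" using g(3) ab(2) by simp
          then show False using a'(3) a by simp
        qed
        have ne: "{a', a} \<noteq> {a, b}"
        proof
          assume eq: "{a', a} = {a, b}"
          then show False using a move(3) by simp
        qed
        have "joined (T - {{a', a}} - {{a, b}}) u (g a)"
          by (rule joined_avoid[OF a'(3) a]) (simp add: ab ne[symmetric])
        then have "joined (T - {{a, b}}) u (g a)" by (rule joined_mono) auto
        then show ?thesis using next_gate aW by simp
      qed
    qed
    moreover have "v \<in> away T Z u"
      using Z uv WZ by (intro joined_away[OF dT(4)]) (auto simp: connected_on_joined)
    ultimately have "H v" by blast
    then obtain a where a: "{a, v} \<in> T" "joined (T - {{a, v}}) u a" "joined (T - {{a, v}}) u (g v)"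
      using uv(3) unfolding H_def by blast
    moreover have "g v = v" using g(3) uv(2) WZ by auto
    ultimately have "joined (T - {{a, v}}) a v"
      using joined_trans[OF joined_sym[OF a(2)]] by simp
    then show False using dT(4) a(1) by (auto simp: forest_def)
  qed
  then obtain a b where ab: "{a, b} \<in> induced T Z" "\<not> {a, b} \<subseteq> W"
    "joined (T - {{a, b}}) a (g a)" "\<not> joined (T - {{a, b}}) a (g b)" by blast
  then have ab': "{a, b} \<in> T" "a \<in> V" "b \<in> V" using WZ by (auto simp: induced_def)
  have "joined (induced T' W) (g a) (g b)"
    using W' g(1) ab' by (simp add: connected_on_joined)
  \<comment> \<open>\<open>F\<close> is the connected graph of \<open>T'\<close> on
    \<open>W\<close>, entered at the gates of \<open>a\<close> and \<open>b\<close>, so the new edge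
    lies inside \<open>W\<close>.\<close>
  from tree_exchange[OF assms(1) T T' ab'(1) _ this g(2)[OF ab'(2)] g(2)[OF ab'(3)] ab(3,4)]
  show ?thesis
    using that[OF ab(1,2)] by (auto simp: induced_def)
qed

section \<open>Consequences of the linear program\<close>

text \<open>Cut weights as sums over all edges: linear relations between cuts can then be checked
  edge by edge.\<close>

lemma sum_cut:
  assumes "finite V"
  shows "sum x (cut V U) = (\<Sum>e \<in> complete_edges V. if card (e \<inter> U) = 1 then x e else 0)"
  unfolding cut_def using finite_complete_edges[OF assms] by (rule sum.inter_filter)

lemma sum_complete_edges:
  assumes "finite V" "W \<subseteq> V"
  shows "sum x (complete_edges W) = (\<Sum>e \<in> complete_edges V. if e \<subseteq> W then x e else 0)"
proof -
  have "complete_edges W = {e \<in> complete_edges V. e \<subseteq> W}"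
    using assms(2) by (auto simp: complete_edges_def)
  then show ?thesis by (simp only: sum.inter_filter[OF finite_complete_edges[OF assms(1)]])
qed

text \<open>Handshake count: an edge inside \<open>W\<close> is met at both ends, an edge of the cut
  at one.\<close>

lemma sum_degrees:
  fixes x :: "'a set \<Rightarrow> real"
  assumes "finite V" "W \<subseteq> V"
  shows "(\<Sum>v \<in> W. sum x (cut V {v})) = sum x (cut V W) + 2 * sum x (complete_edges W)"
proof -
  have W: "finite W" using assms finite_subset by blast
  have "(\<Sum>v \<in> W. sum x (cut V {v})) =
      (\<Sum>e \<in> complete_edges V. \<Sum>v \<in> W. if card (e \<inter> {v}) = 1 then x e else 0)"
    unfolding sum_cut[OF assms(1)] by (rule sum.swap)
  also have "\<dots> = (\<Sum>e \<in> complete_edges V.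
      (if card (e \<inter> W) = 1 then x e else 0) + 2 * (if e \<subseteq> W then x e else 0))"
  proof (rule sum.cong[OF refl])
    fix e assume "e \<in> complete_edges V"
    then obtain u v where e: "e = {u, v}" "u \<noteq> v" by (rule complete_edgesE)
    have "(\<Sum>w \<in> W. if card (e \<inter> {w}) = 1 then x e else 0) =
        (\<Sum>w \<in> W. (if w = u then x e else 0) + (if w = v then x e else 0))"
      by (rule sum.cong[OF refl]) (use e in auto)
    also have "\<dots> = (if u \<in> W then x e else 0) + (if v \<in> W then x e else 0)"
      using W by (simp add: sum.distrib sum.delta)
    finally show "(\<Sum>w \<in> W. if card (e \<inter> {w}) = 1 then x e else 0) =
        (if card (e \<inter> W) = 1 then x e else 0) + 2 * (if e \<subseteq> W then x e else 0)"
      using card_edge_cut[OF e(2), of W] e(1) by auto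
  qed
  also have "\<dots> = sum x (cut V W) + 2 * sum x (complete_edges W)"
    by (simp only: sum.distrib sum_distrib_left[symmetric] sum_cut[OF assms(1)]
        sum_complete_edges[OF assms])
  finally show ?thesis .
qed

text \<open>Posimodularity of the cut function: edges from \<open>A \<inter> B\<close> to the
  outside of both sets are counted on the right only, all others equally often.\<close>

lemma cut_uncross:
  fixes x :: "'a set \<Rightarrow> real"
  assumes "finite V" "\<forall>e \<in> complete_edges V. x e \<ge> 0"
  shows "sum x (cut V (A - B)) + sum x (cut V (B - A)) \<le> sum x (cut V A) + sum x (cut V B)"
  unfolding sum_cut[OF assms(1)] sum.distrib[symmetric]
proof (rule sum_mono)
  fix e assume e: "e \<in> complete_edges V"
  then obtain u v where uv: "e = {u, v}" "u \<noteq> v" by (rule complete_edgesE)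
  show "(if card (e \<inter> (A - B)) = 1 then x e else 0) + (if card (e \<inter> (B - A)) = 1 then x e else 0)
      \<le> (if card (e \<inter> A) = 1 then x e else 0) + (if card (e \<inter> B) = 1 then x e else 0)"
    using assms(2) e unfolding uv(1) card_edge_cut[OF uv(2)] by auto
qed

text \<open>For nested sets, uncrossing has an exact error term: the edges in both cuts are those
  from \<open>A\<close> to the complement of \<open>B\<close>, and these miss
  \<open>B - A\<close>.\<close>

lemma cut_nested:
  fixes x :: "'a set \<Rightarrow> real"
  assumes "finite V" "A \<subseteq> B"
  shows "sum x (cut V (B - A)) + 2 * sum x (cut V A \<inter> cut V B) = sum x (cut V A) + sum x (cut V B)"
proof -
  have "cut V A \<inter> cut V B = {e \<in> complete_edges V. card (e \<inter> A) = 1 \<and> card (e \<inter> B) = 1}"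
    by (auto simp: cut_def)
  then have I: "sum x (cut V A \<inter> cut V B) =
      (\<Sum>e \<in> complete_edges V. if card (e \<inter> A) = 1 \<and> card (e \<inter> B) = 1 then x e else 0)"
    by (simp only: sum.inter_filter[OF finite_complete_edges[OF assms(1)]])
  show ?thesis
    unfolding I sum_cut[OF assms(1)] sum_distrib_left sum.distrib[symmetric]
  proof (rule sum.cong[OF refl])
    fix e assume "e \<in> complete_edges V"
    then obtain u v where uv: "e = {u, v}" "u \<noteq> v" by (rule complete_edgesE)
    show "(if card (e \<inter> (B - A)) = 1 then x e else 0) +
        2 * (if card (e \<inter> A) = 1 \<and> card (e \<inter> B) = 1 then x e else 0) =
        (if card (e \<inter> A) = 1 then x e else 0) + (if card (e \<inter> B) = 1 then x e else 0)"
      using assms(2) unfolding uv(1) card_edge_cut[OF uv(2)] by auto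
  qed
qed

locale reassembly =
  fixes V :: "'a set" and s t :: 'a and xs :: "'a set \<Rightarrow> real" and eps :: real
    and r :: nat and S0 :: "nat \<Rightarrow> 'a set set"
  assumes inst: "reassembly_instance V s t xs eps r S0"
begin

lemma basic:
  shows fin: "finite V" and sV: "s \<in> V" and tV: "t \<in> V" and st: "s \<noteq> t"
    and eps: "eps \<ge> 0" and r: "r \<ge> 1" and V: "V \<noteq> {}"
    and xs_nonneg: "\<forall>e \<in> complete_edges V. xs e \<ge> 0"
  using inst by (auto simp: reassembly_instance_def lp_feasible_def)

lemma cut_ge_2: "U \<noteq> {} \<Longrightarrow> U \<subset> V \<Longrightarrow> (s \<in> U \<longleftrightarrow> t \<in> U) \<Longrightarrow> sum xs (cut V U) \<ge> 2"
proof -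
  assume U: "U \<noteq> {}" "U \<subset> V" "s \<in> U \<longleftrightarrow> t \<in> U"
  have "card (U \<inter> {s, t}) = (if s \<in> U then 2 else 0)"
    using U(3) st by (auto simp: Int_insert_right)
  then show ?thesis using U inst by (auto simp: reassembly_instance_def lp_feasible_def)
qed

lemma cut_ge_1: "U \<noteq> {} \<Longrightarrow> U \<subset> V \<Longrightarrow> sum xs (cut V U) \<ge> 1"
proof (cases "even (card (U \<inter> {s, t}))")
  case True
  moreover assume "U \<noteq> {}" "U \<subset> V"
  ultimately have "sum xs (cut V U) \<ge> 2"
    using inst by (auto simp: reassembly_instance_def lp_feasible_def)
  then show ?thesis by simp
qed (use inst in \<open>auto simp: reassembly_instance_def lp_feasible_def\<close>)

lemma degrees: "v \<in> V \<Longrightarrow> sum xs (cut V {v}) = (if v = s \<or> v = t then 1 else 2)"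
  using inst by (auto simp: reassembly_instance_def lp_feasible_def)

text \<open>Handshake count with the degrees prescribed by the linear program; since
  \<open>t\<close> is outside, only \<open>s\<close> can have degree 1.\<close>

lemma sum_inner:
  assumes "M \<subseteq> V" "t \<notin> M"
  shows "2 * sum xs (complete_edges M) =
    2 * real (card M) - (if s \<in> M then 1 else 0) - sum xs (cut V M)"
proof -
  have finM: "finite M" using fin assms(1) finite_subset by blast
  have "(\<Sum>v \<in> M. sum xs (cut V {v})) = (\<Sum>v \<in> M. 2 - (if v = s then 1 else 0))"
    by (rule sum.cong[OF refl]) (use degrees assms in auto)
  also have "\<dots> = 2 * real (card M) - (if s \<in> M then 1 else 0)"
    using finM by (simp add: sum_subtractf sum.delta)
  finally show ?thesis using sum_degrees[OF fin assms(1), of xs] by simp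
qed

text \<open>All counting arguments refer to the current sequence only through these two conditions,
  so they can be repeated after every exchange.\<close>

definition ok :: "(nat \<Rightarrow> 'a set set) \<Rightarrow> bool" where
  "ok S \<longleftrightarrow> (\<forall>k \<in> {1..r}. S k \<in> spanning_trees V) \<and>
     (\<forall>e \<in> complete_edges V. tree_average r S e = tree_average r S0 e)"

lemma ok_S0: "ok S0"
  using inst by (auto simp: reassembly_instance_def ok_def)

lemma ok_tree: "ok S \<Longrightarrow> k \<in> {1..r} \<Longrightarrow> S k \<in> spanning_trees V"
  by (simp add: ok_def)

lemmas treeD = spanning_treeD[OF fin V]

text \<open>Double counting of the pairs of a tree and one of its edges in \<open>F\<close>.\<close>

lemma sum_card_trees:
  assumes "ok S" "F \<subseteq> complete_edges V"
  shows "(\<Sum>k = 1..r. real (card (S k \<inter> F))) = real r * sum (tree_average r S0) F"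
proof -
  have F: "finite F" using assms(2) finite_complete_edges[OF fin] finite_subset by blast
  have "sum (tree_average r S0) F = sum (tree_average r S) F"
    by (rule sum.cong[OF refl]) (use assms in \<open>auto simp: ok_def\<close>)
  then have "real r * sum (tree_average r S0) F = (\<Sum>e \<in> F. \<Sum>k = 1..r. indicator (S k) e)"
    using r by (simp add: tree_average_def sum_distrib_left)
  also have "\<dots> = (\<Sum>k = 1..r. \<Sum>e \<in> F. indicator (S k) e)"
    by (rule sum.swap)
  also have "\<dots> = (\<Sum>k = 1..r. real (card (S k \<inter> F)))"
    by (rule sum.cong[OF refl])
      (use F in \<open>simp add: indicator_def sum.If_cases Int_commute\<close>)
  finally show ?thesis by simp
qed

lemma trees_upper:
  assumes "ok S" "F \<subseteq> complete_edges V"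
  shows "(\<Sum>k = 1..r. real (card (S k \<inter> F))) \<le> real r * (sum xs F + eps)"
  unfolding sum_card_trees[OF assms]
  using inst assms(2) by (intro mult_left_mono) (auto simp: reassembly_instance_def)

lemma trees_lower:
  assumes "ok S" "F \<subseteq> complete_edges V"
  shows "(\<Sum>k = 1..r. real (card (S k \<inter> F))) \<ge> real r * (sum xs F - eps)"
  unfolding sum_card_trees[OF assms]
  using inst assms(2) by (intro mult_left_mono) (auto simp: reassembly_instance_def)

definition rel :: "nat \<Rightarrow> 'a set set" where
  "rel j = {U. U \<subset> V \<and> s \<in> U \<and> real j - 1 < real r * (2 - sum xs (cut V U) - eps)}"

lemma relD:
  assumes "U \<in> rel j" "j \<ge> 1"
  shows "U \<subset> V" "s \<in> U" "t \<notin> U" "U \<noteq> {}" "sum xs (cut V U) + eps < 2"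
    "real r * (sum xs (cut V U) + eps) < 2 * real r - (real j - 1)"
proof -
  show 1: "U \<subset> V" "s \<in> U" "U \<noteq> {}" using assms by (auto simp: rel_def)
  have j: "real j - 1 < real r * (2 - sum xs (cut V U) - eps)" using assms by (simp add: rel_def)
  then have "0 < real r * (2 - sum xs (cut V U) - eps)" using assms(2) by linarith
  then show lt: "sum xs (cut V U) + eps < 2" by (simp add: zero_less_mult_iff)
  show "t \<notin> U" using cut_ge_2[OF 1(3,1)] 1(2) lt eps by fastforce
  show "real r * (sum xs (cut V U) + eps) < 2 * real r - (real j - 1)"
    using j by (simp add: algebra_simps)
qed

text \<open>Both differences avoid \<open>s\<close>, which is in both sets, and \<open>t\<close>,
  which is in neither. If nonempty, each would have cut weight at least 2, while the two cuts
  together weigh less than 4.\<close>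

lemma rel_chain:
  assumes "A \<in> rel j" "B \<in> rel j" "j \<ge> 1"
  shows "A \<subseteq> B \<or> B \<subseteq> A"
proof (rule ccontr)
  assume "\<not> ?thesis"
  then have ne: "A - B \<noteq> {}" "B - A \<noteq> {}" by auto
  note A = relD[OF assms(1,3)] and B = relD[OF assms(2,3)]
  have "sum xs (cut V (A - B)) \<ge> 2" "sum xs (cut V (B - A)) \<ge> 2"
    by (rule cut_ge_2; use A B ne in auto)+
  then show False
    using cut_uncross[OF fin xs_nonneg, of A B] A(5) B(5) eps by simp
qed

lemma pick_later_tree:
  fixes g :: "nat \<Rightarrow> nat"
  assumes "(\<Sum>k = 1..r. real (g k)) < real r - (real j - 1)" "1 \<le> j" "j \<le> r" "g j \<noteq> 0"
  obtains k where "j < k" "k \<le> r" "g k = 0"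
proof -
  have "\<exists>k. j < k \<and> k \<le> r \<and> g k = 0"
  proof (rule ccontr)
    assume contr: "\<not> ?thesis"
    have "real r - (real j - 1) = (\<Sum>k = j..r. 1)" using assms(3) by (simp add: of_nat_diff)
    also have "\<dots> \<le> (\<Sum>k = j..r. real (g k))"
    proof (rule sum_mono)
      fix k assume "k \<in> {j..r}"
      then have "g k \<noteq> 0" using contr assms(4) by (cases "k = j") auto
      then show "1 \<le> real (g k)" by simp
    qed
    also have "\<dots> \<le> (\<Sum>k = 1..r. real (g k))"
      by (rule sum_mono2) (use assms(2) in auto)
    finally show False using assms(1) by simp
  qed
  then show ?thesis using that by blast
qed

lemma tree_crosses:
  assumes "ok S" "k \<in> {1..r}" "U \<noteq> {}" "U \<subset> V"
  shows "card (S k \<inter> cut V U) \<ge> 1"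
  using tree_meets_cut[OF fin ok_tree[OF assms(1,2)] assms(3,4)] treeD(5)[OF ok_tree[OF assms(1,2)]]
  by (simp add: Suc_le_eq card_gt_0_iff)

lemma pick_crossing:
  assumes "ok S" "U \<in> rel j" "1 \<le> j" "j \<le> r" "card (S j \<inter> cut V U) \<noteq> 1"
  obtains k where "j < k" "k \<le> r" "card (S k \<inter> cut V U) = 1"
proof -
  note U = relD[OF assms(2,3)]
  note ge = tree_crosses[OF assms(1) _ U(4,1)]
  \<comment> \<open>The truncated subtraction is exact because every spanning tree meets the
    cut.\<close>
  have "(\<Sum>k = 1..r. real (card (S k \<inter> cut V U) - 1)) = (\<Sum>k = 1..r. real (card (S k \<inter> cut V U)) - 1)"
    by (rule sum.cong[OF refl]) (use ge in \<open>simp add: of_nat_diff\<close>)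
  also have "\<dots> = (\<Sum>k = 1..r. real (card (S k \<inter> cut V U))) - real r"
    by (simp add: sum_subtractf)
  also have "\<dots> < real r - (real j - 1)"
    using trees_upper[OF assms(1) cut_subset, of U] U(6) by simp
  finally have *: "(\<Sum>k = 1..r. real (card (S k \<inter> cut V U) - 1)) < real r - (real j - 1)" .
  have "card (S j \<inter> cut V U) - 1 \<noteq> 0"
    using assms(5) ge[of j] assms(3,4) by simp
  from pick_later_tree[of "\<lambda>k. card (S k \<inter> cut V U) - 1", OF * assms(3,4) this]
  obtain k where "j < k" "k \<le> r" "card (S k \<inter> cut V U) - 1 = 0" .
  moreover from this have "card (S k \<inter> cut V U) = 1" using ge[of k] assms(3) by simp
  ultimately show ?thesis using that by blast
qed

text \<open>The mean of the two relevance conditions, lowered by \<open>r\<close>. The left side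
  bounds the number of jumping edges as well as the number of edges missing in \<open>B - A\<close>,
  summed over the trees.\<close>

lemma nested_bound:
  assumes "A \<in> rel j" "B \<in> rel j" "A \<subset> B" "1 \<le> j"
  shows "real r * ((sum xs (cut V A) + sum xs (cut V B)) / 2 - 1 + eps) < real r - (real j - 1)"
proof -
  have "real r * ((sum xs (cut V A) + sum xs (cut V B)) / 2 - 1 + eps) =
      (real r * (sum xs (cut V A) + eps) + real r * (sum xs (cut V B) + eps)) / 2 - real r"
    by (simp add: field_simps)
  moreover have "(x + y) / 2 - real r < real r - (real j - 1)"
    if "x < 2 * real r - (real j - 1)" "y < 2 * real r - (real j - 1)" for x y
    using that by (simp add: field_simps)
  ultimately show ?thesis
    using relD(6)[OF assms(1,4)] relD(6)[OF assms(2,4)] by simp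
qed

text \<open>\<open>B - A\<close> contains neither \<open>s\<close> nor \<open>t\<close>, so its cut
  weighs at least 2, and by \<open>cut_nested\<close> the jumping edges weigh at most the mean of
  the two cuts minus 1.\<close>

lemma pick_no_jump:
  assumes "ok S" "A \<in> rel j" "B \<in> rel j" "A \<subset> B" "1 \<le> j" "j \<le> r"
    and "S j \<inter> (cut V A \<inter> cut V B) \<noteq> {}"
  obtains k where "j < k" "k \<le> r" "S k \<inter> (cut V A \<inter> cut V B) = {}"
proof -
  let ?I = "cut V A \<inter> cut V B"
  note A = relD[OF assms(2,5)] and B = relD[OF assms(3,5)]
  have I: "?I \<subseteq> complete_edges V" using cut_subset by auto
  have "sum xs (cut V (B - A)) \<ge> 2"
    by (rule cut_ge_2) (use A B assms(4) in auto)
  then have "sum xs ?I \<le> (sum xs (cut V A) + sum xs (cut V B)) / 2 - 1"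
    using cut_nested[OF fin psubset_imp_subset[OF assms(4)], of xs] by (simp add: field_simps)
  then have "real r * (sum xs ?I + eps) \<le>
      real r * ((sum xs (cut V A) + sum xs (cut V B)) / 2 - 1 + eps)"
    by (intro mult_left_mono) auto
  then have *: "(\<Sum>k = 1..r. real (card (S k \<inter> ?I))) < real r - (real j - 1)"
    using trees_upper[OF assms(1) I] nested_bound[OF assms(2-5)] by simp
  have fin_S: "finite (S k)" if "k \<in> {1..r}" for k
    using treeD(5)[OF ok_tree[OF assms(1) that]] .
  have "card (S j \<inter> ?I) \<noteq> 0"
    using assms(5-7) fin_S[of j] by simp
  from pick_later_tree[of "\<lambda>k. card (S k \<inter> ?I)", OF * assms(5,6) this]
  obtain k where "j < k" "k \<le> r" "card (S k \<inter> ?I) = 0" .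
  moreover from this have "S k \<inter> ?I = {}" using fin_S[of k] assms(5) by simp
  ultimately show ?thesis using that by blast
qed

lemma pick_connected:
  assumes "ok S" "B \<in> rel j" "A = {} \<or> A \<in> rel j" "A \<subset> B" "1 \<le> j" "j \<le> r"
    and "\<not> connected_on (B - A) (induced (S j) (B - A))"
  obtains k where "j < k" "k \<le> r" "connected_on (B - A) (induced (S k) (B - A))"
proof -
  let ?M = "B - A"
  note B = relD[OF assms(2,5)]
  have M: "?M \<noteq> {}" "?M \<subset> V" "t \<notin> ?M" "?M \<subseteq> V" using B assms(4) by auto
  have finM: "finite ?M" using fin M(4) finite_subset by blast
  have E: "complete_edges ?M \<subseteq> complete_edges V" using M(4) by (auto simp: complete_edges_def)
  have bound: "real r * (real (card ?M) - 1 - sum xs (complete_edges ?M) + eps)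
      < real r - (real j - 1)"
  \<comment> \<open>\<open>B - A\<close> contains \<open>s\<close> exactly if \<open>A\<close> is
    empty. Then the fractional deficit is half of \<open>sum xs (cut V B) - 1\<close>; otherwise it
    is half the weight of the cut of \<open>B - A\<close>, minus 1.\<close>
  proof (cases "A = {}")
    case True
    have "real (card ?M) - 1 - sum xs (complete_edges ?M) + eps =
        sum xs (cut V B) / 2 - 1 / 2 + eps"
      using sum_inner[OF M(4,3)] True B(2) by simp
    \<comment> \<open>The factor one half may be dropped since the cut weighs at least 1.\<close>
    also have "\<dots> \<le> sum xs (cut V B) + eps - 1"
      using cut_ge_1[OF B(4,1)] by simp
    finally have "real r * (real (card ?M) - 1 - sum xs (complete_edges ?M) + eps)
        \<le> real r * (sum xs (cut V B) + eps - 1)"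
      by (intro mult_left_mono) auto
    then show ?thesis using B(6) by (simp add: algebra_simps)
  next
    case False
    then have A: "A \<in> rel j" using assms(3) by simp
    have "sum xs (cut V A \<inter> cut V B) \<ge> 0"
      by (rule sum_nonneg) (use xs_nonneg cut_subset in blast)
    then have "sum xs (cut V ?M) \<le> sum xs (cut V A) + sum xs (cut V B)"
      using cut_nested[OF fin psubset_imp_subset[OF assms(4)], of xs] by (simp add: field_simps)
    then have "real (card ?M) - 1 - sum xs (complete_edges ?M) + eps \<le>
        (sum xs (cut V A) + sum xs (cut V B)) / 2 - 1 + eps"
      using sum_inner[OF M(4,3)] relD(2)[OF A assms(5)] by simp
    then have "real r * (real (card ?M) - 1 - sum xs (complete_edges ?M) + eps) \<le>
        real r * ((sum xs (cut V A) + sum xs (cut V B)) / 2 - 1 + eps)"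
      by (intro mult_left_mono) auto
    then show ?thesis using nested_bound[OF A assms(2,4,5)] by simp
  qed
  have ind: "induced (S k) ?M = S k \<inter> complete_edges ?M" if "k \<in> {1..r}" for k
    using treeD(1)[OF ok_tree[OF assms(1) that]] induced_complete[of "S k" V ?M]
    by (auto simp: induced_def complete_edges_def)
  have le: "card (induced (S k) ?M) + 1 \<le> card ?M"
    and eq: "card (induced (S k) ?M) + 1 = card ?M \<longleftrightarrow> connected_on ?M (induced (S k) ?M)"
    if "k \<in> {1..r}" for k
    using forest_card_induced[OF finM M(1) treeD(4,1)[OF ok_tree[OF assms(1) that]]] by auto
  define g where "g k = card ?M - 1 - card (induced (S k) ?M)" for k
  have "(\<Sum>k = 1..r. real (g k)) =
      (\<Sum>k = 1..r. real (card ?M) - 1 - real (card (S k \<inter> complete_edges ?M)))"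
  proof (rule sum.cong[OF refl])
    fix k assume k: "k \<in> {1..r}"
    show "real (g k) = real (card ?M) - 1 - real (card (S k \<inter> complete_edges ?M))"
      using le[OF k] unfolding g_def ind[OF k, symmetric] by (simp add: of_nat_diff)
  qed
  also have "\<dots> = real r * (real (card ?M) - 1) - (\<Sum>k = 1..r. real (card (S k \<inter> complete_edges ?M)))"
    by (simp add: sum_subtractf sum.distrib algebra_simps)
  \<comment> \<open>The deficit falls with the number of inner edges, so here the lower estimate of
    the average is needed.\<close>
  also have "\<dots> \<le> real r * (real (card ?M) - 1 - sum xs (complete_edges ?M) + eps)"
    using trees_lower[OF assms(1) E] by (simp add: algebra_simps)
  also note bound
  finally have *: "(\<Sum>k = 1..r. real (g k)) < real r - (real j - 1)" .
  have "g j \<noteq> 0"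
    using assms(5-7) le[of j] eq[of j] by (auto simp: g_def)
  from pick_later_tree[of g, OF * assms(5,6) this]
  obtain k where k: "j < k" "k \<le> r" "g k = 0" .
  then have "connected_on ?M (induced (S k) ?M)"
    using assms(5) le[of k] eq[of k] by (auto simp: g_def)
  then show ?thesis using k that by blast
qed

section \<open>The chain of relevant cuts\<close>

text \<open>In a chain, the sets missing \<open>v\<close> are the smallest ones, so their number
  locates \<open>v\<close>; one integer per vertex encodes the whole chain, which is how the program
  stores it. With \<open>q = card (rel j)\<close>, \<open>lev j p\<close> is the \<open>p\<close>-th
  set for \<open>1 \<le> p \<le> q\<close>, empty for \<open>p = 0\<close>, and \<open>V\<close> for
  \<open>p > q\<close>.\<close>

definition rk :: "nat \<Rightarrow> 'a \<Rightarrow> nat" where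
  "rk j v = card {U \<in> rel j. v \<notin> U}"

definition lev :: "nat \<Rightarrow> nat \<Rightarrow> 'a set" where
  "lev j p = {v \<in> V. rk j v < p}"

lemma finite_rel: "finite (rel j)"
  by (rule finite_subset[of _ "Pow V"]) (use fin in \<open>auto simp: rel_def\<close>)

lemma lev_0 [simp]: "lev j 0 = {}"
  by (simp add: lev_def)

lemma lev_mono: "p \<le> p' \<Longrightarrow> lev j p \<subseteq> lev j p'"
  by (auto simp: lev_def)

lemma lev_subset: "lev j p \<subseteq> V"
  by (auto simp: lev_def)

text \<open>The index of \<open>U\<close> counts \<open>U\<close> itself. A vertex of
  \<open>U\<close> is missed only by proper subsets of \<open>U\<close>, and a vertex outside by all
  sets up to \<open>U\<close>.\<close>

lemma rel_lev:
  assumes "U \<in> rel j" "1 \<le> j"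
  shows "lev j (card {U' \<in> rel j. U' \<subseteq> U}) = U"
proof -
  have "rk j v < card {U' \<in> rel j. U' \<subseteq> U} \<longleftrightarrow> v \<in> U" if "v \<in> V" for v
  proof
    assume "v \<in> U"
    then have "{U' \<in> rel j. v \<notin> U'} \<subset> {U' \<in> rel j. U' \<subseteq> U}"
      using rel_chain[OF assms(1) _ assms(2)] assms(1) by auto
    then show "rk j v < card {U' \<in> rel j. U' \<subseteq> U}"
      unfolding rk_def by (rule psubset_card_mono[rotated]) (simp add: finite_rel)
  next
    assume less: "rk j v < card {U' \<in> rel j. U' \<subseteq> U}"
    show "v \<in> U"
    proof (rule ccontr)
      assume "v \<notin> U"
      then have "{U' \<in> rel j. U' \<subseteq> U} \<subseteq> {U' \<in> rel j. v \<notin> U'}" by auto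
      then have "card {U' \<in> rel j. U' \<subseteq> U} \<le> rk j v"
        unfolding rk_def by (rule card_mono[rotated]) (simp add: finite_rel)
      then show False using less by simp
    qed
  qed
  moreover have "U \<subseteq> V" using relD(1)[OF assms] by auto
  ultimately show ?thesis unfolding lev_def by blast
qed

text \<open>Injectivity comes from \<open>rel_lev\<close>, which recovers a set from its number;
  surjectivity then follows by cardinality.\<close>

lemma card_below:
  assumes "1 \<le> j"
  shows "bij_betw (\<lambda>U. card {U' \<in> rel j. U' \<subseteq> U}) (rel j) {1..card (rel j)}"
proof -
  let ?c = "\<lambda>U. card {U' \<in> rel j. U' \<subseteq> U}"
  have inj: "inj_on ?c (rel j)"
  proof (rule inj_onI)
    fix U U' assume U: "U \<in> rel j" "U' \<in> rel j" and eq: "?c U = ?c U'"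
    show "U = U'"
      using arg_cong[OF eq, of "lev j"] unfolding rel_lev[OF U(1) assms] rel_lev[OF U(2) assms] .
  qed
  have "?c ` rel j \<subseteq> {1..card (rel j)}"
  proof
    fix c assume "c \<in> ?c ` rel j"
    then obtain U where U: "U \<in> rel j" "c = ?c U" by auto
    have "?c U \<le> card (rel j)" by (rule card_mono) (auto simp: finite_rel)
    moreover have "?c U > 0" using U(1) finite_rel by (auto simp: card_gt_0_iff)
    ultimately show "c \<in> {1..card (rel j)}" using U(2) by simp
  qed
  then have "?c ` rel j = {1..card (rel j)}"
    by (rule card_subset_eq[rotated]) (simp_all add: card_image[OF inj])
  then show ?thesis using inj by (simp add: bij_betw_def)
qed

lemma lev_rel:
  assumes "1 \<le> j" "1 \<le> p" "p \<le> card (rel j)"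
  shows "lev j p \<in> rel j"
proof -
  have "p \<in> (\<lambda>U. card {U' \<in> rel j. U' \<subseteq> U}) ` rel j"
    using card_below[OF assms(1)] assms(2,3) by (simp add: bij_betw_def)
  then show ?thesis using rel_lev assms(1) by auto
qed

lemma lev_strict:
  assumes "1 \<le> j" "p < p'" "p' \<le> card (rel j)"
  shows "lev j p \<subset> lev j p'"
proof (cases "p = 0")
  case True
  then show ?thesis using relD(4)[OF lev_rel[of j p'] assms(1)] assms by auto
next
  case False
  let ?c = "\<lambda>U. card {U' \<in> rel j. U' \<subseteq> U}"
  have "{p, p'} \<subseteq> ?c ` rel j"
    using card_below[OF assms(1)] assms(2,3) False by (auto simp: bij_betw_def)
  then obtain U U' where "U \<in> rel j" "U' \<in> rel j" "p = ?c U" "p' = ?c U'" by auto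
  then have "lev j p \<noteq> lev j p'"
    using rel_lev[OF _ assms(1)] assms(2) by force
  then show ?thesis using lev_mono[of p p' j] assms(2) by auto
qed

lemma rk_le: "rk j v \<le> card (rel j)"
  unfolding rk_def by (rule card_mono) (auto simp: finite_rel)

lemma lev_top: "p > card (rel j) \<Longrightarrow> lev j p = V"
  using rk_le[of j] by (auto simp: lev_def intro: le_less_trans)

end

section \<open>Exchange phases\<close>

text \<open>Only later trees take part, so finished trees stay untouched. Equal edges are not
  forbidden here; they are ruled out where \<open>X\<close> is disjoint from \<open>Y\<close> or
  from \<open>Z\<close>.\<close>

definition xstep ::
  "'a set \<Rightarrow> nat \<Rightarrow> nat \<Rightarrow> 'a set \<Rightarrow> 'a set \<Rightarrow> 'a set \<Rightarrow> (nat \<Rightarrow> 'a set set) \<Rightarrow> (nat \<Rightarrow> 'a set set) \<Rightarrow> bool"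
  where
  "xstep V r j X Y Z S S' \<longleftrightarrow> (\<exists>k u v x y. j < k \<and> k \<le> r \<and> {u, v} \<in> S j \<and> {x, y} \<in> S k \<and>
     x \<in> X \<and> y \<in> X \<and> u \<in> Y \<and> v \<in> Z \<and>
     insert {x, y} (S j - {{u, v}}) \<in> spanning_trees V \<and>
     insert {u, v} (S k - {{x, y}}) \<in> spanning_trees V \<and>
     S' = S(j := insert {x, y} (S j - {{u, v}}), k := insert {u, v} (S k - {{x, y}})))"

lemma xstepI:
  assumes "j < k" "k \<le> r" "{u, v} \<in> S j" "{x, y} \<in> S k" "x \<in> X" "y \<in> X" "u \<in> Y" "v \<in> Z"
    "insert {x, y} (S j - {{u, v}}) \<in> spanning_trees V"
    "insert {u, v} (S k - {{x, y}}) \<in> spanning_trees V"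
  shows "\<exists>S'. xstep V r j X Y Z S S'"
  using assms unfolding xstep_def by blast

text \<open>A relation and not a function, so that every search order realizes it; the program need
  not imitate a fixed choice of exchanges.\<close>

definition phase ::
  "'a set \<Rightarrow> nat \<Rightarrow> nat \<Rightarrow> 'a set \<Rightarrow> 'a set \<Rightarrow> 'a set \<Rightarrow> (nat \<Rightarrow> 'a set set) \<Rightarrow> (nat \<Rightarrow> 'a set set) \<Rightarrow> bool"
  where
  "phase V r j X Y Z S S' \<longleftrightarrow>
     (xstep V r j X Y Z)\<^sup>*\<^sup>* S S' \<and> (\<nexists>S''. xstep V r j X Y Z S' S'')"

lemma phase_preserves:
  assumes "phase V r j X Y Z S S'" "P S"
    and "\<And>S S'. P S \<Longrightarrow> xstep V r j X Y Z S S' \<Longrightarrow> P S'"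
  shows "P S'"
  using assms(1)[unfolded phase_def, THEN conjunct1] assms(2)
  by (induction rule: rtranclp_induct) (use assms(3) in auto)

text \<open>If \<open>f\<close> were in \<open>T\<close> already, the exchanged tree would have an
  edge less.\<close>

lemma swap_notin:
  assumes "finite V" "T \<in> spanning_trees V" "insert f (T - {e}) \<in> spanning_trees V" "e \<in> T" "e \<noteq> f"
  shows "f \<notin> T"
proof
  assume "f \<in> T"
  then have eq: "insert f (T - {e}) = T - {e}" using assms(5) by auto
  have V: "V \<noteq> {}" using assms(2,4) by (auto simp: spanning_trees_def complete_edges_def)
  have "card (T - {e}) < card T"
    using spanning_treeD(5)[OF assms(1) V assms(2)] assms(4) by (rule card_Diff1_less)
  then show False
    using spanning_treeD(3)[OF assms(1) V assms(2)] spanning_treeD(3)[OF assms(1) V assms(3)]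
    unfolding eq by simp
qed

context reassembly
begin

lemma xstep_ok:
  assumes "ok S" "xstep V r j X Y Z S S'" "1 \<le> j"
  shows "ok S'"
proof -
  obtain k u v x y where st: "j < k" "k \<le> r" "{u, v} \<in> S j" "{x, y} \<in> S k"
     "insert {x, y} (S j - {{u, v}}) \<in> spanning_trees V"
     "insert {u, v} (S k - {{x, y}}) \<in> spanning_trees V"
     "S' = S(j := insert {x, y} (S j - {{u, v}}), k := insert {u, v} (S k - {{x, y}}))"
    using assms(2) unfolding xstep_def by blast
  have jk: "j \<in> {1..r}" "k \<in> {1..r} - {j}" using st(1,2) assms(3) by auto
  have tr: "S' i \<in> spanning_trees V" if "i \<in> {1..r}" for i
    using st ok_tree[OF assms(1) that] by auto
  have tj: "S j \<in> spanning_trees V" and tk: "S k \<in> spanning_trees V"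
    using ok_tree[OF assms(1)] jk by auto
  \<comment> \<open>Each edge lost by one tree is gained by the other and was not there before, so
    the multiplicities agree; the average depends on nothing else.\<close>
  have two: "indicator (S' j) e + indicator (S' k) e =
      (indicator (S j) e + indicator (S k) e :: real)" for e
  proof (cases "{u, v} = {x, y}")
    case True
    then show ?thesis using st by (simp add: insert_absorb)
  next
    case False
    have "{x, y} \<notin> S j" by (rule swap_notin[OF fin tj st(5,3) False])
    moreover have "{u, v} \<notin> S k" by (rule swap_notin[OF fin tk st(6,4) False[symmetric]])
    ultimately show ?thesis using st(1,3,4,7) False by (simp add: indicator_def)
  qed
  have "(\<Sum>i = 1..r. indicator (S' i) e) = (\<Sum>i = 1..r. (indicator (S i) e :: real))" for e
  proof -
    have split: "(\<Sum>i = 1..r. g i) = g j + g k + (\<Sum>i \<in> {1..r} - {j} - {k}. g i)" for g :: "nat \<Rightarrow> real"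
      using jk by (subst sum.remove[of _ j]; simp; subst sum.remove[of _ k]; simp)
    have "(\<Sum>i \<in> {1..r} - {j} - {k}. indicator (S' i) e) =
        (\<Sum>i \<in> {1..r} - {j} - {k}. (indicator (S i) e :: real))"
      by (rule sum.cong[OF refl]) (use st(7) in auto)
    then show ?thesis using two[of e] by (simp only: split)
  qed
  then have "tree_average r S' = tree_average r S" by (simp add: tree_average_def)
  then show ?thesis using assms(1) tr by (simp add: ok_def)
qed

text \<open>Termination measure of a phase: the new edge is inside \<open>X\<close>, the old one has
  an end outside, and a spanning tree has fewer than \<open>card V\<close> edges.\<close>

lemma xstep_measure:
  assumes "ok S" "xstep V r j X Y Z S S'" "1 \<le> j" "X \<inter> Y = {} \<or> X \<inter> Z = {}"
  shows "card (induced (S' j) X) = Suc (card (induced (S j) X))"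
proof -
  obtain k u v x y where st: "j < k" "k \<le> r" "{u, v} \<in> S j" "{x, y} \<in> S k"
     "x \<in> X" "y \<in> X" "u \<in> Y" "v \<in> Z"
     "insert {x, y} (S j - {{u, v}}) \<in> spanning_trees V"
     "S' = S(j := insert {x, y} (S j - {{u, v}}), k := insert {u, v} (S k - {{x, y}}))"
    using assms(2) unfolding xstep_def by blast
  have tj: "S j \<in> spanning_trees V" using ok_tree[OF assms(1)] st(1,2) assms(3) by auto
  have out: "\<not> {u, v} \<subseteq> X" using st(7,8) assms(4) by auto
  have ne: "{u, v} \<noteq> {x, y}" using out st(5,6) by auto
  have notin: "{x, y} \<notin> S j" by (rule swap_notin[OF fin tj st(9,3) ne])
  have "induced (S' j) X = insert {x, y} (induced (S j) X)"
    using st(1,5,6,10) out by (auto simp: induced_def)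
  moreover have "{x, y} \<notin> induced (S j) X" using notin by (simp add: induced_def)
  moreover have "finite (induced (S j) X)" using treeD(5)[OF tj] by (simp add: induced_def)
  ultimately show ?thesis by simp
qed

lemma induced_card_less: "T \<in> spanning_trees V \<Longrightarrow> card (induced T X) < card V"
  using treeD(3,5)[of T] card_mono[of T "induced T X"] by (auto simp: induced_def)

lemma phase_exists:
  assumes "ok S" "1 \<le> j" "j \<le> r" "X \<inter> Y = {} \<or> X \<inter> Z = {}"
  obtains S' where "phase V r j X Y Z S S'"
proof -
  have "\<exists>S'. phase V r j X Y Z S S'"
    using assms(1)
  proof (induction "card V - card (induced (S j) X)" arbitrary: S rule: less_induct)
    case (less S)
    show ?case
    proof (cases "\<exists>S'. xstep V r j X Y Z S S'")
      case True
      then obtain S1 where S1: "xstep V r j X Y Z S S1" by blast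
      have ok1: "ok S1" using xstep_ok[OF less(2) S1 assms(2)] .
      have "card V - card (induced (S1 j) X) < card V - card (induced (S j) X)"
        using xstep_measure[OF less(2) S1 assms(2,4)]
          induced_card_less[OF ok_tree[OF less(2)], of j X] assms(2,3) by auto
      from less(1)[OF this ok1] obtain S' where "phase V r j X Y Z S1 S'" by blast
      then have "phase V r j X Y Z S S'"
        using S1 by (auto simp: phase_def intro: converse_rtranclp_into_rtranclp)
      then show ?thesis by blast
    next
      case False
      then have "phase V r j X Y Z S S" by (simp add: phase_def)
      then show ?thesis by blast
    qed
  qed
  then show ?thesis using that by blast
qed

lemma xstep_earlier: "xstep V r j X Y Z S S' \<Longrightarrow> i < j \<Longrightarrow> S' i = S i"
  unfolding xstep_def by auto

lemma xstep_connected: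
  assumes "xstep V r j X Y Z S S'" "Y \<inter> A = {} \<or> Z \<inter> A = {}"
    and "connected_on A (induced (S j) A)"
  shows "connected_on A (induced (S' j) A)"
proof -
  have "induced (S j) A \<subseteq> induced (S' j) A"
    using assms(1,2) unfolding xstep_def by (auto simp: induced_def)
  then show ?thesis
    using assms(3) joined_mono[OF _ \<open>induced (S j) A \<subseteq> induced (S' j) A\<close>]
    unfolding connected_on_joined by simp
qed

text \<open>An edge inside \<open>X\<close> does not touch \<open>U\<close>, so the cut gains
  nothing, and it cannot lose its only edge since every spanning tree meets it.\<close>

lemma xstep_crossing:
  assumes "ok S" "xstep V r j X Y Z S S'" "1 \<le> j" "j \<le> r" "X \<inter> U = {}"
    and "U \<noteq> {}" "U \<subset> V" "card (S j \<inter> cut V U) = 1"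
  shows "card (S' j \<inter> cut V U) = 1"
proof -
  have "S' j \<inter> cut V U \<subseteq> S j \<inter> cut V U"
    using assms(2,5) unfolding xstep_def disjoint_iff by (auto simp: edge_in_cut_iff)
  moreover have "finite (S j \<inter> cut V U)" using assms(8) card.infinite by force
  ultimately have "card (S' j \<inter> cut V U) \<le> 1" using card_mono[of "S j \<inter> cut V U" "S' j \<inter> cut V U"] assms(8) by simp
  then show ?thesis
    using tree_crosses[OF xstep_ok[OF assms(1-3)], of j U] assms by simp
qed

section \<open>What an exhausted phase guarantees\<close>

lemma connect_phase:
  assumes "ok S" "1 \<le> j" "j \<le> r" "\<nexists>S'. xstep V r j W Y (V - B) S S'"
    and "W \<subseteq> Y" "Y \<subseteq> V" "Y - W \<subseteq> V - B" "connected_on Y (induced (S j) Y)"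
    and pick: "\<not> connected_on W (induced (S j) W) \<Longrightarrow>
      \<exists>k. j < k \<and> k \<le> r \<and> connected_on W (induced (S k) W)"
  shows "connected_on W (induced (S j) W)"
proof (rule ccontr)
  assume W: "\<not> ?thesis"
  then obtain k where k: "j < k" "k \<le> r" "connected_on W (induced (S k) W)"
    using pick by blast
  have tj: "S j \<in> spanning_trees V" and tk: "S k \<in> spanning_trees V"
    using ok_tree[OF assms(1)] assms(2,3) k by auto
  obtain a b c d where ab: "{a, b} \<in> induced (S j) Y" "\<not> {a, b} \<subseteq> W" "{c, d} \<in> induced (S k) W"
    and tr: "insert {c, d} (S j - {{a, b}}) \<in> spanning_trees V"
    "insert {a, b} (S k - {{c, d}}) \<in> spanning_trees V"
    by (rule connecting_exchange[OF fin tj tk assms(5,6) k(3) assms(8) W])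
  \<comment> \<open>The edge given up lies in \<open>Y\<close> but not inside \<open>W\<close>;
    naming an end outside \<open>W\<close> as \<open>v\<close> places it in \<open>V - B\<close>, as
    this phase demands.\<close>
  obtain u v where uv: "{u, v} = {a, b}" "v \<notin> W"
    using ab(2) by (metis insert_commute insert_subset empty_subsetI)
  then have "u \<in> Y" "v \<in> V - B" using ab(1) assms(7) by (auto simp: induced_def doubleton_eq_iff)
  moreover have "{u, v} \<in> S j" "{c, d} \<in> S k" "c \<in> W" "d \<in> W"
    using ab(1,3) uv(1) by (auto simp: induced_def)
  ultimately have "\<exists>S'. xstep V r j W Y (V - B) S S'"
    using tr unfolding uv(1)[symmetric] by (intro xstepI[OF k(1,2), where u = u and v = v])
  then show False using assms(4) by blast
qed

text \<open>Here all of tree \<open>k\<close> serves as \<open>F\<close> in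
  \<open>tree_exchange\<close>. Deleting the jumping edge leaves the connected set \<open>B\<close>
  on the side of \<open>a\<close>, so the new edge has its far end outside \<open>B\<close>; as tree
  \<open>k\<close> has no jumping edge, the near end is outside \<open>A\<close>, and the exchange
  is one of this phase.\<close>

lemma no_jump_phase:
  assumes "ok S" "1 \<le> j" "j \<le> r" "\<nexists>S'. xstep V r j (V - A) A (V - B) S S'"
    and "A \<subseteq> B" "B \<subseteq> V" "connected_on B (induced (S j) B)"
    and pick: "S j \<inter> (cut V A \<inter> cut V B) \<noteq> {} \<Longrightarrow>
      \<exists>k. j < k \<and> k \<le> r \<and> S k \<inter> (cut V A \<inter> cut V B) = {}"
  shows "S j \<inter> (cut V A \<inter> cut V B) = {}"
proof (rule ccontr)
  assume ne: "\<not> ?thesis"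
  then obtain k where k: "j < k" "k \<le> r" "S k \<inter> (cut V A \<inter> cut V B) = {}"
    using pick by blast
  have tj: "S j \<in> spanning_trees V" and tk: "S k \<in> spanning_trees V"
    using ok_tree[OF assms(1)] assms(2,3) k by auto
  obtain e where e: "e \<in> S j" "e \<in> cut V A" "e \<in> cut V B" using ne by blast
  obtain a b where ab: "e = {a, b}" "a \<in> V" "b \<in> V" "a \<in> A" "b \<notin> A"
    using e(2) by (rule cutE)
  have b: "b \<notin> B" using e(3) ab assms(5) by (auto simp: edge_in_cut_iff)
  have abj: "{a, b} \<in> S j" using e(1) ab(1) by simp
  have nab: "\<not> joined (S j - {{a, b}}) a b"
    using treeD(4)[OF tj] abj by (auto simp: forest_def)
  have joined_k: "joined (S k) a b" using treeD(6)[OF tk ab(2,3)] .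
  obtain c d where cd: "{c, d} \<in> S k" "joined (S j - {{a, b}}) a c" "\<not> joined (S j - {{a, b}}) a d"
    and tr: "insert {c, d} (S j - {{a, b}}) \<in> spanning_trees V"
    "insert {a, b} (S k - {{c, d}}) \<in> spanning_trees V"
    by (rule tree_exchange[OF fin tj tk abj order_refl joined_k joined_refl joined_refl joined_refl nab])
  have cdV: "c \<in> V" "d \<in> V"
    using treeD(1)[OF tk] cd(1) complete_edges_iff[of c d V] by auto
  have "joined (S j - {{a, b}}) a z" if "z \<in> B" for z
  proof -
    have "joined (induced (S j) B) a z"
      using assms(5,7) ab(4) that by (auto simp: connected_on_joined)
    then show ?thesis
      by (rule joined_mono) (use b in \<open>auto simp: induced_def\<close>)
  qed
  then have d: "d \<notin> B" using cd(3) by blast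
  have c: "c \<notin> A"
  proof
    assume "c \<in> A"
    then have "{c, d} \<in> S k \<inter> (cut V A \<inter> cut V B)"
      using cd(1) cdV d assms(5) by (auto simp: edge_in_cut_iff)
    then show False using k(3) by simp
  qed
  have "\<exists>S'. xstep V r j (V - A) A (V - B) S S'"
    by (rule xstepI[OF k(1,2) abj cd(1) _ _ _ _ tr]) (use cdV c d b ab assms(5) in auto)
  then show False using assms(4) by blast
qed

text \<open>Without jumping edges, two edges leaving \<open>A\<close> both end in
  \<open>B - A\<close>, and together with the connected graphs on \<open>A\<close> and
  \<open>B - A\<close> they would close a cycle.\<close>

lemma one_crossing:
  assumes "T \<in> spanning_trees V" "A \<subseteq> B" "B \<subset> V" "A \<noteq> {}" "T \<inter> (cut V A \<inter> cut V B) = {}"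
    and "connected_on A (induced T A)" "connected_on (B - A) (induced T (B - A))"
  shows "card (T \<inter> cut V A) = 1"
proof -
  have sub: "e = e'" if "e \<in> T \<inter> cut V A" "e' \<in> T \<inter> cut V A" for e e'
  proof (rule ccontr)
    assume ne: "e \<noteq> e'"
    from that obtain a b where ab: "e = {a, b}" "a \<in> A" "b \<notin> A" "a \<in> V" "b \<in> V"
      by (auto elim: cutE)
    from that obtain a' b' where ab': "e' = {a', b'}" "a' \<in> A" "b' \<notin> A" "a' \<in> V" "b' \<in> V"
      by (auto elim: cutE)
    have "y \<in> B" if "{x, y} \<in> T" "x \<in> A" "y \<notin> A" "x \<in> V" "y \<in> V" for x y
    proof (rule ccontr)
      assume "y \<notin> B"
      then have "{x, y} \<in> T \<inter> (cut V A \<inter> cut V B)"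
        using that assms(2) by (auto simp: edge_in_cut_iff)
      then show False using assms(5) by blast
    qed
    then have "b \<in> B" "b' \<in> B" using that ab ab' by auto
    then have B: "b \<in> B - A" "b' \<in> B - A" using ab ab' by auto
    have 1: "joined (T - {e}) a a'"
      by (rule joined_mono[of "induced T A"])
        (use assms(6) ab ab' in \<open>auto simp: connected_on_joined induced_def\<close>)
    have 2: "joined (T - {e}) a' b'"
      by (rule joined_edge) (use that ab' ne in auto)
    have 3: "joined (T - {e}) b' b"
      by (rule joined_mono[of "induced T (B - A)"])
        (use assms(7) B ab in \<open>auto simp: connected_on_joined induced_def\<close>)
    have "joined (T - {e}) a b" by (rule joined_trans[OF joined_trans[OF 1 2] 3])
    then show False using treeD(4)[OF assms(1)] that ab(1) by (auto simp: forest_def)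
  qed
  moreover have "T \<inter> cut V A \<noteq> {}"
    by (rule tree_meets_cut[OF fin assms(1,4)]) (use assms(2,3) in auto)
  ultimately obtain e where "T \<inter> cut V A = {e}" by blast
  then show ?thesis by simp
qed

text \<open>Tree \<open>k\<close> enters \<open>V - B\<close> through one edge
  \<open>{cl, cr}\<close> and is connected on both sides. If a crossing edge \<open>{a, b}\<close>
  of tree \<open>j\<close> can be deleted with \<open>cr\<close> remaining on the side of
  \<open>a\<close>, the walk of tree \<open>k\<close> from \<open>cr\<close> to \<open>b\<close>
  outside \<open>B\<close> must pass to the other side, and it supplies a new edge inside
  \<open>V - B\<close>.\<close>

lemma crossing_phase:
  assumes "ok S" "1 \<le> j" "j \<le> r" "\<nexists>S'. xstep V r j (V - B) B (V - B) S S'"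
    and "B \<subset> V" "B \<noteq> {}" "connected_on B (induced (S j) B)"
    and pick: "card (S j \<inter> cut V B) \<noteq> 1 \<Longrightarrow> \<exists>k. j < k \<and> k \<le> r \<and> card (S k \<inter> cut V B) = 1"
  shows "card (S j \<inter> cut V B) = 1"
proof (rule ccontr)
  assume ne1: "\<not> ?thesis"
  then obtain k where k: "j < k" "k \<le> r" "card (S k \<inter> cut V B) = 1"
    using pick by blast
  have tj: "S j \<in> spanning_trees V" and tk: "S k \<in> spanning_trees V"
    using ok_tree[OF assms(1)] assms(2,3) k by auto
  note con = tree_one_crossing[OF fin tk assms(6,5) k(3)]
  have "card (S j \<inter> cut V B) \<ge> 1" using tree_crosses[OF assms(1) _ assms(6,5)] assms(2,3) by simp
  then have "\<not> card (S j \<inter> cut V B) \<le> Suc 0" using ne1 by simp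
  then obtain e e' where ee: "e \<in> S j \<inter> cut V B" "e' \<in> S j \<inter> cut V B" "e \<noteq> e'"
    using treeD(5)[OF tj] card_le_Suc0_iff_eq[of "S j \<inter> cut V B"] by auto
  from ee(1) obtain a b where ab: "e = {a, b}" "a \<in> B" "b \<notin> B" "a \<in> V" "b \<in> V"
    by (auto elim: cutE)
  from ee(2) obtain a' b' where ab': "e' = {a', b'}" "a' \<in> B" "b' \<notin> B" "a' \<in> V" "b' \<in> V"
    by (auto elim: cutE)
  obtain f where f: "S k \<inter> cut V B = {f}" using k(3) by (auto simp: card_1_singleton_iff)
  then have "f \<in> cut V B" by auto
  then obtain cl cr where c: "f = {cl, cr}" "cl \<in> V" "cr \<in> V" "cl \<in> B" "cr \<notin> B" by (rule cutE)
  have inB: "joined (S j - {{u, w}}) z z'" if "z \<in> B" "z' \<in> B" "w \<notin> B" for u w z z'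
    by (rule joined_mono[of "induced (S j) B"])
      (use assms(7) that in \<open>auto simp: connected_on_joined induced_def\<close>)
  \<comment> \<open>Of two crossing edges one is suitable: if deleting the first separates
    \<open>cr\<close> from \<open>a\<close>, then \<open>cr\<close> hangs on \<open>b\<close>
    without using the second edge, and it is still tied to \<open>B\<close> through the first one
    when the second is deleted.\<close>
  have "joined (S j - {{a, b}}) a cr \<or> joined (S j - {{a', b'}}) a' cr"
  proof (rule ccontr)
    assume contr: "\<not> ?thesis"
    have "joined (S j - {{a, b}} - {{a', b'}}) b cr"
    proof -
      have b: "joined (S j - {{a, b}}) b cr"
        using contr joined_delete_edge[OF treeD(6)[OF tj ab(4) c(3)], of a b] by auto
      have "\<not> joined (S j - {{a, b}}) b a'"
      proof
        assume "joined (S j - {{a, b}}) b a'"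
        then have "joined (S j - {{a, b}}) a b"
          using joined_trans[OF inB[OF ab(2) ab'(2) ab(3)] joined_sym] by blast
        then show False using treeD(4)[OF tj] ee(1) ab(1) by (auto simp: forest_def)
      qed
      then show ?thesis
        by (rule joined_avoid[OF b]) (use ee ab(1) ab'(1) in auto)
    qed
    then have 1: "joined (S j - {{a, b}}) b cr" "joined (S j - {{a', b'}}) b cr"
      by (auto elim!: joined_mono)
    have "joined (S j - {{a', b'}}) a b"
      by (rule joined_edge) (use ee ab(1) ab'(1) in auto)
    then have "joined (S j - {{a', b'}}) a' cr"
      using joined_trans[OF inB[OF ab'(2) ab(2) ab'(3)] joined_trans[OF _ 1(2)]] by blast
    then show False using contr by simp
  qed
  then obtain a b where ab: "{a, b} \<in> S j" "a \<in> B" "b \<notin> B" "a \<in> V" "b \<in> V"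
    and acr: "joined (S j - {{a, b}}) a cr"
    using ab ab' ee by blast
  have nab: "\<not> joined (S j - {{a, b}}) a b"
    using treeD(4)[OF tj] ab(1) by (auto simp: forest_def)
  let ?F = "induced (S k) (V - B)"
  have crb: "joined ?F cr b"
    using con(2) c(3,5) ab(3,5) by (auto simp: connected_on_joined)
  have ne: "{} \<notin> S k" using treeD(1)[OF tk] by (auto elim: complete_edgesE)
  have sub: "induced (S k) B \<subseteq> S k - ?F"
  proof
    fix x assume x: "x \<in> induced (S k) B"
    then have "x \<noteq> {}" "x \<subseteq> B" using ne by (auto simp: induced_def)
    then show "x \<in> S k - ?F" using x by (auto simp: induced_def)
  qed
  have "joined (induced (S k) B) a cl"
    using con(1) ab(2) c(4) by (auto simp: connected_on_joined)
  then have acl: "joined (S k - ?F) a cl" using sub by (rule joined_mono)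
  have "joined (S k - ?F) cl cr"
    by (rule joined_edge) (use f c in \<open>auto simp: induced_def\<close>)
  then have gate: "joined (S k - ?F) a cr" by (rule joined_trans[OF acl])
  have sub: "?F \<subseteq> S k" by (auto simp: induced_def)
  obtain p q where pq: "{p, q} \<in> ?F"
    and tr: "insert {p, q} (S j - {{a, b}}) \<in> spanning_trees V"
    "insert {a, b} (S k - {{p, q}}) \<in> spanning_trees V"
    by (rule tree_exchange[OF fin tj tk ab(1) sub crb gate joined_refl acr nab])
  have "\<exists>S'. xstep V r j (V - B) B (V - B) S S'"
    by (rule xstepI[OF k(1,2) ab(1) _ _ _ _ _ tr]) (use pq ab in \<open>auto simp: induced_def\<close>)
  then show False using assms(4) by blast
qed

section \<open>One tree after the other\<close>

text \<open>Natural subtraction makes \<open>lev j (p - 1)\<close> empty for \<open>p = 0\<close>: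
  the second phase then has the parameters of the first, and the third admits no exchange, its
  \<open>Y\<close> being empty.\<close>

definition stage :: "nat \<Rightarrow> nat \<Rightarrow> (nat \<Rightarrow> 'a set set) \<Rightarrow> (nat \<Rightarrow> 'a set set) \<Rightarrow> bool" where
  "stage j p S S' \<longleftrightarrow> (\<exists>S1 S2 S3.
     phase V r j (lev j (p + 1) - lev j p) (V - lev j p) (V - lev j (p + 1)) S S1 \<and>
     phase V r j (lev j (p + 1) - lev j (p - 1)) (V - lev j (p - 1)) (V - lev j (p + 1)) S1 S2 \<and>
     phase V r j (V - lev j p) (lev j p) (V - lev j (p + 1)) S2 S3 \<and>
     phase V r j (V - lev j (p + 1)) (lev j (p + 1)) (V - lev j (p + 1)) S3 S')"

definition good :: "nat \<Rightarrow> nat \<Rightarrow> (nat \<Rightarrow> 'a set set) \<Rightarrow> bool" where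
  "good j p S \<longleftrightarrow> (\<forall>a \<in> {1..p}. card (S j \<inter> cut V (lev j a)) = 1)"

lemma phase_ok: "phase V r j X Y Z S S' \<Longrightarrow> 1 \<le> j \<Longrightarrow> ok S \<Longrightarrow> ok S'"
  by (rule phase_preserves[where P = ok]) (auto intro: xstep_ok)

lemma phase_earlier:
  assumes "phase V r j X Y Z S S'" "i < j"
  shows "S' i = S i"
proof (rule phase_preserves[OF assms(1), where P = "\<lambda>S'. S' i = S i"])
  fix S1 S2 assume "S1 i = S i" "xstep V r j X Y Z S1 S2"
  then show "S2 i = S i" using xstep_earlier[OF _ assms(2)] by metis
qed simp

lemma phase_connected:
  assumes "phase V r j X Y Z S S'" "Y \<inter> A = {} \<or> Z \<inter> A = {}" "connected_on A (induced (S j) A)"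
  shows "connected_on A (induced (S' j) A)"
  by (rule phase_preserves[OF assms(1), where P = "\<lambda>S. connected_on A (induced (S j) A)"])
    (use assms(3) xstep_connected[OF _ assms(2)] in auto)

lemma phase_good:
  assumes "phase V r j X Y Z S S'" "1 \<le> j" "j \<le> r" "ok S" "p \<le> card (rel j)"
    and "X \<inter> lev j p = {}" "good j p S"
  shows "good j p S'"
proof -
  have "ok S' \<and> good j p S'"
  proof (rule phase_preserves[OF assms(1), where P = "\<lambda>S. ok S \<and> good j p S"])
    fix S S' assume *: "ok S \<and> good j p S" "xstep V r j X Y Z S S'"
    have "card (S' j \<inter> cut V (lev j a)) = 1" if "a \<in> {1..p}" for a
    proof (rule xstep_crossing[OF _ *(2) assms(2,3)])
      show "X \<inter> lev j a = {}" using assms(6) lev_mono[of a p j] that by auto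
      have "lev j a \<in> rel j" using lev_rel assms(2,5) that by auto
      then show "lev j a \<noteq> {}" "lev j a \<subset> V" using relD assms(2) by blast+
      show "card (S j \<inter> cut V (lev j a)) = 1" using * that by (simp add: good_def)
    qed (use * in simp)
    then show "ok S' \<and> good j p S'"
      using xstep_ok[OF _ *(2) assms(2)] * by (simp add: good_def)
  qed (use assms in simp)
  then show ?thesis by simp
qed

lemma stage_ok: "stage j p S S' \<Longrightarrow> 1 \<le> j \<Longrightarrow> ok S \<Longrightarrow> ok S'"
  unfolding stage_def using phase_ok by blast

lemma stage_earlier: "stage j p S S' \<Longrightarrow> i < j \<Longrightarrow> S' i = S i"
  unfolding stage_def using phase_earlier by metis

lemma phase_trivial: "phase V r j X Y {} S S' \<Longrightarrow> S' = S"
  unfolding phase_def by (auto simp: xstep_def elim: converse_rtranclpE)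

text \<open>Past the end of the chain the next level is all of \<open>V\<close>, and
  \<open>Z\<close> is empty. So each tree can be given \<open>card V\<close> stages, whatever the
  length of its chain.\<close>

lemma stage_trivial: "stage j p S S' \<Longrightarrow> card (rel j) \<le> p \<Longrightarrow> S' = S"
  unfolding stage_def using lev_top[of j "p + 1"] by (auto dest!: phase_trivial)

lemma stage_exists:
  assumes "ok S" "1 \<le> j" "j \<le> r"
  obtains S' where "stage j p S S'"
proof -
  obtain S1 where 1: "phase V r j (lev j (p + 1) - lev j p) (V - lev j p) (V - lev j (p + 1)) S S1"
    by (rule phase_exists[OF assms,
      where X = "lev j (p + 1) - lev j p" and Z = "V - lev j (p + 1)"]) auto
  obtain S2 where 2: "phase V r j (lev j (p + 1) - lev j (p - 1)) (V - lev j (p - 1)) (V - lev j (p + 1)) S1 S2"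
    by (rule phase_exists[OF phase_ok[OF 1 assms(2,1)] assms(2,3),
      where X = "lev j (p + 1) - lev j (p - 1)" and Z = "V - lev j (p + 1)"]) auto
  note ok2 = phase_ok[OF 2 assms(2) phase_ok[OF 1 assms(2,1)]]
  obtain S3 where 3: "phase V r j (V - lev j p) (lev j p) (V - lev j (p + 1)) S2 S3"
    by (rule phase_exists[OF ok2 assms(2,3), where X = "V - lev j p" and Y = "lev j p"]) auto
  obtain S4 where 4: "phase V r j (V - lev j (p + 1)) (lev j (p + 1)) (V - lev j (p + 1)) S3 S4"
    by (rule phase_exists[OF phase_ok[OF 3 assms(2) ok2] assms(2,3),
      where X = "V - lev j (p + 1)" and Y = "lev j (p + 1)"]) auto
  show ?thesis using that 1 2 3 4 unfolding stage_def by blast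
qed

lemma pick_connected_lev:
  assumes "ok S" "1 \<le> j" "j \<le> r" "p < p'" "p' \<le> card (rel j)"
    and "\<not> connected_on (lev j p' - lev j p) (induced (S j) (lev j p' - lev j p))"
  shows "\<exists>k. j < k \<and> k \<le> r \<and> connected_on (lev j p' - lev j p) (induced (S k) (lev j p' - lev j p))"
proof -
  have B: "lev j p' \<in> rel j" using lev_rel assms by auto
  have A: "lev j p = {} \<or> lev j p \<in> rel j" using lev_rel[of j p] assms by (cases "p = 0") auto
  show ?thesis
    using pick_connected[OF assms(1) B A lev_strict[OF assms(2,4,5)] assms(2,3,6)] by metis
qed

lemma good_connected:
  assumes "ok S" "1 \<le> j" "j \<le> r" "p \<le> card (rel j)" "good j p S" "1 \<le> p"
  shows "connected_on (lev j p) (induced (S j) (lev j p))"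
    "connected_on (V - lev j p) (induced (S j) (V - lev j p))"
proof -
  have "lev j p \<in> rel j" using lev_rel assms by auto
  note U = relD[OF this assms(2)]
  have "S j \<in> spanning_trees V" using ok_tree assms by auto
  from tree_one_crossing[OF fin this U(4,1)]
  show "connected_on (lev j p) (induced (S j) (lev j p))"
    "connected_on (V - lev j p) (induced (S j) (V - lev j p))"
    using assms(5,6) by (auto simp: good_def)
qed

lemma good_upper_connected:
  assumes "ok S" "1 \<le> j" "j \<le> r" "p \<le> card (rel j)" "good j p S"
  shows "connected_on (V - lev j p) (induced (S j) (V - lev j p))"
proof (cases "p = 0")
  case True
  have tr: "S j \<in> spanning_trees V" using ok_tree assms by auto
  have "induced (S j) V = S j"
    using treeD(1)[OF tr] by (auto simp: induced_def complete_edges_def)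
  then show ?thesis using True treeD(2)[OF tr] by simp
next
  case False
  then show ?thesis using good_connected(2)[OF assms] by simp
qed

lemma connected_on_Un:
  assumes "connected_on A (induced T A)" "connected_on B (induced T B)" "w \<in> A" "w \<in> B"
  shows "connected_on (A \<union> B) (induced T (A \<union> B))"
proof -
  have *: "joined (induced T (A \<union> B)) z w" if "z \<in> A \<union> B" for z
  proof (cases "z \<in> A")
    case True
    then have "joined (induced T A) z w" using assms(1,3) by (simp add: connected_on_joined)
    then show ?thesis by (rule joined_mono) (auto simp: induced_def)
  next
    case False
    then have "joined (induced T B) z w" using assms(2,4) that by (simp add: connected_on_joined)
    then show ?thesis by (rule joined_mono) (auto simp: induced_def)
  qed
  show ?thesis
    unfolding connected_on_joined using joined_trans[OF * joined_sym[OF *]] by blast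
qed

lemma stage_progress:
  assumes "stage j p S S'" "ok S" "1 \<le> j" "j \<le> r" "p < card (rel j)" "good j p S"
  shows "good j (p + 1) S'"
proof -
  let ?A = "lev j p" and ?B = "lev j (p + 1)" and ?A' = "lev j (p - 1)"
  obtain S1 S2 S3 where
    1: "phase V r j (?B - ?A) (V - ?A) (V - ?B) S S1" and
    2: "phase V r j (?B - ?A') (V - ?A') (V - ?B) S1 S2" and
    3: "phase V r j (V - ?A) ?A (V - ?B) S2 S3" and
    4: "phase V r j (V - ?B) ?B (V - ?B) S3 S'"
    using assms(1) unfolding stage_def by blast
  note ok1 = phase_ok[OF 1 assms(3,2)]
  note ok2 = phase_ok[OF 2 assms(3) ok1]
  note ok3 = phase_ok[OF 3 assms(3) ok2]
  note ok4 = phase_ok[OF 4 assms(3) ok3]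
  have AB: "?A \<subset> ?B" using lev_strict assms(3,5) by auto
  have A'A: "?A' \<subseteq> ?A" by (rule lev_mono) simp
  have A'B: "?A' \<subset> ?B" using AB A'A by auto
  have BV: "?B \<subset> V" "?B \<in> rel j" "?B \<noteq> {}"
    using lev_rel[of j "p + 1"] relD(1)[of ?B j] AB assms(3,5) by auto
  have none: "\<nexists>S''. xstep V r j X Y Z T' S''" if "phase V r j X Y Z T T'" for X Y Z T T'
    using that by (simp add: phase_def)
  have le: "p \<le> card (rel j)" "p - 1 \<le> card (rel j)" using assms(5) by auto

  have good1: "good j p S1"
    by (rule phase_good[OF 1 assms(3,4,2) le(1) _ assms(6)]) auto
  have Q1: "connected_on (?B - ?A) (induced (S1 j) (?B - ?A))"
    by (rule connect_phase[OF ok1 assms(3,4) none[OF 1]])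
      (use AB BV good_upper_connected[OF ok1 assms(3,4) le(1) good1]
        pick_connected_lev[OF ok1 assms(3,4), of p "p + 1"] assms(5) in auto)
  \<comment> \<open>The second phase may add edges across the cut of \<open>lev j p\<close>, so only
    the cuts before it are carried on.\<close>
  have good1': "good j (p - 1) S1" using good1 by (auto simp: good_def)

  have good2: "good j (p - 1) S2"
    by (rule phase_good[OF 2 assms(3,4) ok1 le(2) _ good1']) auto
  have W2: "connected_on (?B - ?A') (induced (S2 j) (?B - ?A'))"
    by (rule connect_phase[OF ok2 assms(3,4) none[OF 2]])
      (use A'B BV good_upper_connected[OF ok2 assms(3,4) le(2) good2]
        pick_connected_lev[OF ok2 assms(3,4), of "p - 1" "p + 1"] assms(5) in auto)
  have Q2: "connected_on (?B - ?A) (induced (S2 j) (?B - ?A))"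
    by (rule phase_connected[OF 2 _ Q1]) auto
  have B2: "connected_on ?B (induced (S2 j) ?B)" and A2: "connected_on ?A (induced (S2 j) ?A)"
  proof -
    show A2: "connected_on ?A (induced (S2 j) ?A)"
    proof (cases "p = 0")
      case False
      have "connected_on ?A (induced (S1 j) ?A)"
        using good_connected(1)[OF ok1 assms(3,4) le(1) good1] False by simp
      then show ?thesis by (rule phase_connected[OF 2, rotated]) (use AB in auto)
    qed (simp add: connected_on_joined)
    show "connected_on ?B (induced (S2 j) ?B)"
    proof (cases "p = 0")
      case True
      then show ?thesis using W2 by simp
    next
      case False
      \<comment> \<open>The two connected sets overlap in \<open>lev j p - lev j (p - 1)\<close>,
        which is nonempty because the levels increase strictly.\<close>
      then have "?A' \<subset> ?A" using lev_strict[OF assms(3) _ le(1), of "p - 1"] by simp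
      then obtain w where "w \<in> ?A" "w \<in> ?B - ?A'" using AB by auto
      moreover have "?A \<union> (?B - ?A') = ?B" using AB A'A by auto
      ultimately show ?thesis using connected_on_Un[OF A2 W2] by metis
    qed
  qed

  have good3': "good j (p - 1) S3"
    by (rule phase_good[OF 3 assms(3,4) ok2 le(2) _ good2]) (use A'A in auto)
  have B3: "connected_on ?B (induced (S3 j) ?B)"
    by (rule phase_connected[OF 3 _ B2]) auto
  have Q3: "connected_on (?B - ?A) (induced (S3 j) (?B - ?A))"
    by (rule phase_connected[OF 3 _ Q2]) auto
  have A3: "connected_on ?A (induced (S3 j) ?A)"
    by (rule phase_connected[OF 3 _ A2]) (use AB in auto)
  \<comment> \<open>The single crossing of \<open>lev j p\<close> is regained from the absence of
    jumps and the two connected parts kept from the earlier phases.\<close>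
  have good3: "good j p S3"
  proof (cases "p = 0")
    case False
    have A: "?A \<in> rel j" using lev_rel[of j p] False assms(3,5) by auto
    have nj: "S3 j \<inter> (cut V ?A \<inter> cut V ?B) = {}"
    proof (rule no_jump_phase[OF ok3 assms(3,4) none[OF 3] _ _ B3])
      assume "S3 j \<inter> (cut V ?A \<inter> cut V ?B) \<noteq> {}"
      from pick_no_jump[OF ok3 A BV(2) AB assms(3,4) this]
      show "\<exists>k. j < k \<and> k \<le> r \<and> S3 k \<inter> (cut V ?A \<inter> cut V ?B) = {}" by metis
    qed (use AB BV in auto)
    have tr: "S3 j \<in> spanning_trees V" using ok_tree[OF ok3] assms(3,4) by auto
    have "card (S3 j \<inter> cut V ?A) = 1"
      by (rule one_crossing[OF tr _ BV(1) _ nj A3 Q3]) (use AB relD(4)[OF A assms(3)] in auto)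
    moreover have "a = p \<or> a \<in> {1..p - 1}" if "a \<in> {1..p}" for a
      using that by auto
    ultimately show ?thesis using good3' unfolding good_def by blast
  qed (simp add: good_def)

  have good4': "good j p S'"
    by (rule phase_good[OF 4 assms(3,4) ok3 le(1) _ good3]) (use AB in auto)
  have B4: "connected_on ?B (induced (S' j) ?B)"
    by (rule phase_connected[OF 4 _ B3]) auto
  have "card (S' j \<inter> cut V ?B) = 1"
  proof (rule crossing_phase[OF ok4 assms(3,4) none[OF 4] BV(1,3) B4])
    assume "card (S' j \<inter> cut V ?B) \<noteq> 1"
    from pick_crossing[OF ok4 BV(2) assms(3,4) this]
    show "\<exists>k. j < k \<and> k \<le> r \<and> card (S' k \<inter> cut V ?B) = 1" by metis
  qed
  moreover have "a = p + 1 \<or> a \<in> {1..p}" if "a \<in> {1..p + 1}" for a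
    using that by auto
  ultimately show ?thesis using good4' unfolding good_def by blast
qed

primrec stages :: "nat \<Rightarrow> nat \<Rightarrow> (nat \<Rightarrow> 'a set set) \<Rightarrow> (nat \<Rightarrow> 'a set set) \<Rightarrow> bool" where
  "stages j 0 S S' \<longleftrightarrow> S' = S"
| "stages j (Suc p) S S' \<longleftrightarrow> (\<exists>S1. stages j p S S1 \<and> stage j p S1 S')"

lemma stages_ok: "stages j p S S' \<Longrightarrow> 1 \<le> j \<Longrightarrow> ok S \<Longrightarrow> ok S'"
  by (induction p arbitrary: S') (auto intro: stage_ok)

lemma stages_earlier: "stages j p S S' \<Longrightarrow> i < j \<Longrightarrow> S' i = S i"
  by (induction p arbitrary: S') (auto simp: stage_earlier)

lemma stages_exist: "ok S \<Longrightarrow> 1 \<le> j \<Longrightarrow> j \<le> r \<Longrightarrow> \<exists>S'. stages j p S S'"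
proof (induction p)
  case (Suc p)
  then obtain S1 where S1: "stages j p S S1" by blast
  obtain S2 where "stage j p S1 S2"
    by (rule stage_exists[OF stages_ok[OF S1 Suc.prems(2,1)] Suc.prems(2,3)])
  then have "stages j (Suc p) S S2" using S1 by auto
  then show ?case by blast
qed (rule exI[of _ S], simp)

lemma stages_good:
  assumes "stages j p S S'" "ok S" "1 \<le> j" "j \<le> r"
  shows "good j (min p (card (rel j))) S'"
  using assms(1)
proof (induction p arbitrary: S')
  case (Suc p)
  then obtain S1 where S1: "stages j p S S1" "stage j p S1 S'" by auto
  show ?case
  proof (cases "p < card (rel j)")
    case True
    then show ?thesis
      using stage_progress[OF S1(2) stages_ok[OF S1(1) assms(3,2)] assms(3,4)] Suc(1)[OF S1(1)] by simp
  next
    case False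
    then show ?thesis using stage_trivial[OF S1(2)] Suc(1)[OF S1(1)] by simp
  qed
qed (simp add: good_def)

text \<open>The levels grow strictly, each by at least one vertex; hence \<open>card V\<close>
  stages exhaust the chain.\<close>

lemma card_rel_le: "1 \<le> j \<Longrightarrow> card (rel j) \<le> card V"
proof -
  assume j: "1 \<le> j"
  have "p \<le> card (rel j) \<Longrightarrow> p \<le> card (lev j p)" for p
  proof (induction p)
    case (Suc p)
    have "card (lev j p) < card (lev j (Suc p))"
      by (rule psubset_card_mono) (use lev_strict[OF j, of p "Suc p"] Suc.prems
          finite_subset[OF lev_subset fin] in auto)
    then show ?case using Suc by simp
  qed simp
  from this[of "card (rel j)"] show ?thesis
    using card_mono[OF fin lev_subset[of j "card (rel j)"]] by simp
qed

lemma stages_rel: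
  assumes "stages j (card V) S S'" "ok S" "1 \<le> j" "j \<le> r" "U \<in> rel j"
  shows "card (S' j \<inter> cut V U) = 1"
proof -
  let ?p = "card {U' \<in> rel j. U' \<subseteq> U}"
  have "good j (card (rel j)) S'"
    using stages_good[OF assms(1-4)] card_rel_le[OF assms(3)] by (simp add: min_absorb2)
  moreover have "?p \<in> {1..card (rel j)}"
    using bij_betwE[OF card_below[OF assms(3)]] assms(5) by blast
  ultimately have "card (S' j \<inter> cut V (lev j ?p)) = 1" by (simp only: good_def)
  then show ?thesis unfolding rel_lev[OF assms(5,3)] .
qed

definition done_upto :: "nat \<Rightarrow> (nat \<Rightarrow> 'a set set) \<Rightarrow> bool" where
  "done_upto j S \<longleftrightarrow> ok S \<and> (\<forall>i \<in> {1..j}. \<forall>U \<in> rel i. card (S i \<inter> cut V U) = 1)"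

lemma done_upto_0: "done_upto 0 S0"
  using ok_S0 by (simp add: done_upto_def)

lemma done_upto_Suc:
  assumes "done_upto j S" "stages (Suc j) (card V) S S'" "Suc j \<le> r"
  shows "done_upto (Suc j) S'"
  unfolding done_upto_def
proof (intro conjI ballI)
  have ok: "ok S" using assms(1) by (simp add: done_upto_def)
  show "ok S'" using stages_ok[OF assms(2) _ ok] by simp
  fix i U assume i: "i \<in> {1..Suc j}" "U \<in> rel i"
  show "card (S' i \<inter> cut V U) = 1"
  proof (cases "i = Suc j")
    case True
    then show ?thesis using stages_rel[OF assms(2) ok _ assms(3)] i(2) by simp
  next
    case False
    then show ?thesis using stages_earlier[OF assms(2), of i] assms(1) i by (simp add: done_upto_def)
  qed
qed

lemma done_upto_exists: "j \<le> r \<Longrightarrow> \<exists>S. done_upto j S"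
proof (induction j)
  case 0
  show ?case using done_upto_0 by blast
next
  case (Suc j)
  then obtain S where S: "done_upto j S" by auto
  then obtain S' where "stages (Suc j) (card V) S S'"
    using stages_exist[of S "Suc j" "card V"] Suc.prems unfolding done_upto_def by auto
  then show ?case using done_upto_Suc[OF S _ Suc.prems] by blast
qed

lemma narrow_cut_side:
  assumes "C \<in> narrow_cuts V xs"
  obtains U where "C = cut V U" "U \<subset> V" "s \<in> U"
proof -
  obtain U where U: "C = cut V U" "U \<noteq> {}" "U \<subset> V" "sum xs C < 2"
    using assms unfolding narrow_cuts_def by blast
  show ?thesis
  proof (cases "s \<in> U")
    case True
    then show ?thesis using that U by blast
  next
    case False
    have "U \<subseteq> V" "V - U \<subset> V" using U by auto
    then show ?thesis using that[of "V - U"] U(1) cut_complement[of U V] False sV by simp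
  qed
qed

lemma reassembled_if_done:
  assumes "done_upto r S"
  shows "reassembled V xs eps r S0 S"
  unfolding reassembled_def
proof (intro conjI ballI)
  have ok: "ok S" using assms by (simp add: done_upto_def)
  show "S j \<in> spanning_trees V" if "j \<in> {1..r}" for j using ok_tree[OF ok that] .
  show "tree_average r S0 e = tree_average r S e" if "e \<in> complete_edges V" for e
    using ok that by (simp add: ok_def)
  fix C assume "C \<in> narrow_cuts V xs"
  then obtain U where U: "C = cut V U" "U \<subset> V" "s \<in> U" by (rule narrow_cut_side)
  define \<theta> where "\<theta> = real r * (2 - sum xs C - eps)"
  have "sum xs C \<ge> 1" using cut_ge_1[OF _ U(2)] U(1,3) by blast
  then have "\<theta> \<le> real r * 1"
    unfolding \<theta>_def using eps by (intro mult_left_mono) auto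
  \<comment> \<open>The least \<open>h\<close> with \<open>\<theta> \<le> h\<close>; then
    \<open>j \<le> h\<close> gives \<open>j - 1 < \<theta>\<close>, the relevance condition for tree
    \<open>j\<close>. If \<theta> is not positive, \<open>h\<close> is 0 and nothing is
    claimed.\<close>
  define h where "h = nat \<lceil>\<theta>\<rceil>"
  have h: "h \<le> r" "\<theta> \<le> real h"
    using \<open>\<theta> \<le> real r * 1\<close> unfolding h_def by linarith+
  have "U \<in> rel j" if "j \<in> {1..h}" for j
  proof -
    have "real j - 1 < \<theta>" using that unfolding h_def by simp linarith
    then show ?thesis using U by (simp add: rel_def \<theta>_def)
  qed
  then have "card (C \<inter> S j) = 1" if "j \<in> {1..h}" for j
    using assms that h(1) U(1) by (auto simp: done_upto_def Int_commute)
  moreover have "2 - sum xs C - eps \<le> real h / real r"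
    using h(2) r unfolding \<theta>_def by (simp add: pos_le_divide_eq mult.commute)
  ultimately show "\<exists>h \<in> {0..r}. 2 - sum xs C - eps \<le> real h / real r \<and>
      (\<forall>j \<in> {1..h}. card (C \<inter> S j) = 1)"
    using h(1) by auto
qed

lemma reassembly_exists: "\<exists>S. reassembled V xs eps r S0 S"
  using done_upto_exists[OF order_refl] reassembled_if_done by blast

end

section \<open>Programs with bounded loops\<close>

text \<open>An auxiliary language whose loops run a number of times fixed on entry. Its programs
  denote total functions (\<open>den\<close>), and their running time is bounded by a polynomial
  read off the syntax (\<open>cost\<close>), so the correctness proofs deal neither with termination
  nor with steps.\<close>

datatype prog =
    PSkip
  | PAssign string aexp aexp
  | PSeq prog prog
  | PIf bexp prog prog
  | PFor string aexp prog

abbreviation var :: "string \<Rightarrow> aexp" where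
  "var x \<equiv> Cell x (Const 0)"

primrec compile :: "prog \<Rightarrow> com" where
  "compile PSkip = Skip"
| "compile (PAssign A i a) = Assign A i a"
| "compile (PSeq p q) = Seq (compile p) (compile q)"
| "compile (PIf b p q) = Cond b (compile p) (compile q)"
| "compile (PFor x B p) = Seq (Assign x (Const 0) (Const 0))
     (Loop (Less (var x) B) (Seq (compile p) (Assign x (Const 0) (Add (var x) (Const 1)))))"

definition setv :: "string \<Rightarrow> int \<Rightarrow> store \<Rightarrow> store" where
  "setv x a \<sigma> = \<sigma>(x := (\<sigma> x)(0 := a))"

primrec den :: "prog \<Rightarrow> store \<Rightarrow> store" where
  "den PSkip \<sigma> = \<sigma>"
| "den (PAssign A i a) \<sigma> = \<sigma>(A := (\<sigma> A)(aval i \<sigma> := aval a \<sigma>))"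
| "den (PSeq p q) \<sigma> = den q (den p \<sigma>)"
| "den (PIf b p q) \<sigma> = (if bval b \<sigma> then den p \<sigma> else den q \<sigma>)"
| "den (PFor x B p) \<sigma> =
     ((\<lambda>\<tau>. setv x (den p \<tau> x 0 + 1) (den p \<tau>)) ^^ nat (aval B \<sigma>)) (setv x 0 \<sigma>)"

primrec writes :: "prog \<Rightarrow> string set" where
  "writes PSkip = {}"
| "writes (PAssign A i a) = {A}"
| "writes (PSeq p q) = writes p \<union> writes q"
| "writes (PIf b p q) = writes p \<union> writes q"
| "writes (PFor x B p) = insert x (writes p)"

primrec anames :: "aexp \<Rightarrow> string set" where
  "anames (Const k) = {}"
| "anames (Cell A i) = insert A (anames i)"
| "anames (Add a b) = anames a \<union> anames b"
| "anames (Sub a b) = anames a \<union> anames b"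

primrec bounds :: "prog \<Rightarrow> aexp set" where
  "bounds PSkip = {}"
| "bounds (PAssign A i a) = {}"
| "bounds (PSeq p q) = bounds p \<union> bounds q"
| "bounds (PIf b p q) = bounds p \<union> bounds q"
| "bounds (PFor x B p) = insert B (bounds p)"

primrec counters_ok :: "prog \<Rightarrow> bool" where
  "counters_ok PSkip \<longleftrightarrow> True"
| "counters_ok (PAssign A i a) \<longleftrightarrow> True"
| "counters_ok (PSeq p q) \<longleftrightarrow> counters_ok p \<and> counters_ok q"
| "counters_ok (PIf b p q) \<longleftrightarrow> counters_ok p \<and> counters_ok q"
| "counters_ok (PFor x B p) \<longleftrightarrow> x \<notin> writes p \<and> counters_ok p"

text \<open>A polynomial in a common upper bound of all loop bounds. A loop pays for setting the
  counter and for the last test, and in each round for a test and an increment besides the body. A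
  conditional pays for both branches, as a sum stays polynomial.\<close>

primrec cost :: "prog \<Rightarrow> nat poly" where
  "cost PSkip = 1"
| "cost (PAssign A i a) = 1"
| "cost (PSeq p q) = cost p + cost q"
| "cost (PIf b p q) = 1 + (cost p + cost q)"
| "cost (PFor x B p) = 2 + [:0, 1:] * (cost p + 2)"

lemma aval_cong: "(\<And>A. A \<in> anames e \<Longrightarrow> \<sigma> A = \<tau> A) \<Longrightarrow> aval e \<sigma> = aval e \<tau>"
  by (induction e) auto

lemma setv_same [simp]: "setv x a \<sigma> x 0 = a"
  by (simp add: setv_def)

lemma setv_other [simp]: "A \<noteq> x \<Longrightarrow> setv x a \<sigma> A = \<sigma> A"
  by (simp add: setv_def)

lemma den_frame: "A \<notin> writes p \<Longrightarrow> den p \<sigma> A = \<sigma> A"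
proof (induction p arbitrary: \<sigma>)
  case (PFor x B p)
  have "((\<lambda>\<tau>. setv x (den p \<tau> x 0 + 1) (den p \<tau>)) ^^ m) \<sigma>' A = \<sigma>' A" for m \<sigma>'
    by (induction m) (use PFor in auto)
  then show ?case using PFor.prems by simp
qed auto

text \<open>The premise \<open>stable\<close> covers every store that agrees with the initial one
  outside the counter and the arrays of the body, hence all stores met during the loop. One round
  costs at most \<open>K + 2\<close>: the test, the body and the increment.\<close>

lemma exec_loop:
  assumes "x \<notin> writes p"
    and stable: "\<And>\<tau>. (\<And>A. A \<notin> insert x (writes p) \<Longrightarrow> \<tau> A = \<sigma> A) \<Longrightarrow>
      aval B \<tau> = int N \<and> (\<exists>k. exec (compile p) \<tau> k (den p \<tau>) \<and> k \<le> K)"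
  shows "i + m = N \<Longrightarrow> \<tau> x 0 = int i \<Longrightarrow> (\<And>A. A \<notin> insert x (writes p) \<Longrightarrow> \<tau> A = \<sigma> A) \<Longrightarrow>
    \<exists>k. exec (Loop (Less (var x) B) (Seq (compile p) (Assign x (Const 0) (Add (var x) (Const 1)))))
        \<tau> k (((\<lambda>\<tau>. setv x (den p \<tau> x 0 + 1) (den p \<tau>)) ^^ m) \<tau>) \<and> k \<le> 1 + m * (K + 2)"
proof (induction m arbitrary: i \<tau>)
  case 0
  then have "\<not> bval (Less (var x) B) \<tau>" using stable by simp
  then show ?case using exec_LoopF by fastforce
next
  case (Suc m)
  have B: "bval (Less (var x) B) \<tau>" using Suc.prems stable[of \<tau>] by simp
  let ?\<rho> = "setv x (den p \<tau> x 0 + 1) (den p \<tau>)"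
  obtain k where k: "exec (compile p) \<tau> k (den p \<tau>)" "k \<le> K"
    using stable[OF Suc.prems(3)] by blast
  have "exec (Assign x (Const 0) (Add (var x) (Const 1))) (den p \<tau>) 1 ?\<rho>"
    using exec_Assign[of x "Const 0" "Add (var x) (Const 1)" "den p \<tau>"] by (simp add: setv_def)
  from exec_Seq[OF k(1) this]
  have body: "exec (Seq (compile p) (Assign x (Const 0) (Add (var x) (Const 1)))) \<tau> (k + 1) ?\<rho>" .
  have "den p \<tau> x = \<tau> x" by (rule den_frame[OF assms(1)])
  then have "?\<rho> x 0 = int (Suc i)" using Suc.prems(2) by simp
  moreover have "?\<rho> A = \<sigma> A" if "A \<notin> insert x (writes p)" for A
    using that Suc.prems(3) den_frame by (metis insertI1 insertI2 setv_other)
  ultimately obtain l where l: "exec (Loop (Less (var x) B)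
      (Seq (compile p) (Assign x (Const 0) (Add (var x) (Const 1))))) ?\<rho> l
      (((\<lambda>\<tau>. setv x (den p \<tau> x 0 + 1) (den p \<tau>)) ^^ m) ?\<rho>)" "l \<le> 1 + m * (K + 2)"
    using Suc.IH[of "Suc i" ?\<rho>] Suc.prems(1) by auto
  from exec_LoopT[OF B body l(1)] show ?case
    using k(2) l(2) by (intro exI[of _ "1 + (k + 1) + l"]) (simp add: funpow_Suc_right del: funpow.simps)
qed

text \<open>Compiled loops evaluate their bound in every round, \<open>den\<close> only on entry.
  Both agree because no bound mentions an array that the program writes; for the same reason all
  bounds keep the values they have at the start, and one \<open>M\<close> serves the whole
  program.\<close>

lemma exec_den:
  assumes "counters_ok p" "\<And>B. B \<in> bounds p \<Longrightarrow> aval B \<sigma> \<le> int M \<and> anames B \<inter> writes p = {}"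
  shows "\<exists>k. exec (compile p) \<sigma> k (den p \<sigma>) \<and> k \<le> poly (cost p) M"
  using assms
proof (induction p arbitrary: \<sigma>)
  case PSkip
  then show ?case using exec_Skip by fastforce
next
  case (PAssign A i a)
  show ?case using exec_Assign[of A i a \<sigma>] by (intro exI[of _ 1]) (simp add: fun_upd_def)
next
  case (PSeq p q)
  have "aval B (den p \<sigma>) = aval B \<sigma>" if "B \<in> bounds q" for B
    using PSeq.prems(2)[of B] that by (intro aval_cong den_frame) auto
  then have "\<exists>l. exec (compile q) (den p \<sigma>) l (den q (den p \<sigma>)) \<and> l \<le> poly (cost q) M"
    using PSeq.prems by (intro PSeq.IH(2)) (auto simp: Int_Un_distrib)
  then obtain l where l: "exec (compile q) (den p \<sigma>) l (den q (den p \<sigma>))" "l \<le> poly (cost q) M"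
    by blast
  have "\<exists>k. exec (compile p) \<sigma> k (den p \<sigma>) \<and> k \<le> poly (cost p) M"
    using PSeq.prems by (intro PSeq.IH(1)) (auto simp: Int_Un_distrib)
  then obtain k where k: "exec (compile p) \<sigma> k (den p \<sigma>)" "k \<le> poly (cost p) M"
    by blast
  from exec_Seq[OF k(1) l(1)] show ?case
    using k(2) l(2) by (intro exI[of _ "k + l"]) simp
next
  case (PIf b p q)
  have 1: "\<exists>k. exec (compile p) \<sigma> k (den p \<sigma>) \<and> k \<le> poly (cost p) M"
    using PIf.prems by (intro PIf.IH(1)) (auto simp: Int_Un_distrib)
  have 2: "\<exists>k. exec (compile q) \<sigma> k (den q \<sigma>) \<and> k \<le> poly (cost q) M"
    using PIf.prems by (intro PIf.IH(2)) (auto simp: Int_Un_distrib)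
  show ?case
  proof (cases "bval b \<sigma>")
    case True
    obtain k where "exec (compile p) \<sigma> k (den p \<sigma>)" "k \<le> poly (cost p) M" using 1 by blast
    then show ?thesis using exec_CondT[OF True] True by (intro exI[of _ "1 + k"]) simp
  next
    case False
    obtain k where "exec (compile q) \<sigma> k (den q \<sigma>)" "k \<le> poly (cost q) M" using 2 by blast
    then show ?thesis using exec_CondF[OF False] False by (intro exI[of _ "1 + k"]) simp
  qed
next
  case (PFor x B p)
  define \<sigma>0 where "\<sigma>0 = setv x 0 \<sigma>"
  define N where "N = nat (aval B \<sigma>)"
  show ?case
  proof (cases "aval B \<sigma> \<ge> 0")
    case True
    have st: "aval B' \<tau> = aval B' \<sigma>"
      if "B' \<in> insert B (bounds p)" "\<And>A. A \<notin> insert x (writes p) \<Longrightarrow> \<tau> A = \<sigma>0 A" for B' \<tau>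
    proof (rule aval_cong)
      fix A assume "A \<in> anames B'"
      then have "A \<notin> insert x (writes p)" using PFor.prems(2)[of B'] that(1) by auto
      then show "\<tau> A = \<sigma> A" using that(2) by (auto simp: \<sigma>0_def)
    qed
    have *: "aval B \<tau> = int N \<and> (\<exists>k. exec (compile p) \<tau> k (den p \<tau>) \<and> k \<le> poly (cost p) M)"
      if "\<And>A. A \<notin> insert x (writes p) \<Longrightarrow> \<tau> A = \<sigma>0 A" for \<tau>
    proof
      show "aval B \<tau> = int N" using st[OF _ that] True by (simp add: N_def)
      show "\<exists>k. exec (compile p) \<tau> k (den p \<tau>) \<and> k \<le> poly (cost p) M"
      proof (rule PFor.IH)
        fix B' assume B': "B' \<in> bounds p"
        have "aval B' \<tau> = aval B' \<sigma>" using st[OF _ that] B' by blast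
        then show "aval B' \<tau> \<le> int M \<and> anames B' \<inter> writes p = {}"
          using PFor.prems(2)[of B'] B' by auto
      qed (use PFor.prems in simp)
    qed
    have x: "x \<notin> writes p" using PFor.prems(1) by simp
    obtain k where k: "exec (Loop (Less (var x) B)
        (Seq (compile p) (Assign x (Const 0) (Add (var x) (Const 1))))) \<sigma>0 k
        (((\<lambda>\<tau>. setv x (den p \<tau> x 0 + 1) (den p \<tau>)) ^^ N) \<sigma>0)" "k \<le> 1 + N * (poly (cost p) M + 2)"
      using exec_loop[OF x *, where i = 0 and m = N and \<tau> = \<sigma>0] by (auto simp: \<sigma>0_def)
    have "exec (Assign x (Const 0) (Const 0)) \<sigma> 1 \<sigma>0"
      using exec_Assign[of x "Const 0" "Const 0" \<sigma>] by (simp add: \<sigma>0_def setv_def)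
    from exec_Seq[OF this k(1)]
    have "exec (compile (PFor x B p)) \<sigma> (1 + k) (den (PFor x B p) \<sigma>)"
      by (simp add: N_def \<sigma>0_def)
    moreover have "1 + k \<le> poly (cost (PFor x B p)) M"
    proof -
      have "N \<le> M" using PFor.prems(2)[of B] by (simp add: N_def nat_le_iff)
      then have "N * (poly (cost p) M + 2) \<le> M * (poly (cost p) M + 2)" by (rule mult_le_mono1)
      then show ?thesis using k(2) by (simp add: poly_numeral)
    qed
    ultimately show ?thesis by blast
  next
    case False
    \<comment> \<open>A negative bound: the test fails at once, matching the zero iterations in
      \<open>den\<close>.\<close>
    have "aval B \<sigma>0 = aval B \<sigma>"
    proof (rule aval_cong)
      fix A assume "A \<in> anames B"
      then have "A \<noteq> x" using PFor.prems(2)[of B] by auto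
      then show "\<sigma>0 A = \<sigma> A" by (simp add: \<sigma>0_def)
    qed
    then have stop: "\<not> bval (Less (var x) B) \<sigma>0" using False by (simp add: \<sigma>0_def)
    have start: "exec (Assign x (Const 0) (Const 0)) \<sigma> 1 \<sigma>0"
      using exec_Assign[of x "Const 0" "Const 0" \<sigma>] by (simp add: \<sigma>0_def setv_def)
    have "exec (compile (PFor x B p)) \<sigma> (1 + 1) \<sigma>0"
      unfolding compile.simps by (rule exec_Seq[OF start exec_LoopF[OF stop]])
    then show ?thesis
      using False by (intro exI[of _ "1 + 1"]) (simp add: \<sigma>0_def poly_numeral)
  qed
qed

text \<open>The increment follows the body, so the invariant must not depend on the counter
  (\<open>ins\<close>). The counter value is supplied to the step separately, together with the fact
  that all other arrays not written by the body are unchanged.\<close>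

lemma for_rule_setv:
  assumes "nat (aval B \<sigma>) = N" "x \<notin> writes p"
    and "I 0 (setv x 0 \<sigma>)"
    and step: "\<And>i \<tau>. i < N \<Longrightarrow> I i \<tau> \<Longrightarrow> \<tau> x 0 = int i \<Longrightarrow>
      (\<And>A. A \<noteq> x \<Longrightarrow> A \<notin> writes p \<Longrightarrow> \<tau> A = \<sigma> A) \<Longrightarrow> I (Suc i) (den p \<tau>)"
    and ins: "\<And>i \<tau> a. I i \<tau> \<Longrightarrow> I i (setv x a \<tau>)"
  shows "I N (den (PFor x B p) \<sigma>)"
proof -
  let ?F = "\<lambda>\<tau>. setv x (den p \<tau> x 0 + 1) (den p \<tau>)"
  have "m \<le> N \<Longrightarrow> I m ((?F ^^ m) (setv x 0 \<sigma>)) \<and> (?F ^^ m) (setv x 0 \<sigma>) x 0 = int m \<and>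
    (\<forall>A. A \<noteq> x \<longrightarrow> A \<notin> writes p \<longrightarrow> (?F ^^ m) (setv x 0 \<sigma>) A = \<sigma> A)" for m
  proof (induction m)
    case 0
    then show ?case using assms(3) by simp
  next
    case (Suc m)
    let ?\<tau> = "(?F ^^ m) (setv x 0 \<sigma>)"
    have IH: "I m ?\<tau>" "?\<tau> x 0 = int m" "\<And>A. A \<noteq> x \<Longrightarrow> A \<notin> writes p \<Longrightarrow> ?\<tau> A = \<sigma> A"
      using Suc by auto
    have "I (Suc m) (den p ?\<tau>)" using step[OF _ IH] Suc.prems by simp
    then have "I (Suc m) (?F ?\<tau>)" by (rule ins)
    then show ?case using IH den_frame[OF assms(2)] by (simp add: den_frame)
  qed
  from this[of N] show ?thesis using assms(1) by simp
qed

lemma for_rule: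
  assumes "nat (aval B \<sigma>) = N" "x \<notin> writes p"
    and "\<And>\<tau>. (\<And>A. A \<noteq> x \<Longrightarrow> \<tau> A = \<sigma> A) \<Longrightarrow> I 0 \<tau>"
    and "\<And>i \<tau>. i < N \<Longrightarrow> I i \<tau> \<Longrightarrow> \<tau> x 0 = int i \<Longrightarrow>
      (\<And>A. A \<noteq> x \<Longrightarrow> A \<notin> writes p \<Longrightarrow> \<tau> A = \<sigma> A) \<Longrightarrow> I (Suc i) (den p \<tau>)"
    and "\<And>i \<tau> a. I i \<tau> \<Longrightarrow> I i (setv x a \<tau>)"
  shows "I N (den (PFor x B p) \<sigma>)"
proof (rule for_rule_setv[where I = I, OF assms(1,2) _ assms(4,5)])
  show "I 0 (setv x 0 \<sigma>)" by (rule assms(3)) (rule setv_other)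
qed

text \<open>For searches without a loop exit: once the goal is reached it persists through the
  remaining rounds, and if it is never reached, every index has been refuted.\<close>

lemma for_search:
  assumes "nat (aval B \<sigma>) = N" "x \<notin> writes p" "Open \<sigma>"
    and Done: "\<And>\<tau> a. Done \<tau> \<Longrightarrow> Done (setv x a \<tau>)" "\<And>\<tau>. Done \<tau> \<Longrightarrow> Done (den p \<tau>)"
    and Open: "\<And>\<tau> a. Open \<tau> \<Longrightarrow> Open (setv x a \<tau>)"
    and step: "\<And>i \<tau>. i < N \<Longrightarrow> Open \<tau> \<Longrightarrow> \<tau> x 0 = int i \<Longrightarrow>
      (\<And>A. A \<noteq> x \<Longrightarrow> A \<notin> writes p \<Longrightarrow> \<tau> A = \<sigma> A) \<Longrightarrow>
      Done (den p \<tau>) \<or> Open (den p \<tau>) \<and> Q i"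
  shows "Done (den (PFor x B p) \<sigma>) \<or> Open (den (PFor x B p) \<sigma>) \<and> (\<forall>i < N. Q i)"
proof (rule for_rule_setv[where I = "\<lambda>i \<tau>. Done \<tau> \<or> Open \<tau> \<and> (\<forall>i' < i. Q i')", OF assms(1,2)])
  show "Done (setv x 0 \<sigma>) \<or> Open (setv x 0 \<sigma>) \<and> (\<forall>i' < 0. Q i')"
    using Open[OF assms(3)] by simp
next
  fix i \<tau>
  assume i: "i < N" "\<tau> x 0 = int i" and I: "Done \<tau> \<or> Open \<tau> \<and> (\<forall>i' < i. Q i')"
    and frame: "\<And>A. A \<noteq> x \<Longrightarrow> A \<notin> writes p \<Longrightarrow> \<tau> A = \<sigma> A"
  from I show "Done (den p \<tau>) \<or> Open (den p \<tau>) \<and> (\<forall>i' < Suc i. Q i')"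
  proof
    assume "Open \<tau> \<and> (\<forall>i' < i. Q i')"
    then show ?thesis using step[OF i(1) _ i(2) frame] by (auto simp: less_Suc_eq)
  qed (simp add: Done(2))
qed (use Done(1) Open in auto)

lemma for_keeps:
  assumes "x \<notin> writes p" "P \<sigma>" "\<And>\<tau> a. P \<tau> \<Longrightarrow> P (setv x a \<tau>)" "\<And>\<tau>. P \<tau> \<Longrightarrow> P (den p \<tau>)"
  shows "P (den (PFor x B p) \<sigma>)"
  by (rule for_rule_setv[where I = "\<lambda>_. P", OF refl assms(1)]) (use assms in auto)

section \<open>Graph routines\<close>

text \<open>The array \<open>row\<close> holds the multiples of \<open>n\<close> and \<open>tb\<close> those of \<open>n\<^sup>2\<close>, so that tables can be
  addressed without multiplication.\<close>

abbreviation nE :: aexp where "nE \<equiv> Cell ''in'' (Const 0)"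
abbreviation sE :: aexp where "sE \<equiv> Cell ''in'' (Const 1)"
abbreviation rE :: aexp where "rE \<equiv> Cell ''in'' (Const 3)"

text \<open>\<open>''row''\<close> at index \<open>n\<close> holds the square of \<open>n\<close>,
  so one adjacency matrix starting at address \<open>b\<close> is copied.\<close>

definition load :: "string \<Rightarrow> aexp \<Rightarrow> prog" where
  "load A b = PFor ''l'' (Cell ''row'' nE) (PAssign ''g'' (var ''l'') (Cell A (Add b (var ''l''))))"

definition set_edge :: "string \<Rightarrow> string \<Rightarrow> int \<Rightarrow> prog" where
  "set_edge x y c = PSeq
     (PAssign ''g'' (Add (Cell ''row'' (var x)) (var y)) (Const c))
     (PAssign ''g'' (Add (Cell ''row'' (var y)) (var x)) (Const c))"

definition scan :: prog where
  "scan = PFor ''rx'' nE (PFor ''ry'' nE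
     (PIf (Conj (Less (Const 0) (Cell ''re'' (var ''rx'')))
                (Less (Const 0) (Cell ''g'' (Add (Cell ''row'' (var ''rx'')) (var ''ry'')))))
        (PAssign ''re'' (var ''ry'') (Const 1)) PSkip))"

definition reach :: prog where
  "reach = PSeq (PFor ''l'' nE (PAssign ''re'' (var ''l'') (Const 0)))
     (PSeq (PAssign ''re'' sE (Const 1)) (PFor ''ri'' nE scan))"

text \<open>In \<open>reach\<close>, every round before the last one that changes anything adds a vertex, so \<open>n\<close> rounds
  suffice.\<close>

definition check :: prog where
  "check = PFor ''l'' nE (PIf (Less (Const 0) (Cell ''re'' (var ''l''))) PSkip
     (PAssign ''ok'' (Const 0) (Const 0)))"

lemma writes_routines [simp]:
  "writes (load A b) = {''l'', ''g''}"
  "writes (set_edge x y c) = {''g''}"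
  "writes scan = {''rx'', ''ry'', ''re''}"
  "writes reach = {''l'', ''ri'', ''rx'', ''ry'', ''re''}"
  "writes check = {''l'', ''ok''}"
  by (auto simp: load_def set_edge_def scan_def reach_def check_def)

lemma pair_index_eq_iff:
  fixes n u v u' v' :: nat
  assumes "v < n" "v' < n"
  shows "u * n + v = u' * n + v' \<longleftrightarrow> u = u' \<and> v = v'"
proof
  assume eq: "u * n + v = u' * n + v'"
  have "(u * n + v) div n = u" "(u' * n + v') div n = u'"
    "(u * n + v) mod n = v" "(u' * n + v') mod n = v'"
    using assms by auto
  then show "u = u' \<and> v = v'" using eq by metis
qed simp

lemma int_pair_index_eq_iff:
  fixes n u v u' v' :: nat
  assumes "v < n" "v' < n"
  shows "int u * int n + int v = int u' * int n + int v' \<longleftrightarrow> u = u' \<and> v = v'"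
proof -
  have "int u * int n + int v = int u' * int n + int v' \<longleftrightarrow>
      int (u * n + v) = int (u' * n + v')" by simp
  then show ?thesis unfolding of_nat_eq_iff pair_index_eq_iff[OF assms] .
qed

lemma pair_index_less: "u < m \<Longrightarrow> v < n \<Longrightarrow> u * n + v < m * (n::nat)"
proof -
  assume "u < m" "v < n"
  then have "u * n + v < Suc u * n" by simp
  also have "\<dots> \<le> m * n" using \<open>u < m\<close> by (intro mult_le_mono1) simp
  finally show ?thesis .
qed

section \<open>Correctness of the graph routines\<close>

locale machine =
  fixes n s r :: nat and inp :: "int \<Rightarrow> int"
  assumes inp: "inp 0 = int n" "inp 1 = int s" "inp 3 = int r" and s_less: "s < n"
begin

definition base :: "store \<Rightarrow> bool" where
  "base \<sigma> \<longleftrightarrow> \<sigma> ''in'' = inp \<and> (\<forall>i \<le> n. \<sigma> ''row'' (int i) = int i * int n) \<and>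
     (\<forall>k \<le> r. \<sigma> ''tb'' (int k) = int k * int n * int n)"

lemma base_cong:
  assumes "base \<sigma>" "\<tau> ''in'' = \<sigma> ''in''" "\<tau> ''row'' = \<sigma> ''row''" "\<tau> ''tb'' = \<sigma> ''tb''"
  shows "base \<tau>"
  using assms by (simp add: base_def)

lemma base_in [simp]: "base \<sigma> \<Longrightarrow> \<sigma> ''in'' = inp"
  and base_row [simp]: "base \<sigma> \<Longrightarrow> i \<le> n \<Longrightarrow> \<sigma> ''row'' (int i) = int i * int n"
  and base_tb [simp]: "base \<sigma> \<Longrightarrow> k \<le> r \<Longrightarrow> \<sigma> ''tb'' (int k) = int k * int n * int n"
  by (auto simp: base_def)

lemma base_den:
  assumes "base \<sigma>" "''in'' \<notin> writes p" "''row'' \<notin> writes p" "''tb'' \<notin> writes p"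
  shows "base (den p \<sigma>)"
  by (rule base_cong[OF assms(1)]) (simp_all add: den_frame assms)

lemma base_setv: "base \<sigma> \<Longrightarrow> x \<notin> {''in'', ''row'', ''tb''} \<Longrightarrow> base (setv x a \<sigma>)"
  by (erule base_cong) auto

definition holds :: "store \<Rightarrow> nat set set \<Rightarrow> bool" where
  "holds \<sigma> T \<longleftrightarrow> (\<forall>u < n. \<forall>v < n. \<sigma> ''g'' (int u * int n + int v) = (if {u, v} \<in> T then 1 else 0))"

lemma load_spec:
  assumes "base \<sigma>" "A \<notin> {''l'', ''g''}" "anames b \<inter> {''l'', ''g''} = {}" "i < n * n"
  shows "den (load A b) \<sigma> ''g'' (int i) = \<sigma> A (aval b \<sigma> + int i)"
proof -
  have "\<forall>m < n * n. den (load A b) \<sigma> ''g'' (int m) = \<sigma> A (aval b \<sigma> + int m)"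
    unfolding load_def
  proof (rule for_rule[where I = "\<lambda>i \<tau>. \<forall>m < i. \<tau> ''g'' (int m) = \<sigma> A (aval b \<sigma> + int m)"])
    show "nat (aval (Cell ''row'' nE) \<sigma>) = n * n"
      using assms(1) by (simp add: inp nat_mult_distrib)
  next
    fix i \<tau>
    assume *: "\<forall>m < i. \<tau> ''g'' (int m) = \<sigma> A (aval b \<sigma> + int m)" "\<tau> ''l'' 0 = int i"
      and frame: "\<And>A'. A' \<noteq> ''l'' \<Longrightarrow> A' \<notin> writes (PAssign ''g'' (var ''l'') (Cell A (Add b (var ''l'')))) \<Longrightarrow> \<tau> A' = \<sigma> A'"
    have "\<tau> A = \<sigma> A" by (rule frame) (use assms(2) in auto)
    moreover have "aval b \<tau> = aval b \<sigma>" by (rule aval_cong, rule frame) (use assms(3) in auto)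
    ultimately show "\<forall>m < Suc i. den (PAssign ''g'' (var ''l'') (Cell A (Add b (var ''l'')))) \<tau> ''g'' (int m)
        = \<sigma> A (aval b \<sigma> + int m)"
      using * by (auto simp: less_Suc_eq)
  qed auto
  then show ?thesis using assms(4) by blast
qed

lemma load_holds:
  assumes "base \<sigma>" "A \<notin> {''l'', ''g''}" "anames b \<inter> {''l'', ''g''} = {}"
    and "\<And>u v. u < n \<Longrightarrow> v < n \<Longrightarrow>
      \<sigma> A (aval b \<sigma> + (int u * int n + int v)) = (if {u, v} \<in> T then 1 else 0)"
  shows "holds (den (load A b) \<sigma>) T"
  unfolding holds_def
proof (intro allI impI)
  fix u v assume uv: "u < n" "v < n"
  have "den (load A b) \<sigma> ''g'' (int (u * n + v)) = \<sigma> A (aval b \<sigma> + int (u * n + v))"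
    by (rule load_spec[OF assms(1-3) pair_index_less[OF uv]])
  then show "den (load A b) \<sigma> ''g'' (int u * int n + int v) = (if {u, v} \<in> T then 1 else 0)"
    using assms(4)[OF uv] by simp
qed

lemma set_edge_spec:
  assumes "base \<sigma>" "\<sigma> x 0 = int u" "\<sigma> y 0 = int v" "u < n" "v < n" "x \<noteq> ''g''" "y \<noteq> ''g''"
    and "a < n" "b < n"
  shows "den (set_edge x y c) \<sigma> ''g'' (int a * int n + int b) =
    (if {a, b} = {u, v} then c else \<sigma> ''g'' (int a * int n + int b))"
proof -
  have "den (set_edge x y c) \<sigma> ''g'' =
      (\<sigma> ''g'')(int u * int n + int v := c, int v * int n + int u := c)"
    using assms(1-7) by (simp add: set_edge_def)
  moreover have "int a * int n + int b = int u * int n + int v \<longleftrightarrow> a = u \<and> b = v"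
    "int a * int n + int b = int v * int n + int u \<longleftrightarrow> a = v \<and> b = u"
    using assms(4,5,9) by (simp_all only: int_pair_index_eq_iff)
  ultimately show ?thesis by (simp only: fun_upd_apply doubleton_eq_iff split: if_split) blast
qed

lemma set_edge_holds:
  assumes "base \<sigma>" "holds \<sigma> T" "\<sigma> x 0 = int u" "\<sigma> y 0 = int v" "u < n" "v < n"
    and "x \<noteq> ''g''" "y \<noteq> ''g''"
  shows "holds (den (set_edge x y 0) \<sigma>) (T - {{u, v}})"
    and "holds (den (set_edge x y 1) \<sigma>) (insert {u, v} T)"
  using assms(2) unfolding holds_def by (simp_all add: set_edge_spec[OF assms(1,3-8)])

definition reached :: "store \<Rightarrow> nat set \<Rightarrow> bool" where
  "reached \<sigma> A \<longleftrightarrow> A \<subseteq> {..<n} \<and> (\<forall>y < n. \<sigma> ''re'' (int y) = (if y \<in> A then 1 else 0))"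

text \<open>The table is updated in place, so a round may proceed further than one edge. The result
  is therefore only enclosed: it has at least \<open>A\<close> and its neighbours, at most the
  component of \<open>s\<close>.\<close>

lemma scan_spec:
  assumes "base \<sigma>" "holds \<sigma> T" "reached \<sigma> A" "A \<subseteq> {y. joined T s y}"
  shows "\<exists>A'. reached (den scan \<sigma>) A' \<and> A \<subseteq> A' \<and> A' \<subseteq> {y. joined T s y} \<and>
    (\<forall>x \<in> A. \<forall>y < n. {x, y} \<in> T \<longrightarrow> y \<in> A')"
proof -
  define J where "J i \<tau> \<longleftrightarrow> (\<exists>A'. reached \<tau> A' \<and> A \<subseteq> A' \<and> A' \<subseteq> {y. joined T s y} \<and>
    (\<forall>x \<in> A. x < i \<longrightarrow> (\<forall>y < n. {x, y} \<in> T \<longrightarrow> y \<in> A')))" for i \<tau>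
  have "J n (den scan \<sigma>)"
    unfolding scan_def
  proof (rule for_rule)
    show "nat (aval nE \<sigma>) = n" using assms(1) by (simp add: inp)
    show "J 0 \<tau>" if "\<And>A. A \<noteq> ''rx'' \<Longrightarrow> \<tau> A = \<sigma> A" for \<tau>
      unfolding J_def using assms that[of "''re''"]
      by (intro exI[of _ A]) (auto simp: reached_def)
    show "J i (setv ''rx'' a \<tau>)" if "J i \<tau>" for i \<tau> a
      using that by (simp add: J_def reached_def)
  next
    fix i \<tau>
    let ?body = "PIf (Conj (Less (Const 0) (Cell ''re'' (var ''rx'')))
                (Less (Const 0) (Cell ''g'' (Add (Cell ''row'' (var ''rx'')) (var ''ry'')))))
        (PAssign ''re'' (var ''ry'') (Const 1)) PSkip"
    assume i: "i < n" "J i \<tau>" "\<tau> ''rx'' 0 = int i"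
      and frame: "\<And>A. A \<noteq> ''rx'' \<Longrightarrow> A \<notin> writes (PFor ''ry'' nE ?body) \<Longrightarrow> \<tau> A = \<sigma> A"
    have eq: "\<tau> ''in'' = \<sigma> ''in''" "\<tau> ''row'' = \<sigma> ''row''" "\<tau> ''tb'' = \<sigma> ''tb''" "\<tau> ''g'' = \<sigma> ''g''"
      by (rule frame; simp)+
    have b: "base \<tau>" by (rule base_cong[OF assms(1) eq(1-3)])
    have h: "holds \<tau> T" using assms(2) eq(4) by (simp add: holds_def)
    from i(2) obtain A1 where A1: "reached \<tau> A1" "A \<subseteq> A1" "A1 \<subseteq> {y. joined T s y}"
      "\<forall>x \<in> A. x < i \<longrightarrow> (\<forall>y < n. {x, y} \<in> T \<longrightarrow> y \<in> A1)" unfolding J_def by blast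
    define I where "I m \<rho> \<longleftrightarrow> (\<exists>A2. reached \<rho> A2 \<and> A1 \<subseteq> A2 \<and> A2 \<subseteq> {y. joined T s y} \<and>
      (i \<in> A \<longrightarrow> (\<forall>y < m. {i, y} \<in> T \<longrightarrow> y \<in> A2)))" for m \<rho>
    have "I n (den (PFor ''ry'' nE ?body) \<tau>)"
    proof (rule for_rule)
      show "nat (aval nE \<tau>) = n" using b by (simp add: inp)
      show "I 0 \<rho>" if "\<And>A. A \<noteq> ''ry'' \<Longrightarrow> \<rho> A = \<tau> A" for \<rho>
        unfolding I_def using A1 that[of "''re''"]
        by (intro exI[of _ A1]) (auto simp: reached_def)
      show "I m (setv ''ry'' a \<rho>)" if "I m \<rho>" for m \<rho> a
        using that by (simp add: I_def reached_def)
    next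
      fix m \<rho>
      assume m: "m < n" "I m \<rho>" "\<rho> ''ry'' 0 = int m"
        and frame: "\<And>A. A \<noteq> ''ry'' \<Longrightarrow> A \<notin> writes ?body \<Longrightarrow> \<rho> A = \<tau> A"
      have eq: "\<rho> ''row'' = \<tau> ''row''" "\<rho> ''g'' = \<tau> ''g''" "\<rho> ''rx'' = \<tau> ''rx''"
        by (rule frame; simp)+
      from m(2) obtain A2 where A2: "reached \<rho> A2" "A1 \<subseteq> A2" "A2 \<subseteq> {y. joined T s y}"
        "i \<in> A \<longrightarrow> (\<forall>y < m. {i, y} \<in> T \<longrightarrow> y \<in> A2)" unfolding I_def by blast
      have g: "\<rho> ''g'' (\<rho> ''row'' (\<rho> ''rx'' 0) + \<rho> ''ry'' 0) = (if {i, m} \<in> T then 1 else 0)"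
        using h b i(1,3) m(1,3) by (simp add: eq holds_def)
      have re: "\<rho> ''re'' (\<rho> ''rx'' 0) = (if i \<in> A2 then 1 else 0)"
        using A2(1) i(1,3) by (simp add: eq reached_def)
      show "I (Suc m) (den ?body \<rho>)"
      proof (cases "i \<in> A2 \<and> {i, m} \<in> T")
        case True
        have "joined T s m" using True A2(3) joined_trans[OF _ joined_edge, of T s i m] by auto
        moreover have "reached (den ?body \<rho>) (insert m A2)"
          using True A2(1) g re m(1,3) by (auto simp: reached_def)
        ultimately show ?thesis
          unfolding I_def using A2(2-4) by (intro exI[of _ "insert m A2"]) (auto simp: less_Suc_eq)
      next
        case False
        then have "reached (den ?body \<rho>) A2"
          using A2(1) g re by (auto simp: reached_def)
        moreover have "i \<in> A \<longrightarrow> {i, m} \<notin> T" using False A1(2) A2(2) by auto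
        ultimately show ?thesis
          unfolding I_def using A2(2-4) by (intro exI[of _ A2]) (auto simp: less_Suc_eq)
      qed
    qed simp
    then obtain A2 where "reached (den (PFor ''ry'' nE ?body) \<tau>) A2" "A1 \<subseteq> A2"
      "A2 \<subseteq> {y. joined T s y}" "i \<in> A \<longrightarrow> (\<forall>y < n. {i, y} \<in> T \<longrightarrow> y \<in> A2)" unfolding I_def by blast
    then show "J (Suc i) (den (PFor ''ry'' nE ?body) \<tau>)"
      unfolding J_def using A1(2,4) by (intro exI[of _ A2]) (auto simp: less_Suc_eq)
  qed simp
  then obtain A' where A': "reached (den scan \<sigma>) A'" "A \<subseteq> A'" "A' \<subseteq> {y. joined T s y}"
    "\<forall>x \<in> A. x < n \<longrightarrow> (\<forall>y < n. {x, y} \<in> T \<longrightarrow> y \<in> A')" unfolding J_def by blast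
  moreover have "x < n" if "x \<in> A" for x using that assms(3) by (auto simp: reached_def)
  ultimately show ?thesis by blast
qed

lemma reach_spec:
  assumes "base \<sigma>" "holds \<sigma> T" "T \<subseteq> complete_edges {..<n}"
  shows "reached (den reach \<sigma>) {y. joined T s y}"
proof -
  let ?R = "{y. joined T s y}"
  have R: "?R \<subseteq> {..<n}" using joined_in[OF assms(3)] s_less by blast
  let ?z = "PFor ''l'' nE (PAssign ''re'' (var ''l'') (Const 0))"
  let ?a = "PAssign ''re'' sE (Const 1)"
  define \<sigma>1 where "\<sigma>1 = den ?z \<sigma>"
  define \<sigma>2 where "\<sigma>2 = den ?a \<sigma>1"
  have "\<forall>m < n. \<sigma>1 ''re'' (int m) = 0"
    unfolding \<sigma>1_def
    by (rule for_rule[where I = "\<lambda>i \<tau>. \<forall>m < i. \<tau> ''re'' (int m) = 0"])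
      (use assms(1) in \<open>auto simp: inp less_Suc_eq\<close>)
  moreover have eq1: "\<sigma>1 A = \<sigma> A" if "A \<notin> {''l'', ''re''}" for A
    using that unfolding \<sigma>1_def by (intro den_frame) auto
  ultimately have r2: "reached \<sigma>2 {s}"
    using assms(1) s_less by (auto simp: \<sigma>2_def reached_def inp)
  have eq2: "\<sigma>2 A = \<sigma> A" if "A \<notin> {''l'', ''re''}" for A
    using that eq1[OF that] by (simp add: \<sigma>2_def)
  have b2: "base \<sigma>2" by (rule base_cong[OF assms(1)]; rule eq2; simp)
  have h2: "holds \<sigma>2 T" using assms(2) eq2[of "''g''"] by (simp add: holds_def)
  define closed where "closed A \<longleftrightarrow> (\<forall>x \<in> A. \<forall>y < n. {x, y} \<in> T \<longrightarrow> y \<in> A)" for A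
  \<comment> \<open>Either the set is closed, or it outgrows the number of rounds, starting with the
    one vertex \<open>s\<close> after none. After \<open>n\<close> rounds the second alternative
    would need more than \<open>n\<close> vertices.\<close>
  define I where "I i \<tau> \<longleftrightarrow> (\<exists>A. reached \<tau> A \<and> s \<in> A \<and> A \<subseteq> ?R \<and> (closed A \<or> i < card A))" for i \<tau>
  have full: "A = ?R" if "s \<in> A" "A \<subseteq> ?R" "closed A" for A
  proof
    show "?R \<subseteq> A"
    proof
      fix y assume "y \<in> ?R"
      then have "joined T s y" by simp
      then show "y \<in> A"
      proof (induction rule: joined_induct)
        case (step y z)
        have "{y, z} \<in> complete_edges {..<n}" using step(2) assms(3) by auto
        then have "z < n" by (simp add: complete_edges_iff)
        then show ?case using that(3) step(2,3) unfolding closed_def by blast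
      qed (rule that(1))
    qed
  qed (rule that(2))
  have "I n (den (PFor ''ri'' nE scan) \<sigma>2)"
  proof (rule for_rule)
    show "nat (aval nE \<sigma>2) = n" using b2 by (simp add: inp)
    show "I 0 \<tau>" if "\<And>A. A \<noteq> ''ri'' \<Longrightarrow> \<tau> A = \<sigma>2 A" for \<tau>
      unfolding I_def using r2 that[of "''re''"]
      by (intro exI[of _ "{s}"]) (auto simp: reached_def)
    show "I i (setv ''ri'' a \<tau>)" if "I i \<tau>" for i \<tau> a
      using that by (simp add: I_def reached_def)
  next
    fix i \<tau>
    assume i: "I i \<tau>" and frame: "\<And>A. A \<noteq> ''ri'' \<Longrightarrow> A \<notin> writes scan \<Longrightarrow> \<tau> A = \<sigma>2 A"
    from i obtain A where A: "reached \<tau> A" "s \<in> A" "A \<subseteq> ?R" "closed A \<or> i < card A"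
      unfolding I_def by blast
    have b: "base \<tau>" by (rule base_cong[OF b2]; rule frame; simp)
    have h: "holds \<tau> T" using h2 frame[of "''g''"] by (simp add: holds_def)
    obtain A' where A': "reached (den scan \<tau>) A'" "A \<subseteq> A'" "A' \<subseteq> ?R"
      "\<forall>x \<in> A. \<forall>y < n. {x, y} \<in> T \<longrightarrow> y \<in> A'"
      using scan_spec[OF b h A(1,3)] by blast
    have fin: "finite A'" using finite_subset[OF order_trans[OF A'(3) R]] by simp
    have "closed A' \<or> Suc i < card A'"
    proof (cases "closed A")
      case True
      then have "A' = A" using full[OF A(2,3)] A'(2,3) by auto
      then show ?thesis using True by simp
    next
      case False
      then obtain x y where "x \<in> A" "y < n" "{x, y} \<in> T" "y \<notin> A" unfolding closed_def by blast
      then have "A \<subset> A'" using A'(2,4) by blast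
      then have "card A < card A'" using fin by (simp add: psubset_card_mono)
      then show ?thesis using A(4) False by simp
    qed
    then show "I (Suc i) (den scan \<tau>)"
      unfolding I_def using A' A(2) by blast
  qed simp
  then obtain A where A: "reached (den (PFor ''ri'' nE scan) \<sigma>2) A" "s \<in> A" "A \<subseteq> ?R"
    "closed A \<or> n < card A" unfolding I_def by blast
  have "card A \<le> n" using card_mono[OF _ order_trans[OF A(3) R]] by simp
  then have "A = ?R" using full[OF A(2,3)] A(4) by simp
  then show ?thesis using A(1) by (simp add: reach_def \<sigma>1_def \<sigma>2_def)
qed

text \<open>The flag is only ever cleared, so successive tests form a conjunction; \<open>P\<close>
  stands for the earlier ones. Reaching everything from \<open>s\<close> amounts to
  connectivity.\<close>

lemma check_spec:
  assumes "base \<sigma>" "reached \<sigma> {y. joined T s y}" "\<sigma> ''ok'' 0 = (if P then 1 else 0)"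
  shows "den check \<sigma> ''ok'' 0 = (if P \<and> connected_on {..<n} T then 1 else 0)"
proof -
  have "den check \<sigma> ''ok'' 0 = (if P \<and> (\<forall>m < n. joined T s m) then 1 else 0)"
    unfolding check_def
  proof (rule for_rule[where I = "\<lambda>i \<tau>. \<tau> ''ok'' 0 = (if P \<and> (\<forall>m < i. joined T s m) then 1 else 0)"])
    show "nat (aval nE \<sigma>) = n" using assms(1) by (simp add: inp)
  next
    fix i \<tau>
    let ?body = "PIf (Less (Const 0) (Cell ''re'' (var ''l''))) PSkip
     (PAssign ''ok'' (Const 0) (Const 0))"
    assume i: "i < n" "\<tau> ''ok'' 0 = (if P \<and> (\<forall>m < i. joined T s m) then 1 else 0)" "\<tau> ''l'' 0 = int i"
      and frame: "\<And>A. A \<noteq> ''l'' \<Longrightarrow> A \<notin> writes ?body \<Longrightarrow> \<tau> A = \<sigma> A"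
    have "\<tau> ''re'' = \<sigma> ''re''" by (rule frame) auto
    then have "\<tau> ''re'' (\<tau> ''l'' 0) = (if joined T s i then 1 else 0)"
      using assms(2) i(1,3) by (simp add: reached_def)
    then show "den ?body \<tau> ''ok'' 0 = (if P \<and> (\<forall>m < Suc i. joined T s m) then 1 else 0)"
      using i(2) by (auto simp: less_Suc_eq)
  qed (use assms(3) in auto)
  moreover have "(\<forall>m < n. joined T s m) \<longleftrightarrow> connected_on {..<n} T"
  proof
    assume all: "\<forall>m < n. joined T s m"
    show "connected_on {..<n} T"
      unfolding connected_on_joined
    proof (intro ballI)
      fix u v assume "u \<in> {..<n}" "v \<in> {..<n}"
      then show "joined T u v" using all joined_trans[OF joined_sym, of T s u v] by simp
    qed
  qed (use s_less in \<open>simp add: connected_on_joined\<close>)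
  ultimately show ?thesis by simp
qed

end

section \<open>Computing the chain of relevant cuts\<close>

context reassembly
begin

lemma rel_fundamental:
  assumes "U \<in> rel j" "1 \<le> j"
  obtains k u v where "k \<in> {1..r}" "{u, v} \<in> S0 k" "u \<in> V" "v \<in> V"
    "{y. joined (S0 k - {{u, v}}) s y} = U"
proof -
  note U = relD[OF assms]
  have "\<exists>k \<in> {1..r}. card (S0 k \<inter> cut V U) = 1"
  proof (rule ccontr)
    assume contr: "\<not> ?thesis"
    have "2 * real r = (\<Sum>k = 1..r. 2)" by simp
    also have "\<dots> \<le> (\<Sum>k = 1..r. real (card (S0 k \<inter> cut V U)))"
    proof (rule sum_mono)
      fix k assume k: "k \<in> {1..r}"
      then have "card (S0 k \<inter> cut V U) \<noteq> 1" "card (S0 k \<inter> cut V U) \<ge> 1"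
        using contr tree_crosses[OF ok_S0 k U(4,1)] by auto
      then show "2 \<le> real (card (S0 k \<inter> cut V U))" by simp
    qed
    also have "\<dots> \<le> real r * (sum xs (cut V U) + eps)" by (rule trees_upper[OF ok_S0 cut_subset])
    also have "\<dots> < 2 * real r" using U(6) assms(2) by simp
    finally show False by simp
  qed
  then obtain k where k: "k \<in> {1..r}" "card (S0 k \<inter> cut V U) = 1" by blast
  then obtain e where e: "S0 k \<inter> cut V U = {e}" by (auto simp: card_1_singleton_iff)
  then have "e \<in> cut V U" by auto
  then obtain u v where uv: "e = {u, v}" "u \<in> V" "v \<in> V" "u \<in> U" "v \<notin> U" by (rule cutE)
  note tr = ok_tree[OF ok_S0 k(1)]
  have "{y. joined (S0 k - {{u, v}}) s y} = U"
  proof (intro equalityI subsetI)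
    fix y assume "y \<in> U"
    then have "joined (induced (S0 k) U) s y"
      using tree_one_crossing(1)[OF fin tr U(4,1) k(2)] U(2) by (simp add: connected_on_joined)
    then have "joined (S0 k - {{u, v}}) s y"
      by (rule joined_mono) (use uv(5) in \<open>auto simp: induced_def\<close>)
    then show "y \<in> {y. joined (S0 k - {{u, v}}) s y}" by simp
  next
    fix y assume y: "y \<in> {y. joined (S0 k - {{u, v}}) s y}"
    show "y \<in> U"
    proof (rule ccontr)
      assume "y \<notin> U"
      \<comment> \<open>A walk leaving \<open>U\<close> would need an edge of the cut, but the only
        one in the tree has been deleted.\<close>
      then obtain c d where cd: "{c, d} \<in> S0 k - {{u, v}}" "c \<in> U" "d \<notin> U"
        using joined_crossing[of "S0 k - {{u, v}}" s y U] y U(2) by auto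
      then have "{c, d} \<in> complete_edges V" using treeD(1)[OF tr] by auto
      then have "{c, d} \<in> S0 k \<inter> cut V U"
        using cd by (auto simp: edge_in_cut_iff complete_edges_iff)
      then show False using e uv(1) cd(1) by auto
    qed
  qed
  moreover have "{u, v} \<in> S0 k" using e uv(1) by auto
  ultimately show ?thesis using that k(1) uv(2,3) by blast
qed

text \<open>A set of the chain separates low ranks from high ones, so the left side fails for
  members. For a new \<open>U\<close>, take \<open>x\<close> of largest rank inside and
  \<open>y\<close> of smallest rank outside: if \<open>x\<close> ranked below \<open>y\<close>, some
  \<open>W\<close> in \<open>F\<close> would contain \<open>x\<close> but not \<open>y\<close>. As
  \<open>W\<close> and \<open>U\<close> are nested and distinct, a vertex in the larger but not in
  the smaller would contradict the choice of \<open>x\<close> or \<open>y\<close>.\<close>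

lemma new_member_iff:
  assumes "F \<subseteq> rel j" "U \<in> rel j" "1 \<le> j"
  shows "(\<exists>x \<in> U. \<exists>y \<in> V - U. card {W \<in> F. y \<notin> W} \<le> card {W \<in> F. x \<notin> W}) \<longleftrightarrow> U \<notin> F"
proof -
  let ?f = "\<lambda>v. card {W \<in> F. v \<notin> W}"
  have finF: "finite F" using assms(1) finite_rel finite_subset by blast
  have chain: "A \<subseteq> B \<or> B \<subseteq> A" if "A \<in> F \<or> A = U" "B \<in> F \<or> B = U" for A B
    using rel_chain[of A j B] assms that by auto
  have less: "?f x < ?f y" if "W \<in> F" "x \<in> W" "y \<notin> W" for W x y
  proof (rule psubset_card_mono)
    show "{W \<in> F. x \<notin> W} \<subset> {W \<in> F. y \<notin> W}"
      using chain[of _ W] that by blast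
  qed (use finF in simp)
  note U = relD[OF assms(2,3)]
  have finU: "finite U" "U \<noteq> {}" "finite (V - U)" "V - U \<noteq> {}"
    using U(1,4) fin finite_subset[of U V] by auto
  show ?thesis
  proof
    assume "\<exists>x \<in> U. \<exists>y \<in> V - U. ?f y \<le> ?f x"
    then show "U \<notin> F" using less by fastforce
  next
    assume new: "U \<notin> F"
    have "Max (?f ` U) \<in> ?f ` U" using finU by (intro Max_in) auto
    then obtain x where "x \<in> U" "?f x = Max (?f ` U)" by auto
    then have x: "x \<in> U" "\<And>z. z \<in> U \<Longrightarrow> ?f z \<le> ?f x" using finU by simp_all
    have "Min (?f ` (V - U)) \<in> ?f ` (V - U)" using finU by (intro Min_in) auto
    then obtain y where "y \<in> V - U" "?f y = Min (?f ` (V - U))" by auto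
    then have y: "y \<in> V - U" "\<And>z. z \<in> V - U \<Longrightarrow> ?f y \<le> ?f z" using finU by simp_all
    have "?f y \<le> ?f x"
    proof (rule ccontr)
      assume "\<not> ?f y \<le> ?f x"
      then have "\<not> {W \<in> F. y \<notin> W} \<subseteq> {W \<in> F. x \<notin> W}"
        using card_mono[of "{W \<in> F. x \<notin> W}" "{W \<in> F. y \<notin> W}"] finF by auto
      then obtain W where W: "W \<in> F" "y \<notin> W" "x \<in> W" by blast
      have "W \<noteq> U" using W(1) new by auto
      then consider "W \<subset> U" | "U \<subset> W" using chain[of W U] W(1) by blast
      then show False
      proof cases
        case 1
        then obtain z where z: "z \<in> U" "z \<notin> W" by blast
        show False using less[OF W(1,3) z(2)] x(2)[OF z(1)] by simp
      next
        case 2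
        then obtain z where z: "z \<in> W" "z \<notin> U" by blast
        then have "z \<in> V - U" using W(1) assms(1) relD(1)[of W j] assms(3) by auto
        from y(2)[OF this] show False using less[OF W(1) z(1) W(2)] by simp
      qed
    qed
    then show "\<exists>x \<in> U. \<exists>y \<in> V - U. ?f y \<le> ?f x" using x(1) y(1) by blast
  qed
qed

end

text \<open>Each edge of the cut has one ordered pair leading from inside to outside, so a double
  loop over the vertices meets it once.\<close>

lemma sum_cut_pairs:
  fixes a :: "nat set \<Rightarrow> int"
  assumes "U \<subseteq> {..<n}"
  shows "(\<Sum>x<n. \<Sum>y<n. if x \<in> U \<and> y \<notin> U then a {x, y} else 0) = sum a (cut {..<n} U)"
proof -
  have finU: "finite U" using assms finite_subset by blast
  have "bij_betw (\<lambda>(x, y). {x, y}) (U \<times> ({..<n} - U)) (cut {..<n} U)"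
    unfolding bij_betw_def
  proof
    show "inj_on (\<lambda>(x, y). {x, y}) (U \<times> ({..<n} - U))"
      by (auto simp: inj_on_def doubleton_eq_iff)
    show "(\<lambda>(x, y). {x, y}) ` (U \<times> ({..<n} - U)) = cut {..<n} U"
    proof (intro equalityI subsetI)
      fix e assume "e \<in> cut {..<n} U"
      then obtain x y where "e = {x, y}" "y < n" "x \<in> U" "y \<notin> U" by (auto elim: cutE)
      then show "e \<in> (\<lambda>(x, y). {x, y}) ` (U \<times> ({..<n} - U))" by force
    qed (use assms in \<open>auto simp: edge_in_cut_iff\<close>)
  qed
  from sum.reindex_bij_betw[OF this, of a]
  have "sum a (cut {..<n} U) = (\<Sum>(x, y) \<in> U \<times> ({..<n} - U). a {x, y})"
    by (simp add: case_prod_unfold)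
  also have "\<dots> = (\<Sum>x \<in> U. \<Sum>y \<in> {..<n} - U. a {x, y})"
    by (simp add: sum.cartesian_product)
  also have "\<dots> = (\<Sum>x<n. if x \<in> U then \<Sum>y<n. if y \<notin> U then a {x, y} else 0 else 0)"
  proof -
    have "(\<Sum>y \<in> {..<n} - U. a {x, y}) = (\<Sum>y<n. if y \<notin> U then a {x, y} else 0)" for x
      by (rule sum.mono_neutral_cong_left) auto
    then show ?thesis
      using assms by (auto intro!: sum.mono_neutral_cong_left)
  qed
  also have "\<dots> = (\<Sum>x<n. \<Sum>y<n. if x \<in> U \<and> y \<notin> U then a {x, y} else 0)"
    by (intro sum.cong refl) auto
  finally show ?thesis by simp
qed

text \<open>Programs number the trees from \<open>0\<close>. The scalar \<open>jd\<close> holds \<open>j D\<close>, and \<open>be\<close> holds for each vertex the number of distinct relevant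
  sets found so far that miss it. The same cut arises from many tree edges; a relevant set \<open>U\<close> has
  not been counted before (\<open>nw\<close>) iff some vertex outside \<open>U\<close> has a value of \<open>be\<close> that is not larger
  than that of some vertex inside.\<close>

definition measure_cut :: prog where
  "measure_cut = PSeq (PAssign ''ac'' (Const 0) (Const 0)) (PSeq (PAssign ''nw'' (Const 0) (Const 0))
     (PFor ''x'' nE (PFor ''y'' nE
       (PIf (Conj (Less (Const 0) (Cell ''re'' (var ''x''))) (Neg (Less (Const 0) (Cell ''re'' (var ''y'')))))
         (PSeq (PAssign ''ac'' (Const 0) (Add (var ''ac'')
             (Cell ''in'' (Add (Const 6) (Add (Cell ''row'' (var ''x'')) (var ''y''))))))
           (PIf (Neg (Less (Cell ''be'' (var ''x'')) (Cell ''be'' (var ''y''))))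
             (PAssign ''nw'' (Const 0) (Const 1)) PSkip))
         PSkip))))"

text \<open>Multiplication by \<open>r\<close> as repeated addition. The relevance condition is
  multiplied by \<open>D\<close>, so that integers are compared.\<close>

definition weigh :: prog where
  "weigh = PSeq (PAssign ''q'' (Const 0) (Const 0)) (PFor ''l'' rE
     (PAssign ''q'' (Const 0) (Add (var ''q'') (Sub (Sub
       (Add (Cell ''in'' (Const 4)) (Cell ''in'' (Const 4))) (var ''ac'')) (Cell ''in'' (Const 5))))))"

definition raise :: prog where
  "raise = PFor ''l'' nE (PIf (Less (Const 0) (Cell ''re'' (var ''l''))) PSkip
     (PAssign ''be'' (var ''l'') (Add (Cell ''be'' (var ''l'')) (Const 1))))"

definition test_cut :: prog where
  "test_cut = PSeq measure_cut (PSeq weigh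
     (PIf (Conj (Less (var ''jd'') (var ''q'')) (Less (Const 0) (var ''nw''))) raise PSkip))"

text \<open>In the input, six numbers and the \<open>n * n\<close> entries of the edge vector
  precede the matrices of the trees. Each tree edge is met in both orientations, which the test for
  new sets makes harmless.\<close>

definition cut_body :: prog where
  "cut_body = PIf (Less (Const 0) (Cell ''in'' (Add (Add (Const 6) (Cell ''row'' nE))
       (Add (Cell ''tb'' (var ''k'')) (Add (Cell ''row'' (var ''u'')) (var ''v''))))))
     (PSeq (load ''in'' (Add (Add (Const 6) (Cell ''row'' nE)) (Cell ''tb'' (var ''k''))))
       (PSeq (set_edge ''u'' ''v'' 0) (PSeq reach test_cut)))
     PSkip"

definition level :: prog where
  "level = PSeq (PFor ''l'' nE (PAssign ''be'' (var ''l'') (Const 0)))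
     (PFor ''k'' rE (PFor ''u'' nE (PFor ''v'' nE cut_body)))"

lemma writes_level [simp]:
  "writes measure_cut = {''ac'', ''nw'', ''x'', ''y''}"
  "writes weigh = {''q'', ''l''}"
  "writes raise = {''l'', ''be''}"
  "writes test_cut = {''ac'', ''nw'', ''x'', ''y'', ''q'', ''l'', ''be''}"
  "writes cut_body = {''ac'', ''nw'', ''x'', ''y'', ''q'', ''l'', ''be'', ''g'', ''ri'', ''rx'', ''ry'', ''re''}"
  "writes level = {''k'', ''u'', ''v'', ''ac'', ''nw'', ''x'', ''y'', ''q'', ''l'', ''be'', ''g'', ''ri'', ''rx'', ''ry'', ''re''}"
  by (auto simp: measure_cut_def weigh_def raise_def test_cut_def cut_body_def level_def)

section \<open>Correctness of the rank computation\<close>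

locale machine_instance = reassembly "{..<n}" s t xs eps r S0 + machine n s r inp
  for n s t r :: nat and xs :: "nat set \<Rightarrow> real" and eps :: real
    and S0 :: "nat \<Rightarrow> nat set set" and inp :: "int \<Rightarrow> int" +
  fixes D b :: int and a :: "nat set \<Rightarrow> int"
  assumes D: "D > 0" and xs: "xs = (\<lambda>e. real_of_int (a e) / real_of_int D)"
    and eps_eq: "eps = real_of_int b / real_of_int D"
    and inp_D: "inp 4 = D" and inp_b: "inp 5 = b"
    and inp_a: "\<And>u v. u < n \<Longrightarrow> v < n \<Longrightarrow> u \<noteq> v \<Longrightarrow> inp (6 + (int u * int n + int v)) = a {u, v}"
    and inp_S: "\<And>k u v. k < r \<Longrightarrow> u < n \<Longrightarrow> v < n \<Longrightarrow>
      inp (6 + int n * int n + (int k * int n * int n + (int u * int n + int v))) =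
        (if {u, v} \<in> S0 (Suc k) then 1 else 0)"
begin

lemma measure_cut_spec:
  assumes "base \<sigma>" "reached \<sigma> U" "\<And>w. w < n \<Longrightarrow> \<sigma> ''be'' (int w) = int (f w)"
  shows "den measure_cut \<sigma> ''ac'' 0 = sum a (cut {..<n} U)"
    and "den measure_cut \<sigma> ''nw'' 0 = (if \<exists>x \<in> U. \<exists>y \<in> {..<n} - U. f y \<le> f x then 1 else 0)"
proof -
  define w where "w x y = (if x \<in> U \<and> y \<notin> U then a {x, y} else 0)" for x y
  define c where "c x y \<longleftrightarrow> x \<in> U \<and> y \<notin> U \<and> f y \<le> f x" for x y
  let ?body = "PIf (Conj (Less (Const 0) (Cell ''re'' (var ''x''))) (Neg (Less (Const 0) (Cell ''re'' (var ''y'')))))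
         (PSeq (PAssign ''ac'' (Const 0) (Add (var ''ac'')
             (Cell ''in'' (Add (Const 6) (Add (Cell ''row'' (var ''x'')) (var ''y''))))))
           (PIf (Neg (Less (Cell ''be'' (var ''x'')) (Cell ''be'' (var ''y''))))
             (PAssign ''nw'' (Const 0) (Const 1)) PSkip))
         PSkip"
  define J where "J i \<tau> \<longleftrightarrow> \<tau> ''ac'' 0 = (\<Sum>x<i. \<Sum>y<n. w x y) \<and>
    \<tau> ''nw'' 0 = (if \<exists>x<i. \<exists>y<n. c x y then 1 else 0)" for i :: nat and \<tau> :: store
  define \<sigma>1 where "\<sigma>1 = \<sigma>(''ac'' := (\<sigma> ''ac'')(0 := 0), ''nw'' := (\<sigma> ''nw'')(0 := 0))"
  have b1: "base \<sigma>1" by (rule base_cong[OF assms(1)]) (simp_all add: \<sigma>1_def)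
  have "J n (den (PFor ''x'' nE (PFor ''y'' nE ?body)) \<sigma>1)"
  proof (rule for_rule)
    show "nat (aval nE \<sigma>1) = n" using b1 by (simp add: inp)
    show "J 0 \<tau>" if "\<And>A. A \<noteq> ''x'' \<Longrightarrow> \<tau> A = \<sigma>1 A" for \<tau>
      using that[of "''ac''"] that[of "''nw''"] by (simp add: J_def \<sigma>1_def)
    show "J i (setv ''x'' z \<tau>)" if "J i \<tau>" for i \<tau> z using that by (simp add: J_def)
  next
    fix i \<tau>
    assume i: "i < n" "J i \<tau>" "\<tau> ''x'' 0 = int i"
      and frame: "\<And>A. A \<noteq> ''x'' \<Longrightarrow> A \<notin> writes (PFor ''y'' nE ?body) \<Longrightarrow> \<tau> A = \<sigma>1 A"
    have eq: "\<tau> ''in'' = \<sigma>1 ''in''" "\<tau> ''row'' = \<sigma>1 ''row''" "\<tau> ''tb'' = \<sigma>1 ''tb''"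
        "\<tau> ''re'' = \<sigma>1 ''re''" "\<tau> ''be'' = \<sigma>1 ''be''"
      by (rule frame; simp)+
    have bt: "base \<tau>" by (rule base_cong[OF b1 eq(1-3)])
    define I where "I m \<rho> \<longleftrightarrow> \<rho> ''ac'' 0 = (\<Sum>x<i. \<Sum>y<n. w x y) + (\<Sum>y<m. w i y) \<and>
      \<rho> ''nw'' 0 = (if (\<exists>x<i. \<exists>y<n. c x y) \<or> (\<exists>y<m. c i y) then 1 else 0)" for m :: nat and \<rho> :: store
    have "I n (den (PFor ''y'' nE ?body) \<tau>)"
    proof (rule for_rule)
      show "nat (aval nE \<tau>) = n" using bt by (simp add: inp)
      show "I 0 \<rho>" if "\<And>A. A \<noteq> ''y'' \<Longrightarrow> \<rho> A = \<tau> A" for \<rho>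
        using that[of "''ac''"] that[of "''nw''"] i(2) by (simp add: I_def J_def)
      show "I m (setv ''y'' z \<rho>)" if "I m \<rho>" for m \<rho> z using that by (simp add: I_def)
    next
      fix m \<rho>
      assume m: "m < n" "I m \<rho>" "\<rho> ''y'' 0 = int m"
        and frame: "\<And>A. A \<noteq> ''y'' \<Longrightarrow> A \<notin> writes ?body \<Longrightarrow> \<rho> A = \<tau> A"
      have eq': "\<rho> ''in'' = \<tau> ''in''" "\<rho> ''row'' = \<tau> ''row''" "\<rho> ''tb'' = \<tau> ''tb''"
          "\<rho> ''re'' = \<tau> ''re''" "\<rho> ''be'' = \<tau> ''be''" "\<rho> ''x'' = \<tau> ''x''"
        by (rule frame; simp)+
      have br: "base \<rho>" by (rule base_cong[OF bt eq'(1-3)])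
      have re: "\<rho> ''re'' (int z) = (if z \<in> U then 1 else 0)" if "z < n" for z
        using assms(2) that by (simp add: eq eq' \<sigma>1_def reached_def)
      have be: "\<rho> ''be'' (int z) = int (f z)" if "z < n" for z
        using assms(3) that by (simp add: eq eq' \<sigma>1_def)
      have x: "\<rho> ''x'' 0 = int i" using i(3) by (simp add: eq')
      show "I (Suc m) (den ?body \<rho>)"
      proof (cases "i \<in> U \<and> m \<notin> U")
        case True
        \<comment> \<open>\<open>inp_a\<close> identifies the input with edge weights off the
          diagonal only.\<close>
        then have "i \<noteq> m" by auto
        have "den ?body \<rho> ''ac'' 0 = \<rho> ''ac'' 0 + a {i, m}"
          using True re[OF i(1)] re[OF m(1)] x m(3) br i(1) inp_a[OF i(1) m(1) \<open>i \<noteq> m\<close>]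
          by simp
        moreover have "den ?body \<rho> ''nw'' 0 = (if f m \<le> f i then 1 else \<rho> ''nw'' 0)"
          using True re[OF i(1)] re[OF m(1)] be[OF i(1)] be[OF m(1)] x m(3) by simp
        ultimately show ?thesis
          using m(2) True by (auto simp: I_def w_def c_def less_Suc_eq)
      next
        case False
        then have "den ?body \<rho> = \<rho>"
          using re[OF i(1)] re[OF m(1)] x m(3) by auto
        moreover have "w i m = 0" "\<not> c i m" using False by (auto simp: w_def c_def)
        ultimately show ?thesis
          using m(2) by (auto simp: I_def less_Suc_eq)
      qed
    qed simp
    then show "J (Suc i) (den (PFor ''y'' nE ?body) \<tau>)"
      unfolding I_def J_def by (auto simp: less_Suc_eq)
  qed simp
  moreover have "den measure_cut \<sigma> = den (PFor ''x'' nE (PFor ''y'' nE ?body)) \<sigma>1"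
    by (simp add: measure_cut_def \<sigma>1_def)
  moreover have "U \<subseteq> {..<n}" using assms(2) by (simp add: reached_def)
  ultimately show "den measure_cut \<sigma> ''ac'' 0 = sum a (cut {..<n} U)"
    "den measure_cut \<sigma> ''nw'' 0 = (if \<exists>x \<in> U. \<exists>y \<in> {..<n} - U. f y \<le> f x then 1 else 0)"
    unfolding J_def w_def c_def sum_cut_pairs[OF \<open>U \<subseteq> {..<n}\<close>] by auto
qed

lemma weigh_spec:
  assumes "base \<sigma>"
  shows "den weigh \<sigma> ''q'' 0 = int r * (2 * D - \<sigma> ''ac'' 0 - b)"
proof -
  let ?\<sigma> = "\<sigma>(''q'' := (\<sigma> ''q'')(0 := 0))"
  let ?p = "PAssign ''q'' (Const 0) (Add (var ''q'') (Sub (Sub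
       (Add (Cell ''in'' (Const 4)) (Cell ''in'' (Const 4))) (var ''ac'')) (Cell ''in'' (Const 5))))"
  have "den (PFor ''l'' rE ?p) ?\<sigma> ''q'' 0 = int r * (2 * D - \<sigma> ''ac'' 0 - b)"
  proof (rule for_rule[where I = "\<lambda>i \<tau>. \<tau> ''q'' 0 = int i * (2 * D - \<sigma> ''ac'' 0 - b)"])
    show "nat (aval rE ?\<sigma>) = r" using assms by (simp add: inp)
  next
    fix i \<tau>
    assume i: "\<tau> ''q'' 0 = int i * (2 * D - \<sigma> ''ac'' 0 - b)"
      and frame: "\<And>A. A \<noteq> ''l'' \<Longrightarrow> A \<notin> writes ?p \<Longrightarrow> \<tau> A = ?\<sigma> A"
    have "\<tau> ''in'' = \<sigma> ''in''" "\<tau> ''ac'' = \<sigma> ''ac''"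
      using frame[of "''in''"] frame[of "''ac''"] by auto
    then show "den ?p \<tau> ''q'' 0 = int (Suc i) * (2 * D - \<sigma> ''ac'' 0 - b)"
      using i assms by (simp add: inp_D inp_b algebra_simps)
  qed auto
  then show ?thesis by (simp add: weigh_def)
qed

definition ranks :: "store \<Rightarrow> nat set set \<Rightarrow> bool" where
  "ranks \<sigma> F \<longleftrightarrow> (\<forall>w < n. \<sigma> ''be'' (int w) = int (card {U \<in> F. w \<notin> U}))"

lemma raise_spec:
  assumes "base \<sigma>" "reached \<sigma> U" "ranks \<sigma> F" "U \<notin> F" "finite F"
  shows "ranks (den raise \<sigma>) (insert U F)"
proof -
  let ?p = "PIf (Less (Const 0) (Cell ''re'' (var ''l''))) PSkip
     (PAssign ''be'' (var ''l'') (Add (Cell ''be'' (var ''l'')) (Const 1)))"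
  have c: "card {W \<in> insert U F. w \<notin> W} = card {W \<in> F. w \<notin> W} + (if w \<in> U then 0 else 1)" for w
  proof -
    have "{W \<in> insert U F. w \<notin> W} = (if w \<in> U then {W \<in> F. w \<notin> W} else insert U {W \<in> F. w \<notin> W})"
      by auto
    then show ?thesis using assms(4,5) by simp
  qed
  have "\<forall>w < n. den raise \<sigma> ''be'' (int w) =
      int (card {W \<in> F. w \<notin> W}) + (if w < n \<and> w \<notin> U then 1 else 0)"
    unfolding raise_def
  proof (rule for_rule[where I = "\<lambda>i \<tau>. \<forall>w < n. \<tau> ''be'' (int w) =
      int (card {W \<in> F. w \<notin> W}) + (if w < i \<and> w \<notin> U then 1 else 0)"])
    show "nat (aval nE \<sigma>) = n" using assms(1) by (simp add: inp)
  next
    fix i \<tau>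
    assume i: "i < n" "\<forall>w < n. \<tau> ''be'' (int w) =
        int (card {W \<in> F. w \<notin> W}) + (if w < i \<and> w \<notin> U then 1 else 0)" "\<tau> ''l'' 0 = int i"
      and frame: "\<And>A. A \<noteq> ''l'' \<Longrightarrow> A \<notin> writes ?p \<Longrightarrow> \<tau> A = \<sigma> A"
    have "\<tau> ''re'' = \<sigma> ''re''" by (rule frame) auto
    then have "\<tau> ''re'' (int i) = (if i \<in> U then 1 else 0)"
      using assms(2) i(1) by (simp add: reached_def)
    then show "\<forall>w < n. den ?p \<tau> ''be'' (int w) =
        int (card {W \<in> F. w \<notin> W}) + (if w < Suc i \<and> w \<notin> U then 1 else 0)"
      using i by (auto simp: less_Suc_eq)
  qed (use assms(3) in \<open>auto simp: ranks_def\<close>)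
  then show ?thesis unfolding ranks_def c by simp
qed

text \<open>Multiplication by the positive denominator \<open>D\<close>. As \<open>j\<close> counts
  from 0 here, the \<open>j - 1\<close> of the relevance condition becomes \<open>j\<close>.\<close>

lemma threshold:
  "U \<subset> {..<n} \<Longrightarrow> s \<in> U \<Longrightarrow>
    U \<in> rel (Suc j) \<longleftrightarrow> int j * D < int r * (2 * D - sum a (cut {..<n} U) - b)"
proof -
  assume U: "U \<subset> {..<n}" "s \<in> U"
  let ?c = "sum a (cut {..<n} U)"
  have D': "real_of_int D > 0" using D by simp
  have c: "sum xs (cut {..<n} U) = real_of_int ?c / real_of_int D"
    by (simp add: xs sum_divide_distrib)
  have "U \<in> rel (Suc j) \<longleftrightarrow> real j < real r * (2 - sum xs (cut {..<n} U) - eps)"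
    using U by (simp add: rel_def)
  also have "\<dots> \<longleftrightarrow>
      real j < real r * (2 - real_of_int ?c / real_of_int D - real_of_int b / real_of_int D)"
    unfolding c unfolding eps_eq ..
  also have "\<dots> \<longleftrightarrow> real j * real_of_int D <
      real r * (2 - real_of_int ?c / real_of_int D - real_of_int b / real_of_int D) * real_of_int D"
    using D' by (simp only: mult_less_cancel_right_pos)
  also have "real r * (2 - real_of_int ?c / real_of_int D - real_of_int b / real_of_int D) * real_of_int D
      = real r * (2 * real_of_int D - real_of_int ?c - real_of_int b)"
    using D' by (simp add: field_simps)
  also have "real j * real_of_int D < real r * (2 * real_of_int D - real_of_int ?c - real_of_int b) \<longleftrightarrow>
      real_of_int (int j * D) < real_of_int (int r * (2 * D - ?c - b))"
    by simp
  also have "\<dots> \<longleftrightarrow> int j * D < int r * (2 * D - ?c - b)"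
    by (simp only: of_int_less_iff)
  finally show ?thesis .
qed

lemma test_cut_spec:
  assumes "base \<sigma>" "reached \<sigma> U" "ranks \<sigma> F" "F \<subseteq> rel (Suc j)" "\<sigma> ''jd'' 0 = int j * D"
    and "U \<subset> {..<n}" "s \<in> U"
  shows "ranks (den test_cut \<sigma>) (F \<union> ({U} \<inter> rel (Suc j)))"
proof -
  let ?f = "\<lambda>w. card {W \<in> F. w \<notin> W}"
  define \<sigma>1 where "\<sigma>1 = den measure_cut \<sigma>"
  define \<sigma>2 where "\<sigma>2 = den weigh \<sigma>1"
  have be: "\<And>w. w < n \<Longrightarrow> \<sigma> ''be'' (int w) = int (?f w)" using assms(3) by (simp add: ranks_def)
  note m = measure_cut_spec[OF assms(1,2) be, folded \<sigma>1_def]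
  have eq: "\<sigma>2 A = \<sigma> A" if "A \<notin> {''ac'', ''nw'', ''x'', ''y'', ''q'', ''l''}" for A
    using that by (simp add: \<sigma>2_def \<sigma>1_def den_frame)
  have b1: "base \<sigma>1" unfolding \<sigma>1_def by (rule base_den[OF assms(1)]) auto
  have b2: "base \<sigma>2" by (rule base_cong[OF assms(1)]; rule eq; simp)
  have q: "\<sigma>2 ''q'' 0 = int r * (2 * D - sum a (cut {..<n} U) - b)"
    using weigh_spec[OF b1] m(1) by (simp add: \<sigma>2_def)
  have nw: "\<sigma>2 ''nw'' 0 = \<sigma>1 ''nw'' 0" by (simp add: \<sigma>2_def den_frame)
  have jd: "\<sigma>2 ''jd'' 0 = int j * D" using assms(5) eq[of "''jd''"] by simp
  have r2: "reached \<sigma>2 U" "ranks \<sigma>2 F"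
    using assms(2,3) eq[of "''re''"] eq[of "''be''"] by (simp_all add: reached_def ranks_def)
  have finF: "finite F" using assms(4) finite_rel finite_subset by blast
  have den: "den test_cut \<sigma> = (if int j * D < int r * (2 * D - sum a (cut {..<n} U) - b) \<and>
      0 < \<sigma>1 ''nw'' 0 then den raise \<sigma>2 else \<sigma>2)"
    using q nw jd by (simp add: test_cut_def \<sigma>1_def[symmetric] \<sigma>2_def[symmetric])
  show ?thesis
  proof (cases "U \<in> rel (Suc j)")
    case True
    have "0 < \<sigma>1 ''nw'' 0 \<longleftrightarrow> U \<notin> F"
      using m(2) new_member_iff[OF assms(4) True] by simp
    then have "den test_cut \<sigma> = (if U \<notin> F then den raise \<sigma>2 else \<sigma>2)"
      using den True threshold[OF assms(6,7), of j] by simp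
    then show ?thesis
      using True r2 raise_spec[OF b2 r2 _ finF] by (simp add: insert_absorb)
  next
    case False
    then have "den test_cut \<sigma> = \<sigma>2"
      using den threshold[OF assms(6,7), of j] by simp
    then show ?thesis using False r2 by simp
  qed
qed

definition found :: "nat \<Rightarrow> nat \<Rightarrow> nat \<Rightarrow> nat \<Rightarrow> nat set set" where
  "found j k u v = (if {u, v} \<in> S0 (Suc k)
     then {{y. joined (S0 (Suc k) - {{u, v}}) s y}} \<inter> rel (Suc j) else {})"

lemma found_all: "(\<Union>k<r. \<Union>u<n. \<Union>v<n. found j k u v) = rel (Suc j)"
proof (intro equalityI subsetI)
  fix U assume U: "U \<in> rel (Suc j)"
  then obtain k u v where k: "k \<in> {1..r}" "{u, v} \<in> S0 k" "u < n" "v < n"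
    "{y. joined (S0 k - {{u, v}}) s y} = U"
    using rel_fundamental[OF U] by auto
  then have "U \<in> found j (k - 1) u v" using U by (simp add: found_def)
  moreover have "k - 1 < r" using k(1) by auto
  ultimately show "U \<in> (\<Union>k<r. \<Union>u<n. \<Union>v<n. found j k u v)" using k(3,4) by blast
qed (auto simp: found_def split: if_splits)

lemma cut_body_spec:
  assumes "base \<sigma>" "ranks \<sigma> F" "F \<subseteq> rel (Suc j)" "\<sigma> ''jd'' 0 = int j * D"
    and "k < r" "u < n" "v < n" "\<sigma> ''k'' 0 = int k" "\<sigma> ''u'' 0 = int u" "\<sigma> ''v'' 0 = int v"
  shows "ranks (den cut_body \<sigma>) (F \<union> found j k u v)"
proof (cases "{u, v} \<in> S0 (Suc k)")
  case False
  then have "den cut_body \<sigma> = \<sigma>"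
    using assms inp_S[OF assms(5-7)] by (simp add: cut_body_def inp)
  then show ?thesis using assms(2) False by (simp add: found_def)
next
  case True
  let ?T = "S0 (Suc k)"
  let ?b = "Add (Add (Const 6) (Cell ''row'' nE)) (Cell ''tb'' (var ''k''))"
  define \<sigma>1 where "\<sigma>1 = den (load ''in'' ?b) \<sigma>"
  define \<sigma>2 where "\<sigma>2 = den (set_edge ''u'' ''v'' 0) \<sigma>1"
  define \<sigma>3 where "\<sigma>3 = den reach \<sigma>2"
  have tr: "?T \<in> spanning_trees {..<n}" using ok_tree[OF ok_S0] assms(5) by auto
  have b: "base \<sigma>1" "base \<sigma>2" "base \<sigma>3"
    using assms(1) by (simp_all add: \<sigma>1_def \<sigma>2_def \<sigma>3_def base_den)
  have h1: "holds \<sigma>1 ?T"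
    unfolding \<sigma>1_def
  proof (rule load_holds[OF assms(1)])
    fix x y assume "x < n" "y < n"
    then show "\<sigma> ''in'' (aval ?b \<sigma> + (int x * int n + int y)) = (if {x, y} \<in> ?T then 1 else 0)"
      using assms(1,5,8) inp_S[OF assms(5), of x y] by (simp add: inp add.assoc)
  qed auto
  have uv: "\<sigma>1 ''u'' 0 = int u" "\<sigma>1 ''v'' 0 = int v"
    using assms(9,10) by (simp_all add: \<sigma>1_def den_frame)
  have h2: "holds \<sigma>2 (?T - {{u, v}})"
    unfolding \<sigma>2_def by (rule set_edge_holds(1)[OF b(1) h1 uv assms(6,7)]) auto
  let ?U = "{y. joined (?T - {{u, v}}) s y}"
  have sub: "?T - {{u, v}} \<subseteq> complete_edges {..<n}" using treeD(1)[OF tr] by auto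
  have r3: "reached \<sigma>3 ?U" unfolding \<sigma>3_def by (rule reach_spec[OF b(2) h2 sub])
  have eq: "\<sigma>3 A = \<sigma> A" if "A \<notin> {''l'', ''g'', ''ri'', ''rx'', ''ry'', ''re''}" for A
    using that by (simp add: \<sigma>1_def \<sigma>2_def \<sigma>3_def den_frame)
  have rk3: "ranks \<sigma>3 F" "\<sigma>3 ''jd'' 0 = int j * D"
    using assms(2,4) eq[of "''be''"] eq[of "''jd''"] by (simp_all add: ranks_def)
  \<comment> \<open>The deleted edge is a bridge, so one of its ends is not reached and the side of
    \<open>s\<close> is a proper subset.\<close>
  have "\<not> (u \<in> ?U \<and> v \<in> ?U)"
  proof
    assume "u \<in> ?U \<and> v \<in> ?U"
    then have "joined (?T - {{u, v}}) u v"
      using joined_trans[OF joined_sym, of "?T - {{u, v}}" s u v] by simp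
    then show False using treeD(4)[OF tr] True by (auto simp: forest_def)
  qed
  moreover have "?U \<subseteq> {..<n}" using r3 unfolding reached_def by (rule conjunct1)
  moreover have "u \<in> {..<n}" "v \<in> {..<n}" using assms(6,7) by auto
  ultimately have U: "?U \<subset> {..<n}" by (metis psubsetI)
  have "den cut_body \<sigma> = den test_cut \<sigma>3"
    using True assms inp_S[OF assms(5-7)]
    by (simp add: cut_body_def inp \<sigma>1_def \<sigma>2_def \<sigma>3_def)
  then show ?thesis
    using test_cut_spec[OF b(3) r3 rk3(1) assms(3) rk3(2) U] True by (simp add: found_def)
qed

text \<open>The loops run over the fundamental cuts of the input trees; by \<open>found_all\<close>
  the relevant ones among them are all relevant sets.\<close>

lemma level_spec:
  assumes "base \<sigma>" "\<sigma> ''jd'' 0 = int j * D"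
  shows "\<And>w. w < n \<Longrightarrow> den level \<sigma> ''be'' (int w) = int (rk (Suc j) w)"
proof -
  let ?z = "PFor ''l'' nE (PAssign ''be'' (var ''l'') (Const 0))"
  define \<sigma>1 where "\<sigma>1 = den ?z \<sigma>"
  have "\<forall>m < n. \<sigma>1 ''be'' (int m) = 0"
    unfolding \<sigma>1_def
    by (rule for_rule[where I = "\<lambda>i \<tau>. \<forall>m < i. \<tau> ''be'' (int m) = 0"])
      (use assms(1) in \<open>auto simp: inp less_Suc_eq\<close>)
  then have rk1: "ranks \<sigma>1 {}" by (simp add: ranks_def)
  have eq: "\<sigma>1 A = \<sigma> A" if "A \<notin> {''l'', ''be''}" for A
    using that unfolding \<sigma>1_def by (intro den_frame) auto
  have "base \<sigma>1" by (rule base_cong[OF assms(1)]; rule eq; simp)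
  moreover have "\<sigma>1 ''jd'' 0 = int j * D" using assms(2) eq[of "''jd''"] by simp
  ultimately have b1: "base \<sigma>1" "\<sigma>1 ''jd'' 0 = int j * D" by simp_all
  define Ik where "Ik i \<tau> \<longleftrightarrow> ranks \<tau> (\<Union>k<i. \<Union>u<n. \<Union>v<n. found j k u v)" for i \<tau>
  have sub: "found j k u v \<subseteq> rel (Suc j)" for k u v by (auto simp: found_def)
  have "Ik r (den (PFor ''k'' rE (PFor ''u'' nE (PFor ''v'' nE cut_body))) \<sigma>1)"
  proof (rule for_rule)
    show "nat (aval rE \<sigma>1) = r" using b1 by (simp add: inp)
    show "Ik 0 \<tau>" if "\<And>A. A \<noteq> ''k'' \<Longrightarrow> \<tau> A = \<sigma>1 A" for \<tau>
      using rk1 that[of "''be''"] by (simp add: Ik_def ranks_def)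
    show "Ik i (setv ''k'' z \<tau>)" if "Ik i \<tau>" for i \<tau> z using that by (simp add: Ik_def ranks_def)
  next
    fix k \<tau>
    assume k: "k < r" "Ik k \<tau>" "\<tau> ''k'' 0 = int k"
      and frame: "\<And>A. A \<noteq> ''k'' \<Longrightarrow> A \<notin> writes (PFor ''u'' nE (PFor ''v'' nE cut_body)) \<Longrightarrow> \<tau> A = \<sigma>1 A"
    have bk: "base \<tau>" by (rule base_cong[OF b1(1)]; rule frame; simp)
    have jk: "\<tau> ''jd'' 0 = int j * D" using b1(2) frame[of "''jd''"] by simp
    define Fk where "Fk = (\<Union>k'<k. \<Union>u<n. \<Union>v<n. found j k' u v)"
    define Iu where "Iu i \<tau> \<longleftrightarrow> ranks \<tau> (Fk \<union> (\<Union>u<i. \<Union>v<n. found j k u v))" for i \<tau>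
    have "Iu n (den (PFor ''u'' nE (PFor ''v'' nE cut_body)) \<tau>)"
    proof (rule for_rule)
      show "nat (aval nE \<tau>) = n" using bk by (simp add: inp)
      show "Iu 0 \<rho>" if "\<And>A. A \<noteq> ''u'' \<Longrightarrow> \<rho> A = \<tau> A" for \<rho>
        using k(2) that[of "''be''"] by (simp add: Ik_def Iu_def Fk_def ranks_def)
      show "Iu i (setv ''u'' z \<rho>)" if "Iu i \<rho>" for i \<rho> z using that by (simp add: Iu_def ranks_def)
    next
      fix u \<rho>
      assume u: "u < n" "Iu u \<rho>" "\<rho> ''u'' 0 = int u"
        and frame: "\<And>A. A \<noteq> ''u'' \<Longrightarrow> A \<notin> writes (PFor ''v'' nE cut_body) \<Longrightarrow> \<rho> A = \<tau> A"
      have bu: "base \<rho>" by (rule base_cong[OF bk]; rule frame; simp)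
      have ju: "\<rho> ''jd'' 0 = int j * D" "\<rho> ''k'' 0 = int k"
        using jk k(3) frame[of "''jd''"] frame[of "''k''"] by simp_all
      define Fu where "Fu = Fk \<union> (\<Union>u'<u. \<Union>v<n. found j k u' v)"
      define Iv where "Iv i \<tau> \<longleftrightarrow> ranks \<tau> (Fu \<union> (\<Union>v<i. found j k u v))" for i \<tau>
      have "Iv n (den (PFor ''v'' nE cut_body) \<rho>)"
      proof (rule for_rule)
        show "nat (aval nE \<rho>) = n" using bu by (simp add: inp)
        show "Iv 0 \<omega>" if "\<And>A. A \<noteq> ''v'' \<Longrightarrow> \<omega> A = \<rho> A" for \<omega>
          using u(2) that[of "''be''"] by (simp add: Iu_def Iv_def Fu_def ranks_def)
        show "Iv i (setv ''v'' z \<omega>)" if "Iv i \<omega>" for i \<omega> z using that by (simp add: Iv_def ranks_def)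
      next
        fix v \<omega>
        assume v: "v < n" "Iv v \<omega>" "\<omega> ''v'' 0 = int v"
          and frame: "\<And>A. A \<noteq> ''v'' \<Longrightarrow> A \<notin> writes cut_body \<Longrightarrow> \<omega> A = \<rho> A"
        have bv: "base \<omega>" by (rule base_cong[OF bu]; rule frame; simp)
        have jv: "\<omega> ''jd'' 0 = int j * D" "\<omega> ''k'' 0 = int k" "\<omega> ''u'' 0 = int u"
          using ju u(3) frame[of "''jd''"] frame[of "''k''"] frame[of "''u''"] by simp_all
        have "Fu \<union> (\<Union>v'<v. found j k u v') \<subseteq> rel (Suc j)"
          using sub unfolding Fu_def Fk_def by blast
        from cut_body_spec[OF bv v(2)[unfolded Iv_def] this jv(1) k(1) u(1) v(1) jv(2,3) v(3)]
        show "Iv (Suc v) (den cut_body \<omega>)"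
          by (simp add: Iv_def lessThan_Suc Un_ac)
      qed simp
      then show "Iu (Suc u) (den (PFor ''v'' nE cut_body) \<rho>)"
        by (simp add: Iu_def Iv_def Fu_def lessThan_Suc Un_ac)
    qed simp
    then show "Ik (Suc k) (den (PFor ''u'' nE (PFor ''v'' nE cut_body)) \<tau>)"
      by (simp add: Ik_def Iu_def Fk_def lessThan_Suc Un_ac)
  qed simp
  then have "ranks (den level \<sigma>) (rel (Suc j))"
    by (simp add: Ik_def found_all level_def \<sigma>1_def)
  then show "\<And>w. w < n \<Longrightarrow> den level \<sigma> ''be'' (int w) = int (rk (Suc j) w)"
    by (simp add: ranks_def rk_def)
qed

end

section \<open>Searching for exchanges\<close>

text \<open>All sets restricting exchanges are differences of levels, hence intervals of ranks, and
  membership takes two comparisons.\<close>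

definition in_range :: "aexp \<Rightarrow> string \<Rightarrow> aexp \<Rightarrow> bexp" where
  "in_range lo z hi = Conj (Neg (Less (Cell ''be'' (var z)) lo)) (Less (Cell ''be'' (var z)) hi)"

definition set_out :: "string \<Rightarrow> string \<Rightarrow> string \<Rightarrow> int \<Rightarrow> prog" where
  "set_out k x y c = PSeq
     (PAssign ''out'' (Add (Cell ''tb'' (var k)) (Add (Cell ''row'' (var x)) (var y))) (Const c))
     (PAssign ''out'' (Add (Cell ''tb'' (var k)) (Add (Cell ''row'' (var y)) (var x))) (Const c))"

definition swap :: prog where
  "swap = PSeq (PSeq (set_out ''j'' ''u'' ''v'' 0) (set_out ''j'' ''x'' ''y'' 1))
     (PSeq (set_out ''k'' ''x'' ''y'' 0) (set_out ''k'' ''u'' ''v'' 1))"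

definition test_swap :: "string \<Rightarrow> string \<Rightarrow> string \<Rightarrow> string \<Rightarrow> string \<Rightarrow> prog" where
  "test_swap k u v x y = PSeq (load ''out'' (Cell ''tb'' (var k)))
     (PSeq (set_edge u v 0) (PSeq (set_edge x y 1) (PSeq reach check)))"

definition attempt :: prog where
  "attempt = PSeq (PAssign ''ok'' (Const 0) (Const 1))
     (PSeq (test_swap ''j'' ''u'' ''v'' ''x'' ''y'') (PSeq (test_swap ''k'' ''x'' ''y'' ''u'' ''v'')
       (PIf (Less (Const 0) (var ''ok'')) (PSeq swap (PAssign ''fo'' (Const 0) (Const 1))) PSkip)))"

text \<open>The four phases share \<open>Z\<close>, the complement of the next level, so only
  \<open>X\<close> and \<open>Y\<close> are parameters. The bound \<open>n + 1\<close> exceeds every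
  rank. The flag \<open>''fo''\<close> admits one exchange per search.\<close>

definition candidate :: "aexp \<Rightarrow> aexp \<Rightarrow> aexp \<Rightarrow> aexp \<Rightarrow> bexp" where
  "candidate xl xh yl yh = Conj (Less (var ''fo'') (Const 1))
     (Conj (Less (Const 0) (Cell ''out'' (Add (Cell ''tb'' (var ''j'')) (Add (Cell ''row'' (var ''u'')) (var ''v'')))))
     (Conj (Less (Const 0) (Cell ''out'' (Add (Cell ''tb'' (var ''k'')) (Add (Cell ''row'' (var ''x'')) (var ''y'')))))
     (Conj (in_range xl ''x'' xh) (Conj (in_range xl ''y'' xh)
     (Conj (in_range yl ''u'' yh) (in_range (Add (var ''p'') (Const 1)) ''v'' (Add nE (Const 1))))))))"

definition try_all :: "aexp \<Rightarrow> aexp \<Rightarrow> aexp \<Rightarrow> aexp \<Rightarrow> prog" where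
  "try_all xl xh yl yh = PIf (candidate xl xh yl yh) attempt PSkip"

text \<open>Loops cannot be left early; after the first exchange the flag makes all remaining rounds
  idle. The next search starts afresh, since an exchange changes which others are possible.\<close>

definition search :: "aexp \<Rightarrow> aexp \<Rightarrow> aexp \<Rightarrow> aexp \<Rightarrow> prog" where
  "search xl xh yl yh = PSeq (PAssign ''fo'' (Const 0) (Const 0))
     (PFor ''k'' rE (PIf (Less (var ''j'') (var ''k''))
       (PFor ''u'' nE (PFor ''v'' nE (PFor ''x'' nE (PFor ''y'' nE (try_all xl xh yl yh))))) PSkip))"

text \<open>Each exchange of a phase adds an edge inside the set \<open>X\<close> to tree \<open>j\<close>, so that fewer than \<open>n\<close>
  exchanges are possible in a phase.\<close>

definition run_phase :: "aexp \<Rightarrow> aexp \<Rightarrow> aexp \<Rightarrow> aexp \<Rightarrow> prog" where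
  "run_phase xl xh yl yh = PFor ''it'' nE (search xl xh yl yh)"

abbreviation "pE \<equiv> var ''p''"
abbreviation "topE \<equiv> Add nE (Const 1)"

text \<open>For \<open>p = 0\<close> the lower bound \<open>p - 1\<close> is the integer -1. Ranks
  are never negative, so it selects the same vertices as the truncated \<open>p - 1 = 0\<close> in
  \<open>stage\<close>.\<close>

definition run_stage :: prog where
  "run_stage = PSeq
     (PSeq (run_phase pE (Add pE (Const 1)) pE topE)
           (run_phase (Sub pE (Const 1)) (Add pE (Const 1)) (Sub pE (Const 1)) topE))
     (PSeq (run_phase pE topE (Const 0) pE)
           (run_phase (Add pE (Const 1)) topE (Const 0) (Add pE (Const 1))))"

definition main_loop :: prog where
  "main_loop = PFor ''j'' rE (PSeq level (PSeq (PFor ''p'' nE run_stage)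
     (PAssign ''jd'' (Const 0) (Add (var ''jd'') (Cell ''in'' (Const 4))))))"

abbreviation "attempt_names \<equiv> {''ok'', ''l'', ''g'', ''ri'', ''rx'', ''ry'', ''re'', ''out'', ''fo''}"

lemma writes_search [simp]:
  "writes (set_out k x y c) = {''out''}"
  "writes swap = {''out''}"
  "writes (test_swap k u v x y) = {''l'', ''g'', ''ri'', ''rx'', ''ry'', ''re'', ''ok''}"
  "writes attempt = attempt_names"
  "writes (try_all xl xh yl yh) = attempt_names"
  "writes (search xl xh yl yh) = attempt_names \<union> {''k'', ''u'', ''v'', ''x'', ''y''}"
  "writes (run_phase xl xh yl yh) = attempt_names \<union> {''k'', ''u'', ''v'', ''x'', ''y'', ''it''}"
  "writes run_stage = attempt_names \<union> {''k'', ''u'', ''v'', ''x'', ''y'', ''it''}"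
  by (auto simp: set_out_def swap_def test_swap_def attempt_def try_all_def search_def
      run_phase_def run_stage_def)

section \<open>Correctness of the exchange search\<close>

context machine_instance
begin

lemma triple_index_eq_iff:
  assumes "u < n" "v < n" "u' < n" "v' < n"
  shows "int k * int n * int n + (int u * int n + int v) =
      int k' * int n * int n + (int u' * int n + int v') \<longleftrightarrow> k = k' \<and> u = u' \<and> v = v'"
proof -
  have "int k * int n * int n + (int u * int n + int v) =
      int k' * int n * int n + (int u' * int n + int v') \<longleftrightarrow>
      int (k * n + u) * int n + int v = int (k' * n + u') * int n + int v'"
    by (simp add: algebra_simps)
  also have "\<dots> \<longleftrightarrow> k * n + u = k' * n + u' \<and> v = v'"
    by (rule int_pair_index_eq_iff[OF assms(2,4)])
  finally show ?thesis using pair_index_eq_iff[OF assms(1,3)] by simp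
qed

definition represents :: "store \<Rightarrow> (nat \<Rightarrow> nat set set) \<Rightarrow> bool" where
  "represents \<sigma> S \<longleftrightarrow> (\<forall>k < r. \<forall>u < n. \<forall>v < n.
     \<sigma> ''out'' (int k * int n * int n + (int u * int n + int v)) = (if {u, v} \<in> S (Suc k) then 1 else 0))"

lemma set_out_represents:
  assumes "base \<sigma>" "represents \<sigma> S" "\<sigma> z 0 = int k" "\<sigma> x 0 = int u" "\<sigma> y 0 = int v"
    and "k < r" "u < n" "v < n" "z \<noteq> ''out''" "x \<noteq> ''out''" "y \<noteq> ''out''" "c = 0 \<or> c = 1"
  shows "represents (den (set_out z x y c) \<sigma>)
    (S(Suc k := (if c = 1 then insert {u, v} (S (Suc k)) else S (Suc k) - {{u, v}})))"
  unfolding represents_def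
proof (intro allI impI)
  fix k' u' v' assume lt: "k' < r" "u' < n" "v' < n"
  have "den (set_out z x y c) \<sigma> ''out'' = (\<sigma> ''out'')
      (int k * int n * int n + (int u * int n + int v) := c,
       int k * int n * int n + (int v * int n + int u) := c)"
    using assms by (simp add: set_out_def)
  then have "den (set_out z x y c) \<sigma> ''out'' (int k' * int n * int n + (int u' * int n + int v')) =
      (if k' = k \<and> {u', v'} = {u, v} then c
       else \<sigma> ''out'' (int k' * int n * int n + (int u' * int n + int v')))"
    using triple_index_eq_iff[OF lt(2,3) assms(7,8), of k' k]
      triple_index_eq_iff[OF lt(2,3) assms(8,7), of k' k]
    by (simp only: fun_upd_apply doubleton_eq_iff split: if_split) blast
  moreover have "\<sigma> ''out'' (int k' * int n * int n + (int u' * int n + int v')) =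
      (if {u', v'} \<in> S (Suc k') then 1 else 0)"
    using assms(2) lt by (simp add: represents_def)
  ultimately show "den (set_out z x y c) \<sigma> ''out'' (int k' * int n * int n + (int u' * int n + int v')) =
      (if {u', v'} \<in> (S(Suc k := (if c = 1 then insert {u, v} (S (Suc k)) else S (Suc k) - {{u, v}}))) (Suc k')
       then 1 else 0)"
    using assms(12) by auto
qed

lemma represents_cong: "represents \<sigma> S \<Longrightarrow> \<tau> ''out'' = \<sigma> ''out'' \<Longrightarrow> represents \<tau> S"
  by (simp add: represents_def)

lemma swap_spec:
  assumes "base \<sigma>" "represents \<sigma> S" "\<sigma> ''j'' 0 = int j" "\<sigma> ''k'' 0 = int k"
    and "\<sigma> ''u'' 0 = int u" "\<sigma> ''v'' 0 = int v" "\<sigma> ''x'' 0 = int x" "\<sigma> ''y'' 0 = int y"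
    and "j < r" "k < r" "j \<noteq> k" "u < n" "v < n" "x < n" "y < n"
  shows "represents (den swap \<sigma>) (S(Suc j := insert {x, y} (S (Suc j) - {{u, v}}),
     Suc k := insert {u, v} (S (Suc k) - {{x, y}})))"
proof -
  define \<sigma>1 where "\<sigma>1 = den (set_out ''j'' ''u'' ''v'' 0) \<sigma>"
  define \<sigma>2 where "\<sigma>2 = den (set_out ''j'' ''x'' ''y'' 1) \<sigma>1"
  define \<sigma>3 where "\<sigma>3 = den (set_out ''k'' ''x'' ''y'' 0) \<sigma>2"
  have eq: "\<sigma>1 A = \<sigma> A" "\<sigma>2 A = \<sigma> A" "\<sigma>3 A = \<sigma> A" if "A \<noteq> ''out''" for A
    using that by (simp_all add: \<sigma>1_def \<sigma>2_def \<sigma>3_def den_frame)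
  have b: "base \<sigma>1" "base \<sigma>2" "base \<sigma>3"
    by (rule base_cong[OF assms(1)]; rule eq; simp)+
  note r1 = set_out_represents[where c = 0, OF assms(1,2,3,5,6,9,12,13), simplified, folded \<sigma>1_def]
  have "represents \<sigma>2 ((S(Suc j := S (Suc j) - {{u, v}}))
      (Suc j := insert {x, y} ((S(Suc j := S (Suc j) - {{u, v}})) (Suc j))))"
    using set_out_represents[where c = 1 and z = "''j''" and x = "''x''" and y = "''y''", OF b(1) r1 _ _ _ assms(9,14,15)]
      assms(3,7,8) by (simp add: eq \<sigma>2_def)
  then have r2: "represents \<sigma>2 (S(Suc j := insert {x, y} (S (Suc j) - {{u, v}})))" by simp
  let ?S2 = "S(Suc j := insert {x, y} (S (Suc j) - {{u, v}}))"
  have r3: "represents \<sigma>3 (?S2(Suc k := ?S2 (Suc k) - {{x, y}}))"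
    using set_out_represents[where c = 0 and z = "''k''" and x = "''x''" and y = "''y''", OF b(2) r2 _ _ _ assms(10,14,15)]
      assms(4,7,8) by (simp add: eq \<sigma>3_def)
  let ?S3 = "?S2(Suc k := ?S2 (Suc k) - {{x, y}})"
  have "represents (den (set_out ''k'' ''u'' ''v'' 1) \<sigma>3) (?S3(Suc k := insert {u, v} (?S3 (Suc k))))"
    using set_out_represents[where c = 1 and z = "''k''" and x = "''u''" and y = "''v''", OF b(3) r3 _ _ _ assms(10,12,13)]
      assms(4-6) by (simp add: eq)
  moreover have "den swap \<sigma> = den (set_out ''k'' ''u'' ''v'' 1) \<sigma>3"
    by (simp add: swap_def \<sigma>1_def \<sigma>2_def \<sigma>3_def)
  moreover have "?S3(Suc k := insert {u, v} (?S3 (Suc k))) =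
      S(Suc j := insert {x, y} (S (Suc j) - {{u, v}}), Suc k := insert {u, v} (S (Suc k) - {{x, y}}))"
    using assms(11) by simp
  ultimately show ?thesis by simp
qed

text \<open>The new edge set is no larger than the tree, and a connected graph cannot have fewer
  edges; hence a reachability test decides.\<close>

lemma swapped_tree_iff:
  assumes "T \<in> spanning_trees {..<n}" "{u, v} \<in> T" "{x, y} \<in> complete_edges {..<n}"
  shows "insert {x, y} (T - {{u, v}}) \<in> spanning_trees {..<n} \<longleftrightarrow>
    connected_on {..<n} (insert {x, y} (T - {{u, v}}))"
proof
  assume c: "connected_on {..<n} (insert {x, y} (T - {{u, v}}))"
  let ?T = "insert {x, y} (T - {{u, v}})"
  note dT = treeD[OF assms(1)]
  have sub: "?T \<subseteq> complete_edges {..<n}" using dT(1) assms(3) by auto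
  have "card ?T \<le> Suc (card (T - {{u, v}}))" using dT(5) by (simp add: card_insert_le_m1)
  then have "card ?T + 1 \<le> card {..<n}"
    using dT(3) card_Suc_Diff1[OF dT(5) assms(2)] by linarith
  then have "card ?T + 1 = card {..<n}"
    using connected_card_ge[OF fin sub c] by simp
  then show "?T \<in> spanning_trees {..<n}" using c sub spanning_tree_iff[OF fin V] by simp
qed (simp add: spanning_trees_def)

lemma test_swap_spec:
  assumes "base \<sigma>" "represents \<sigma> S" "ok S" "k < r" "\<sigma> z 0 = int k"
    and "\<sigma> a1 0 = int u" "\<sigma> a2 0 = int v" "\<sigma> b1 0 = int x" "\<sigma> b2 0 = int y"
    and "u < n" "v < n" "x < n" "y < n" "x \<noteq> y" "{u, v} \<in> S (Suc k)"
    and names: "{z, a1, a2, b1, b2} \<inter> {''l'', ''g'', ''ri'', ''rx'', ''ry'', ''re'', ''ok''} = {}"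
    and P: "\<sigma> ''ok'' 0 = (if P then 1 else 0)"
  shows "den (test_swap z a1 a2 b1 b2) \<sigma> ''ok'' 0 =
    (if P \<and> insert {x, y} (S (Suc k) - {{u, v}}) \<in> spanning_trees {..<n} then 1 else 0)"
proof -
  let ?T = "S (Suc k)"
  let ?T' = "insert {x, y} (?T - {{u, v}})"
  define \<sigma>1 where "\<sigma>1 = den (load ''out'' (Cell ''tb'' (var z))) \<sigma>"
  define \<sigma>2 where "\<sigma>2 = den (set_edge a1 a2 0) \<sigma>1"
  define \<sigma>3 where "\<sigma>3 = den (set_edge b1 b2 1) \<sigma>2"
  define \<sigma>4 where "\<sigma>4 = den reach \<sigma>3"
  have b: "base \<sigma>1" "base \<sigma>2" "base \<sigma>3" "base \<sigma>4"
    using assms(1) by (simp_all add: \<sigma>1_def \<sigma>2_def \<sigma>3_def \<sigma>4_def base_den)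
  have h1: "holds \<sigma>1 ?T"
    unfolding \<sigma>1_def
    by (rule load_holds[OF assms(1)])
      (use assms(1,2,4,5) names in \<open>auto simp: represents_def\<close>)
  have eq: "\<sigma>1 A = \<sigma> A" "\<sigma>2 A = \<sigma> A" if "A \<notin> {''l'', ''g''}" for A
    using that by (simp_all add: \<sigma>1_def \<sigma>2_def den_frame)
  have nm: "a1 \<notin> {''l'', ''g''}" "a2 \<notin> {''l'', ''g''}" "b1 \<notin> {''l'', ''g''}" "b2 \<notin> {''l'', ''g''}"
    using names by blast+
  have val: "\<sigma>1 a1 0 = int u" "\<sigma>1 a2 0 = int v" "\<sigma>2 b1 0 = int x" "\<sigma>2 b2 0 = int y"
    using eq(1)[OF nm(1)] eq(1)[OF nm(2)] eq(2)[OF nm(3)] eq(2)[OF nm(4)] assms(6-9) by simp_all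
  have h2: "holds \<sigma>2 (?T - {{u, v}})"
    unfolding \<sigma>2_def
    by (rule set_edge_holds(1)[OF b(1) h1 val(1,2) assms(10,11)]) (use nm in blast)+
  have h3: "holds \<sigma>3 ?T'"
    unfolding \<sigma>3_def
    by (rule set_edge_holds(2)[OF b(2) h2 val(3,4) assms(12,13)]) (use nm in blast)+
  have tr: "?T \<in> spanning_trees {..<n}" using ok_tree[OF assms(3)] assms(4) by auto
  have xy: "{x, y} \<in> complete_edges {..<n}" using assms(12-14) by (simp add: complete_edges_iff)
  have sub: "?T' \<subseteq> complete_edges {..<n}" using treeD(1)[OF tr] xy by auto
  have r4: "reached \<sigma>4 {w. joined ?T' s w}" unfolding \<sigma>4_def by (rule reach_spec[OF b(3) h3 sub])
  have "\<sigma>4 ''ok'' = \<sigma> ''ok''"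
    by (simp add: \<sigma>1_def \<sigma>2_def \<sigma>3_def \<sigma>4_def den_frame)
  then have "\<sigma>4 ''ok'' 0 = (if P then 1 else 0)" using P by simp
  from check_spec[OF b(4) r4 this]
  show ?thesis
    unfolding swapped_tree_iff[OF tr assms(15) xy]
    by (simp add: test_swap_def \<sigma>1_def \<sigma>2_def \<sigma>3_def \<sigma>4_def)
qed

definition env :: "nat \<Rightarrow> nat \<Rightarrow> store \<Rightarrow> bool" where
  "env j p \<sigma> \<longleftrightarrow> base \<sigma> \<and> \<sigma> ''j'' 0 = int j \<and> \<sigma> ''p'' 0 = int p \<and>
     (\<forall>w < n. \<sigma> ''be'' (int w) = int (rk (Suc j) w))"

lemma env_cong:
  assumes "env j p \<sigma>" "\<And>A. A \<in> {''in'', ''row'', ''tb'', ''j'', ''p'', ''be''} \<Longrightarrow> \<tau> A = \<sigma> A"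
  shows "env j p \<tau>"
proof -
  have "base \<tau>" by (rule base_cong[of \<sigma>]) (use assms in \<open>auto simp: env_def\<close>)
  then show ?thesis using assms by (simp add: env_def)
qed

lemma env_den: "env j p \<sigma> \<Longrightarrow> writes q \<inter> {''in'', ''row'', ''tb'', ''j'', ''p'', ''be''} = {} \<Longrightarrow> env j p (den q \<sigma>)"
  by (erule env_cong) (auto intro: den_frame)

lemma env_setv: "env j p \<sigma> \<Longrightarrow> x \<notin> {''in'', ''row'', ''tb'', ''j'', ''p'', ''be''} \<Longrightarrow> env j p (setv x z \<sigma>)"
  by (erule env_cong) auto

lemma attempt_spec:
  assumes "env j p \<sigma>" "represents \<sigma> S" "ok S" "j < k" "k < r" "\<sigma> ''fo'' 0 = 0"
    and "\<sigma> ''k'' 0 = int k" "\<sigma> ''u'' 0 = int u" "\<sigma> ''v'' 0 = int v" "\<sigma> ''x'' 0 = int x" "\<sigma> ''y'' 0 = int y"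
    and "u < n" "v < n" "x < n" "y < n" "{u, v} \<in> S (Suc j)" "{x, y} \<in> S (Suc k)"
  defines "T \<equiv> insert {x, y} (S (Suc j) - {{u, v}})" and "T' \<equiv> insert {u, v} (S (Suc k) - {{x, y}})"
  shows "if T \<in> spanning_trees {..<n} \<and> T' \<in> spanning_trees {..<n}
    then represents (den attempt \<sigma>) (S(Suc j := T, Suc k := T')) \<and> den attempt \<sigma> ''fo'' 0 = 1
    else represents (den attempt \<sigma>) S \<and> den attempt \<sigma> ''fo'' 0 = 0"
proof -
  define \<sigma>0 where "\<sigma>0 = den (PAssign ''ok'' (Const 0) (Const 1)) \<sigma>"
  define \<sigma>1 where "\<sigma>1 = den (test_swap ''j'' ''u'' ''v'' ''x'' ''y'') \<sigma>0"
  define \<sigma>2 where "\<sigma>2 = den (test_swap ''k'' ''x'' ''y'' ''u'' ''v'') \<sigma>1"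
  have eq: "\<sigma>0 A = \<sigma> A" "\<sigma>1 A = \<sigma> A" "\<sigma>2 A = \<sigma> A"
    if "A \<notin> {''l'', ''g'', ''ri'', ''rx'', ''ry'', ''re'', ''ok''}" for A
    using that by (simp_all add: \<sigma>0_def \<sigma>1_def \<sigma>2_def den_frame)
  have base: "base \<sigma>" using assms(1) by (simp add: env_def)
  have b: "base \<sigma>0" "base \<sigma>1" "base \<sigma>2"
    by (rule base_cong[OF base]; rule eq; simp)+
  have rep: "represents \<sigma>0 S" "represents \<sigma>1 S" "represents \<sigma>2 S"
    by (rule represents_cong[OF assms(2)]; rule eq; simp)+
  have j: "\<sigma> ''j'' 0 = int j" "j < r" using assms(1,4,5) by (simp_all add: env_def)
  have "S (Suc j) \<subseteq> complete_edges {..<n}" "S (Suc k) \<subseteq> complete_edges {..<n}"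
    using treeD(1)[OF ok_tree[OF assms(3)], of "Suc j"] treeD(1)[OF ok_tree[OF assms(3)], of "Suc k"]
      assms(5) j(2) by simp_all
  then have "{u, v} \<in> complete_edges {..<n}" "{x, y} \<in> complete_edges {..<n}"
    using assms(16,17) by blast+
  then have ne: "u \<noteq> v" "x \<noteq> y" by (simp_all add: complete_edges_iff)
  have 0: "\<sigma>0 ''ok'' 0 = (if True then 1 else 0)" by (simp add: \<sigma>0_def)
  have 1: "\<sigma>1 ''ok'' 0 = (if True \<and> T \<in> spanning_trees {..<n} then 1 else 0)"
    unfolding \<sigma>1_def T_def
    by (rule test_swap_spec[OF b(1) rep(1) assms(3) j(2) _ _ _ _ _ assms(12-15) ne(2) assms(16) _ 0])
      (use assms j in \<open>simp_all add: eq\<close>)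
  have 2: "\<sigma>2 ''ok'' 0 = (if (True \<and> T \<in> spanning_trees {..<n}) \<and> T' \<in> spanning_trees {..<n} then 1 else 0)"
    unfolding \<sigma>2_def T'_def
    by (rule test_swap_spec[OF b(2) rep(2) assms(3,5) _ _ _ _ _ assms(14,15,12,13) ne(1) assms(17) _ 1])
      (use assms in \<open>simp_all add: eq\<close>)
  have sw: "represents (den swap \<sigma>2) (S(Suc j := T, Suc k := T'))"
    unfolding T_def T'_def
    by (rule swap_spec[OF b(3) rep(3)]) (use assms j in \<open>simp_all add: eq\<close>)
  have "den attempt \<sigma> = (if 0 < \<sigma>2 ''ok'' 0 then
      den (PAssign ''fo'' (Const 0) (Const 1)) (den swap \<sigma>2) else \<sigma>2)"
    by (simp add: attempt_def \<sigma>0_def \<sigma>1_def \<sigma>2_def)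
  then show ?thesis
    using 2 rep(3) assms(6) eq(3)[of "''fo''"] represents_cong[OF sw] by auto
qed

lemma attempt_names_env:
  "attempt_names \<inter> {''in'', ''row'', ''tb'', ''j'', ''p'', ''be''} = {}"
  by simp

definition rank_range :: "nat \<Rightarrow> int \<Rightarrow> int \<Rightarrow> nat set" where
  "rank_range j lo hi = {w. w < n \<and> lo \<le> int (rk (Suc j) w) \<and> int (rk (Suc j) w) < hi}"

context
  fixes j p :: nat and S :: "nat \<Rightarrow> nat set set" and xl xh yl yh :: aexp and Xl Xh Yl Yh :: int
  assumes okS: "ok S" and j: "j < r"
    and vals: "\<And>\<tau>. env j p \<tau> \<Longrightarrow> aval xl \<tau> = Xl" "\<And>\<tau>. env j p \<tau> \<Longrightarrow> aval xh \<tau> = Xh"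
      "\<And>\<tau>. env j p \<tau> \<Longrightarrow> aval yl \<tau> = Yl" "\<And>\<tau>. env j p \<tau> \<Longrightarrow> aval yh \<tau> = Yh"
begin

abbreviation step :: "(nat \<Rightarrow> nat set set) \<Rightarrow> (nat \<Rightarrow> nat set set) \<Rightarrow> bool" where
  "step \<equiv> xstep {..<n} r (Suc j) (rank_range j Xl Xh) (rank_range j Yl Yh) (rank_range j (int p + 1) (int n + 1))"

definition valid :: "nat \<Rightarrow> nat \<Rightarrow> nat \<Rightarrow> nat \<Rightarrow> nat \<Rightarrow> bool" where
  "valid k u v x y \<longleftrightarrow> {u, v} \<in> S (Suc j) \<and> {x, y} \<in> S (Suc k) \<and>
     x \<in> rank_range j Xl Xh \<and> y \<in> rank_range j Xl Xh \<and> u \<in> rank_range j Yl Yh \<and> v \<in> rank_range j (int p + 1) (int n + 1) \<and>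
     insert {x, y} (S (Suc j) - {{u, v}}) \<in> spanning_trees {..<n} \<and>
     insert {u, v} (S (Suc k) - {{x, y}}) \<in> spanning_trees {..<n}"

text \<open>A search from \<open>S\<close> has either made its one exchange (\<open>hit\<close>) or
  changed nothing so far (\<open>pending\<close>). These are the persistent and the open state in
  \<open>for_search\<close>.\<close>

definition hit :: "store \<Rightarrow> bool" where
  "hit \<tau> \<longleftrightarrow> \<tau> ''fo'' 0 = 1 \<and> env j p \<tau> \<and> (\<exists>S'. step S S' \<and> represents \<tau> S')"

definition pending :: "store \<Rightarrow> bool" where
  "pending \<tau> \<longleftrightarrow> \<tau> ''fo'' 0 = 0 \<and> env j p \<tau> \<and> represents \<tau> S"

lemma hit_setv: "hit \<tau> \<Longrightarrow> x \<in> {''k'', ''u'', ''v'', ''x'', ''y''} \<Longrightarrow> hit (setv x z \<tau>)"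
  unfolding hit_def using env_setv[of j p \<tau> x z] represents_cong[of \<tau> _ "setv x z \<tau>"] by auto

lemma pending_setv: "pending \<tau> \<Longrightarrow> x \<in> {''k'', ''u'', ''v'', ''x'', ''y''} \<Longrightarrow> pending (setv x z \<tau>)"
  unfolding pending_def using env_setv[of j p \<tau> x z] represents_cong[of \<tau> _ "setv x z \<tau>"] by auto

lemma try_hit: "hit \<tau> \<Longrightarrow> hit (den (try_all xl xh yl yh) \<tau>)"
proof -
  assume h: "hit \<tau>"
  then have "\<not> bval (candidate xl xh yl yh) \<tau>" by (simp add: hit_def candidate_def)
  then show ?thesis using h by (simp add: try_all_def)
qed

lemma try_spec:
  assumes "pending \<tau>" "j < k" "k < r" "u < n" "v < n" "x < n" "y < n"
    and "\<tau> ''k'' 0 = int k" "\<tau> ''u'' 0 = int u" "\<tau> ''v'' 0 = int v" "\<tau> ''x'' 0 = int x" "\<tau> ''y'' 0 = int y"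
  shows "hit (den (try_all xl xh yl yh) \<tau>) \<or> pending (den (try_all xl xh yl yh) \<tau>) \<and> \<not> valid k u v x y"
proof -
  have e: "env j p \<tau>" "represents \<tau> S" "\<tau> ''fo'' 0 = 0" using assms(1) by (simp_all add: pending_def)
  then have b: "base \<tau>" "\<tau> ''j'' 0 = int j" "\<tau> ''p'' 0 = int p" by (simp_all add: env_def)
  have be: "\<tau> ''be'' (int w) = int (rk (Suc j) w)" if "w < n" for w
    using e(1) that by (simp add: env_def)
  have out: "0 < \<tau> ''out'' (int k' * int n * int n + (int w * int n + int z)) \<longleftrightarrow> {w, z} \<in> S (Suc k')"
    if "k' < r" "w < n" "z < n" for k' w z
    using e(2) that by (simp add: represents_def)
  have cand: "bval (candidate xl xh yl yh) \<tau> \<longleftrightarrow> {u, v} \<in> S (Suc j) \<and> {x, y} \<in> S (Suc k) \<and>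
     x \<in> rank_range j Xl Xh \<and> y \<in> rank_range j Xl Xh \<and> u \<in> rank_range j Yl Yh \<and> v \<in> rank_range j (int p + 1) (int n + 1)"
    using assms b j out[OF j assms(4,5)] out[OF assms(3,6,7)] be e(3) vals[OF e(1)]
    by (simp add: candidate_def in_range_def rank_range_def inp not_less, auto)
  show ?thesis
  proof (cases "bval (candidate xl xh yl yh) \<tau>")
    case False
    then have "den (try_all xl xh yl yh) \<tau> = \<tau>" by (simp add: try_all_def)
    moreover have "\<not> valid k u v x y" using False cand by (auto simp: valid_def)
    ultimately show ?thesis using assms(1) by simp
  next
    case True
    let ?T = "insert {x, y} (S (Suc j) - {{u, v}})" and ?T' = "insert {u, v} (S (Suc k) - {{x, y}})"
    have d: "den (try_all xl xh yl yh) \<tau> = den attempt \<tau>" using True by (simp add: try_all_def)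
    have c: "{u, v} \<in> S (Suc j)" "{x, y} \<in> S (Suc k)" using True cand by auto
    have env': "env j p (den attempt \<tau>)" by (rule env_den[OF e(1)]) (simp add: attempt_names_env)
    note sp = attempt_spec[OF e(1,2) okS assms(2,3) e(3) assms(8-12) assms(4-7) c]
    show ?thesis
    proof (cases "?T \<in> spanning_trees {..<n} \<and> ?T' \<in> spanning_trees {..<n}")
      case valid: True
      have "step S (S(Suc j := ?T, Suc k := ?T'))"
        unfolding xstep_def using valid True[unfolded cand] assms(2,3)
        by (intro exI[of _ "Suc k"] exI[of _ u] exI[of _ v] exI[of _ x] exI[of _ y]) simp
      then have "hit (den attempt \<tau>)"
        using sp valid env' unfolding hit_def by auto
      then show ?thesis by (simp add: d)
    next
      case False
      then have "pending (den attempt \<tau>)" using sp env' unfolding pending_def by auto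
      moreover have "\<not> valid k u v x y" using False by (auto simp: valid_def)
      ultimately show ?thesis by (simp add: d)
    qed
  qed
qed

abbreviation "loop_y \<equiv> PFor ''y'' nE (try_all xl xh yl yh)"
abbreviation "loop_x \<equiv> PFor ''x'' nE loop_y"
abbreviation "loop_v \<equiv> PFor ''v'' nE loop_x"
abbreviation "loop_u \<equiv> PFor ''u'' nE loop_v"

lemma pending_n: "pending \<tau> \<Longrightarrow> nat (aval nE \<tau>) = n"
  by (simp add: pending_def env_def inp)

lemma loop_y_hit: "hit \<tau> \<Longrightarrow> hit (den loop_y \<tau>)"
  by (rule for_keeps[where P = hit]) (auto intro: try_hit hit_setv)

lemma loop_x_hit: "hit \<tau> \<Longrightarrow> hit (den loop_x \<tau>)"
  by (rule for_keeps[where P = hit]) (auto intro: loop_y_hit hit_setv simp del: den.simps)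

lemma loop_v_hit: "hit \<tau> \<Longrightarrow> hit (den loop_v \<tau>)"
  by (rule for_keeps[where P = hit]) (auto intro: loop_x_hit hit_setv simp del: den.simps)

lemma loop_u_hit: "hit \<tau> \<Longrightarrow> hit (den loop_u \<tau>)"
  by (rule for_keeps[where P = hit]) (auto intro: loop_v_hit hit_setv simp del: den.simps)

lemma loop_y_spec:
  assumes "pending \<sigma>" "j < k" "k < r" "u < n" "v < n" "x < n"
    and "\<sigma> ''k'' 0 = int k" "\<sigma> ''u'' 0 = int u" "\<sigma> ''v'' 0 = int v" "\<sigma> ''x'' 0 = int x"
  shows "hit (den loop_y \<sigma>) \<or> pending (den loop_y \<sigma>) \<and> (\<forall>y < n. \<not> valid k u v x y)"
proof (rule for_search[where Done = hit and Open = pending, OF pending_n[OF assms(1)] _ assms(1)])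
  fix y \<tau>
  assume y: "y < n" "pending \<tau>" "\<tau> ''y'' 0 = int y"
    and frame: "\<And>A. A \<noteq> ''y'' \<Longrightarrow> A \<notin> writes (try_all xl xh yl yh) \<Longrightarrow> \<tau> A = \<sigma> A"
  show "hit (den (try_all xl xh yl yh) \<tau>) \<or> pending (den (try_all xl xh yl yh) \<tau>) \<and> \<not> valid k u v x y"
    by (rule try_spec[OF y(2) assms(2-6) y(1)])
      (use assms(7-10) y(3) frame[of "''k''"] frame[of "''u''"] frame[of "''v''"] frame[of "''x''"] in simp_all)
qed (auto intro: hit_setv pending_setv try_hit)

lemma loop_x_spec:
  assumes "pending \<sigma>" "j < k" "k < r" "u < n" "v < n"
    and "\<sigma> ''k'' 0 = int k" "\<sigma> ''u'' 0 = int u" "\<sigma> ''v'' 0 = int v"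
  shows "hit (den loop_x \<sigma>) \<or> pending (den loop_x \<sigma>) \<and> (\<forall>x < n. \<forall>y < n. \<not> valid k u v x y)"
proof (rule for_search[where Done = hit and Open = pending, OF pending_n[OF assms(1)] _ assms(1)])
  fix x \<tau>
  assume x: "x < n" "pending \<tau>" "\<tau> ''x'' 0 = int x"
    and frame: "\<And>A. A \<noteq> ''x'' \<Longrightarrow> A \<notin> writes loop_y \<Longrightarrow> \<tau> A = \<sigma> A"
  show "hit (den loop_y \<tau>) \<or> pending (den loop_y \<tau>) \<and> (\<forall>y < n. \<not> valid k u v x y)"
    by (rule loop_y_spec[OF x(2) assms(2-5) x(1)])
      (use assms(6-8) x(3) frame[of "''k''"] frame[of "''u''"] frame[of "''v''"] in simp_all)
qed (auto intro: hit_setv pending_setv loop_y_hit simp del: den.simps)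

lemma loop_v_spec:
  assumes "pending \<sigma>" "j < k" "k < r" "u < n" "\<sigma> ''k'' 0 = int k" "\<sigma> ''u'' 0 = int u"
  shows "hit (den loop_v \<sigma>) \<or> pending (den loop_v \<sigma>) \<and> (\<forall>v < n. \<forall>x < n. \<forall>y < n. \<not> valid k u v x y)"
proof (rule for_search[where Done = hit and Open = pending, OF pending_n[OF assms(1)] _ assms(1)])
  fix v \<tau>
  assume v: "v < n" "pending \<tau>" "\<tau> ''v'' 0 = int v"
    and frame: "\<And>A. A \<noteq> ''v'' \<Longrightarrow> A \<notin> writes loop_x \<Longrightarrow> \<tau> A = \<sigma> A"
  show "hit (den loop_x \<tau>) \<or> pending (den loop_x \<tau>) \<and> (\<forall>x < n. \<forall>y < n. \<not> valid k u v x y)"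
    by (rule loop_x_spec[OF v(2) assms(2-4) v(1)])
      (use assms(5,6) v(3) frame[of "''k''"] frame[of "''u''"] in simp_all)
qed (auto intro: hit_setv pending_setv loop_x_hit simp del: den.simps)

lemma loop_u_spec:
  assumes "pending \<sigma>" "j < k" "k < r" "\<sigma> ''k'' 0 = int k"
  shows "hit (den loop_u \<sigma>) \<or> pending (den loop_u \<sigma>) \<and>
    (\<forall>u < n. \<forall>v < n. \<forall>x < n. \<forall>y < n. \<not> valid k u v x y)"
proof (rule for_search[where Done = hit and Open = pending, OF pending_n[OF assms(1)] _ assms(1)])
  fix u \<tau>
  assume u: "u < n" "pending \<tau>" "\<tau> ''u'' 0 = int u"
    and frame: "\<And>A. A \<noteq> ''u'' \<Longrightarrow> A \<notin> writes loop_v \<Longrightarrow> \<tau> A = \<sigma> A"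
  show "hit (den loop_v \<tau>) \<or> pending (den loop_v \<tau>) \<and> (\<forall>v < n. \<forall>x < n. \<forall>y < n. \<not> valid k u v x y)"
    by (rule loop_v_spec[OF u(2) assms(2,3) u(1)])
      (use assms(4) u(3) frame[of "''k''"] in simp_all)
qed (auto intro: hit_setv pending_setv loop_v_hit simp del: den.simps)

lemma search_spec:
  assumes "env j p \<sigma>" "represents \<sigma> S"
  shows "env j p (den (search xl xh yl yh) \<sigma>)"
    and "(\<exists>S'. step S S' \<and> represents (den (search xl xh yl yh) \<sigma>) S') \<or>
      represents (den (search xl xh yl yh) \<sigma>) S \<and> (\<nexists>S'. step S S')"
proof -
  let ?p = "PIf (Less (var ''j'') (var ''k'')) loop_u PSkip"
  define \<sigma>1 where "\<sigma>1 = den (PAssign ''fo'' (Const 0) (Const 0)) \<sigma>"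
  have p1: "pending \<sigma>1"
    unfolding pending_def
  proof (intro conjI)
    show "env j p \<sigma>1" by (rule env_cong[OF assms(1)]) (auto simp: \<sigma>1_def)
    show "represents \<sigma>1 S" by (rule represents_cong[OF assms(2)]) (simp add: \<sigma>1_def)
  qed (simp add: \<sigma>1_def)
  define Q where "Q k \<longleftrightarrow> (j < k \<longrightarrow> (\<forall>u < n. \<forall>v < n. \<forall>x < n. \<forall>y < n. \<not> valid k u v x y))" for k
  have r1: "nat (aval rE \<sigma>1) = r" using p1 by (simp add: pending_def env_def inp)
  have "hit (den (PFor ''k'' rE ?p) \<sigma>1) \<or> pending (den (PFor ''k'' rE ?p) \<sigma>1) \<and> (\<forall>k < r. Q k)"
  proof (rule for_search[where Done = hit and Open = pending, OF r1 _ p1])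
    fix k \<tau>
    assume k: "k < r" "pending \<tau>" "\<tau> ''k'' 0 = int k"
    have "\<tau> ''j'' 0 = int j" using k(2) by (simp add: pending_def env_def)
    then show "hit (den ?p \<tau>) \<or> pending (den ?p \<tau>) \<and> Q k"
      using loop_u_spec[OF k(2) _ k(1,3)] k by (cases "j < k") (simp_all add: Q_def del: den.simps(5))
  qed (auto intro: hit_setv pending_setv loop_u_hit simp del: den.simps(5))
  then have *: "hit (den (search xl xh yl yh) \<sigma>) \<or> pending (den (search xl xh yl yh) \<sigma>) \<and> (\<forall>k < r. Q k)"
    by (simp add: search_def \<sigma>1_def del: den.simps(5))
  then show "env j p (den (search xl xh yl yh) \<sigma>)"
    by (auto simp: hit_def pending_def)
  have "\<nexists>S'. step S S'" if Q: "\<forall>k < r. Q k"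
  proof
    assume "\<exists>S'. step S S'"
    then obtain K u v x y where st: "Suc j < K" "K \<le> r" "{u, v} \<in> S (Suc j)" "{x, y} \<in> S K"
      "x \<in> rank_range j Xl Xh" "y \<in> rank_range j Xl Xh" "u \<in> rank_range j Yl Yh" "v \<in> rank_range j (int p + 1) (int n + 1)"
      "insert {x, y} (S (Suc j) - {{u, v}}) \<in> spanning_trees {..<n}"
      "insert {u, v} (S K - {{x, y}}) \<in> spanning_trees {..<n}"
      unfolding xstep_def by blast
    obtain k where K: "K = Suc k" using st(1) by (cases K) auto
    have "valid k u v x y" using st unfolding K valid_def by simp
    moreover have "u < n" "v < n" "x < n" "y < n" using st(5-8) by (simp_all add: rank_range_def)
    ultimately show False using Q st(1,2) unfolding K Q_def by auto
  qed
  then show "(\<exists>S'. step S S' \<and> represents (den (search xl xh yl yh) \<sigma>) S') \<or>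
      represents (den (search xl xh yl yh) \<sigma>) S \<and> (\<nexists>S'. step S S')"
    using * by (auto simp: hit_def pending_def)
qed

end

lemma run_phase_spec:
  fixes j p :: nat and Xl Xh Yl Yh :: int
  defines "X \<equiv> rank_range j Xl Xh" and "Y \<equiv> rank_range j Yl Yh"
    and "Z \<equiv> rank_range j (int p + 1) (int n + 1)"
  assumes "ok S" "j < r" "env j p \<sigma>" "represents \<sigma> S" "X \<inter> Y = {} \<or> X \<inter> Z = {}"
    and vals: "\<And>\<tau>. env j p \<tau> \<Longrightarrow> aval xl \<tau> = Xl" "\<And>\<tau>. env j p \<tau> \<Longrightarrow> aval xh \<tau> = Xh"
      "\<And>\<tau>. env j p \<tau> \<Longrightarrow> aval yl \<tau> = Yl" "\<And>\<tau>. env j p \<tau> \<Longrightarrow> aval yh \<tau> = Yh"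
  shows "env j p (den (run_phase xl xh yl yh) \<sigma>) \<and>
    (\<exists>S'. phase {..<n} r (Suc j) X Y Z S S' \<and> represents (den (run_phase xl xh yl yh) \<sigma>) S')"
proof -
  let ?step = "xstep {..<n} r (Suc j) X Y Z"
  \<comment> \<open>Each search either makes an exchange, adding an edge inside \<open>X\<close>, or
    shows that none is left. The second alternative fails for \<open>i = n\<close>, as a spanning
    tree has fewer than \<open>n\<close> edges.\<close>
  define I where "I i \<tau> \<longleftrightarrow> env j p \<tau> \<and> (\<exists>S1. ?step\<^sup>*\<^sup>* S S1 \<and> represents \<tau> S1 \<and> ok S1 \<and>
    ((\<nexists>S2. ?step S1 S2) \<or> i \<le> card (induced (S1 (Suc j)) X)))" for i \<tau>
  have "I n (den (run_phase xl xh yl yh) \<sigma>)"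
    unfolding run_phase_def
  proof (rule for_rule_setv[where I = I])
    show "nat (aval nE \<sigma>) = n" using assms(6) by (simp add: env_def inp)
    have "env j p (setv ''it'' 0 \<sigma>)" by (rule env_setv[OF assms(6)]) simp
    moreover have "represents (setv ''it'' 0 \<sigma>) S" by (rule represents_cong[OF assms(7)]) simp
    ultimately show "I 0 (setv ''it'' 0 \<sigma>)" unfolding I_def using assms(4) by auto
    show "I i (setv ''it'' z \<tau>)" if "I i \<tau>" for i \<tau> z
    proof -
      have "env j p (setv ''it'' z \<tau>)" by (rule env_setv) (use that in \<open>simp_all add: I_def\<close>)
      moreover have "represents (setv ''it'' z \<tau>) S1" if "represents \<tau> S1" for S1
        by (rule represents_cong[OF that]) simp
      ultimately show ?thesis using that unfolding I_def by blast
    qed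
  next
    fix i \<tau> assume i: "I i \<tau>"
    then obtain S1 where S1: "?step\<^sup>*\<^sup>* S S1" "represents \<tau> S1" "ok S1"
      "(\<nexists>S2. ?step S1 S2) \<or> i \<le> card (induced (S1 (Suc j)) X)" and e: "env j p \<tau>"
      unfolding I_def by blast
    note sp = search_spec[where xl = xl and xh = xh and yl = yl and yh = yh,
        OF S1(3) assms(5) vals e S1(2), folded X_def Y_def Z_def]
    from sp(2) show "I (Suc i) (den (search xl xh yl yh) \<tau>)"
    proof
      assume "\<exists>S'. ?step S1 S' \<and> represents (den (search xl xh yl yh) \<tau>) S'"
      then obtain S2 where S2: "?step S1 S2" "represents (den (search xl xh yl yh) \<tau>) S2" by blast
      have "i \<le> card (induced (S1 (Suc j)) X)" using S1(4) S2(1) by blast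
      then have "Suc i \<le> card (induced (S2 (Suc j)) X)"
        using xstep_measure[OF S1(3) S2(1) _ assms(8)] by simp
      moreover have "ok S2" using xstep_ok[OF S1(3) S2(1)] by simp
      moreover have "?step\<^sup>*\<^sup>* S S2" using S1(1) S2(1) by simp
      ultimately show ?thesis unfolding I_def using S2(2) sp(1) by blast
    next
      assume "represents (den (search xl xh yl yh) \<tau>) S1 \<and> (\<nexists>S'. ?step S1 S')"
      then show ?thesis unfolding I_def using S1 sp(1) by blast
    qed
  qed simp
  then obtain S1 where S1: "?step\<^sup>*\<^sup>* S S1" "represents (den (run_phase xl xh yl yh) \<sigma>) S1" "ok S1"
    "(\<nexists>S2. ?step S1 S2) \<or> n \<le> card (induced (S1 (Suc j)) X)"
    and e: "env j p (den (run_phase xl xh yl yh) \<sigma>)" unfolding I_def by blast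
  have "card (induced (S1 (Suc j)) X) < n"
    using induced_card_less[OF ok_tree[OF S1(3)], of "Suc j" X] assms(5) by simp
  then have "\<nexists>S2. ?step S1 S2" using S1(4) by simp
  then show ?thesis using S1(1,2) e unfolding phase_def by blast
qed

lemma rank_range_lev:
  "rank_range j (int p) (int p') = lev (Suc j) p' - lev (Suc j) p"
  "rank_range j (int p - 1) (int p') = lev (Suc j) p' - lev (Suc j) (p - 1)"
  "rank_range j 0 (int p) = lev (Suc j) p"
  "rank_range j (int p) (int n + 1) = {..<n} - lev (Suc j) p"
  "rank_range j (int p - 1) (int n + 1) = {..<n} - lev (Suc j) (p - 1)"
proof -
  have "rk (Suc j) w \<le> n" for w
    using rk_le[of "Suc j" w] card_rel_le[of "Suc j"] by simp
  then have top: "int (rk (Suc j) w) < int n + 1" for w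
    by (metis less_Suc_eq_le of_nat_Suc of_nat_less_iff add.commute)
  show "rank_range j (int p) (int p') = lev (Suc j) p' - lev (Suc j) p"
    "rank_range j (int p - 1) (int p') = lev (Suc j) p' - lev (Suc j) (p - 1)"
    "rank_range j 0 (int p) = lev (Suc j) p"
    by (auto simp: rank_range_def lev_def)
  show "rank_range j (int p) (int n + 1) = {..<n} - lev (Suc j) p"
    "rank_range j (int p - 1) (int n + 1) = {..<n} - lev (Suc j) (p - 1)"
    using top by (auto simp: rank_range_def lev_def)
qed

lemma run_stage_spec:
  assumes "ok S" "j < r" "env j p \<sigma>" "represents \<sigma> S"
  shows "env j p (den run_stage \<sigma>) \<and> (\<exists>S'. stage (Suc j) p S S' \<and> represents (den run_stage \<sigma>) S')"
proof -
  have pE: "aval pE \<tau> = int p" "aval topE \<tau> = int n + 1" if "env j p \<tau>" for \<tau>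
    using that by (simp_all add: env_def inp)
  have pS: "int p + 1 = int (Suc p)" by simp
  note ranges = rank_range_lev(1)[of j p "Suc p", folded pS] rank_range_lev(2)[of j p "Suc p", folded pS]
    rank_range_lev(3)[of j p] rank_range_lev(3)[of j "Suc p", folded pS]
    rank_range_lev(4)[of j p] rank_range_lev(4)[of j "Suc p", folded pS] rank_range_lev(5)[of j p]
  let ?p1 = "run_phase pE (Add pE (Const 1)) pE topE"
  let ?p2 = "run_phase (Sub pE (Const 1)) (Add pE (Const 1)) (Sub pE (Const 1)) topE"
  let ?p3 = "run_phase pE topE (Const 0) pE"
  let ?p4 = "run_phase (Add pE (Const 1)) topE (Const 0) (Add pE (Const 1))"
  have 1: "env j p (den ?p1 \<sigma>) \<and> (\<exists>S'. phase {..<n} r (Suc j)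
      (lev (Suc j) (p + 1) - lev (Suc j) p) ({..<n} - lev (Suc j) p) ({..<n} - lev (Suc j) (p + 1)) S S' \<and>
      represents (den ?p1 \<sigma>) S')"
    if "ok S" "env j p \<sigma>" "represents \<sigma> S" for S \<sigma>
    using run_phase_spec[of S j p \<sigma> "int p" "int p + 1" "int p" "int n + 1" pE "Add pE (Const 1)" pE topE]
      that assms(2) pE unfolding ranges by auto
  have 2: "env j p (den ?p2 \<sigma>) \<and> (\<exists>S'. phase {..<n} r (Suc j)
      (lev (Suc j) (p + 1) - lev (Suc j) (p - 1)) ({..<n} - lev (Suc j) (p - 1)) ({..<n} - lev (Suc j) (p + 1)) S S' \<and>
      represents (den ?p2 \<sigma>) S')"
    if "ok S" "env j p \<sigma>" "represents \<sigma> S" for S \<sigma>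
    using run_phase_spec[of S j p \<sigma> "int p - 1" "int p + 1" "int p - 1" "int n + 1"
        "Sub pE (Const 1)" "Add pE (Const 1)" "Sub pE (Const 1)" topE]
      that assms(2) pE unfolding ranges by auto
  have 3: "env j p (den ?p3 \<sigma>) \<and> (\<exists>S'. phase {..<n} r (Suc j)
      ({..<n} - lev (Suc j) p) (lev (Suc j) p) ({..<n} - lev (Suc j) (p + 1)) S S' \<and>
      represents (den ?p3 \<sigma>) S')"
    if "ok S" "env j p \<sigma>" "represents \<sigma> S" for S \<sigma>
    using run_phase_spec[of S j p \<sigma> "int p" "int n + 1" 0 "int p" pE topE "Const 0" pE]
      that assms(2) pE unfolding ranges by auto
  have 4: "env j p (den ?p4 \<sigma>) \<and> (\<exists>S'. phase {..<n} r (Suc j)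
      ({..<n} - lev (Suc j) (p + 1)) (lev (Suc j) (p + 1)) ({..<n} - lev (Suc j) (p + 1)) S S' \<and>
      represents (den ?p4 \<sigma>) S')"
    if "ok S" "env j p \<sigma>" "represents \<sigma> S" for S \<sigma>
    using run_phase_spec[of S j p \<sigma> "int p + 1" "int n + 1" 0 "int p + 1"
        "Add pE (Const 1)" topE "Const 0" "Add pE (Const 1)"]
      that assms(2) pE unfolding ranges by auto
  obtain S1 where S1: "phase {..<n} r (Suc j)
      (lev (Suc j) (p + 1) - lev (Suc j) p) ({..<n} - lev (Suc j) p) ({..<n} - lev (Suc j) (p + 1)) S S1"
      "represents (den ?p1 \<sigma>) S1" and e1: "env j p (den ?p1 \<sigma>)"
    using 1[OF assms(1,3,4)] by blast
  have ok1: "ok S1" using phase_ok[OF S1(1) _ assms(1)] by simp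
  obtain S2 where S2: "phase {..<n} r (Suc j)
      (lev (Suc j) (p + 1) - lev (Suc j) (p - 1)) ({..<n} - lev (Suc j) (p - 1)) ({..<n} - lev (Suc j) (p + 1)) S1 S2"
      "represents (den ?p2 (den ?p1 \<sigma>)) S2" and e2: "env j p (den ?p2 (den ?p1 \<sigma>))"
    using 2[OF ok1 e1 S1(2)] by blast
  have ok2: "ok S2" using phase_ok[OF S2(1) _ ok1] by simp
  obtain S3 where S3: "phase {..<n} r (Suc j)
      ({..<n} - lev (Suc j) p) (lev (Suc j) p) ({..<n} - lev (Suc j) (p + 1)) S2 S3"
      "represents (den ?p3 (den ?p2 (den ?p1 \<sigma>))) S3" and e3: "env j p (den ?p3 (den ?p2 (den ?p1 \<sigma>)))"
    using 3[OF ok2 e2 S2(2)] by blast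
  have ok3: "ok S3" using phase_ok[OF S3(1) _ ok2] by simp
  obtain S4 where S4: "phase {..<n} r (Suc j)
      ({..<n} - lev (Suc j) (p + 1)) (lev (Suc j) (p + 1)) ({..<n} - lev (Suc j) (p + 1)) S3 S4"
      "represents (den ?p4 (den ?p3 (den ?p2 (den ?p1 \<sigma>)))) S4"
      and e4: "env j p (den ?p4 (den ?p3 (den ?p2 (den ?p1 \<sigma>))))"
    using 4[OF ok3 e3 S3(2)] by blast
  have "den run_stage \<sigma> = den ?p4 (den ?p3 (den ?p2 (den ?p1 \<sigma>)))" by (simp add: run_stage_def)
  moreover have "stage (Suc j) p S S4" unfolding stage_def using S1(1) S2(1) S3(1) S4(1) by blast
  ultimately show ?thesis using S4(2) e4 by auto
qed

text \<open>\<open>env\<close> fixes the value of \<open>''p''\<close>, which is the counter of this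
  loop; the assumption is therefore made for the store with the counter overwritten, for every
  value.\<close>

lemma run_stages_spec:
  assumes "ok S" "j < r" "\<And>p. env j p (setv ''p'' (int p) \<sigma>)" "represents \<sigma> S"
  shows "\<exists>S'. stages (Suc j) n S S' \<and> represents (den (PFor ''p'' nE run_stage) \<sigma>) S'"
proof -
  define L where "L \<tau> \<longleftrightarrow> base \<tau> \<and> \<tau> ''j'' 0 = int j \<and> (\<forall>w < n. \<tau> ''be'' (int w) = int (rk (Suc j) w))"
    for \<tau>
  have L: "L \<tau> \<longleftrightarrow> env j p (setv ''p'' (int p) \<tau>)" for \<tau> p
    unfolding L_def env_def base_def by simp
  define I where "I i \<tau> \<longleftrightarrow> L \<tau> \<and> (\<exists>S'. stages (Suc j) i S S' \<and> represents \<tau> S')" for i \<tau>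
  have Ls: "L (setv ''p'' z \<tau>)" if "L \<tau>" for \<tau> z
    using that base_setv[of \<tau> "''p''" z] by (simp add: L_def)
  have "I n (den (PFor ''p'' nE run_stage) \<sigma>)"
  proof (rule for_rule_setv[where I = I])
    have L\<sigma>: "L \<sigma>" using L[of \<sigma> 0] assms(3)[of 0] by simp
    then show "nat (aval nE \<sigma>) = n" by (simp add: L_def inp)
    show "I 0 (setv ''p'' 0 \<sigma>)"
      unfolding I_def using Ls[OF L\<sigma>] represents_cong[OF assms(4), of "setv ''p'' 0 \<sigma>"] by simp
    show "I i (setv ''p'' z \<tau>)" if "I i \<tau>" for i \<tau> z
      using that Ls represents_cong[of \<tau> _ "setv ''p'' z \<tau>"] unfolding I_def by auto
  next
    fix i \<tau> assume i: "I i \<tau>" "\<tau> ''p'' 0 = int i"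
    then obtain S1 where S1: "stages (Suc j) i S S1" "represents \<tau> S1" and Lt: "L \<tau>"
      unfolding I_def by blast
    have e: "env j i \<tau>" using Lt i(2) by (simp add: L_def env_def)
    have ok1: "ok S1" using stages_ok[OF S1(1) _ assms(1)] by simp
    from run_stage_spec[OF ok1 assms(2) e S1(2)]
    show "I (Suc i) (den run_stage \<tau>)"
      using S1(1) unfolding I_def L_def env_def by auto
  qed simp
  then show ?thesis unfolding I_def by blast
qed

lemma main_loop_spec:
  assumes "base \<sigma>" "\<sigma> ''jd'' 0 = 0" "represents \<sigma> S0"
  shows "\<exists>S'. done_upto r S' \<and> represents (den main_loop \<sigma>) S'"
proof -
  let ?inc = "PAssign ''jd'' (Const 0) (Add (var ''jd'') (Cell ''in'' (Const 4)))"
  define I where "I i \<tau> \<longleftrightarrow> base \<tau> \<and> \<tau> ''jd'' 0 = int i * D \<and>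
    (\<exists>S'. done_upto i S' \<and> represents \<tau> S')" for i \<tau>
  have "I r (den main_loop \<sigma>)"
    unfolding main_loop_def
  proof (rule for_rule_setv[where I = I])
    show "nat (aval rE \<sigma>) = r" using assms(1) by (simp add: inp)
    show "I 0 (setv ''j'' 0 \<sigma>)"
      unfolding I_def using base_setv[OF assms(1), of "''j''" 0] assms(2) done_upto_0
        represents_cong[OF assms(3), of "setv ''j'' 0 \<sigma>"] by auto
    show "I i (setv ''j'' z \<tau>)" if "I i \<tau>" for i \<tau> z
      using that base_setv[of \<tau> "''j''" z] represents_cong[of \<tau> _ "setv ''j'' z \<tau>"]
      unfolding I_def by auto
  next
    fix i \<tau> assume i: "i < r" "I i \<tau>" "\<tau> ''j'' 0 = int i"
    then obtain S1 where S1: "done_upto i S1" "represents \<tau> S1" and b: "base \<tau>" "\<tau> ''jd'' 0 = int i * D"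
      unfolding I_def by blast
    define \<tau>1 where "\<tau>1 = den level \<tau>"
    define \<tau>2 where "\<tau>2 = den (PFor ''p'' nE run_stage) \<tau>1"
    have b1: "base \<tau>1" unfolding \<tau>1_def by (rule base_den[OF b(1)]) simp_all
    have b2: "base \<tau>2" unfolding \<tau>2_def by (rule base_den[OF b1]) simp_all
    have be: "\<tau>1 ''be'' (int w) = int (rk (Suc i) w)" if "w < n" for w
      unfolding \<tau>1_def by (rule level_spec[OF b that])
    have j1: "\<tau>1 ''j'' 0 = int i" using i(3) by (simp add: \<tau>1_def den_frame)
    have e: "env i p (setv ''p'' (int p) \<tau>1)" for p
      using base_setv[OF b1, of "''p''" "int p"] be j1 by (simp add: env_def)
    have r1: "represents \<tau>1 S1"
      by (rule represents_cong[OF S1(2)]) (simp add: \<tau>1_def den_frame)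
    have ok1: "ok S1" using S1(1) by (simp add: done_upto_def)
    obtain S2 where S2: "stages (Suc i) n S1 S2" "represents \<tau>2 S2"
      using run_stages_spec[OF ok1 i(1) e r1] unfolding \<tau>2_def by blast
    have d2: "done_upto (Suc i) S2" by (rule done_upto_Suc[OF S1(1)]) (use S2(1) i(1) in simp_all)
    have "\<tau>1 ''jd'' = \<tau> ''jd''" unfolding \<tau>1_def by (rule den_frame) simp
    moreover have "\<tau>2 ''jd'' = \<tau>1 ''jd''" unfolding \<tau>2_def by (rule den_frame) simp
    ultimately have "\<tau>2 ''jd'' 0 = int i * D" using b(2) by simp
    then have "den ?inc \<tau>2 ''jd'' 0 = int (Suc i) * D"
      using b2 by (simp add: inp_D algebra_simps)
    moreover have "base (den ?inc \<tau>2)" by (rule base_den[OF b2]) simp_all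
    moreover have "represents (den ?inc \<tau>2) S2" by (rule represents_cong[OF S2(2)]) simp
    ultimately have "I (Suc i) (den ?inc \<tau>2)" unfolding I_def using d2 by blast
    then show "I (Suc i) (den (PSeq level (PSeq (PFor ''p'' nE run_stage) ?inc)) \<tau>)"
      by (simp only: den.simps(3) \<tau>1_def \<tau>2_def)
  qed simp
  then show ?thesis unfolding I_def by blast
qed

end

section \<open>The whole program\<close>

text \<open>Kept apart from \<open>body\<close>, since \<open>body\<close> uses entries of both
  tables as loop bounds and \<open>exec_den\<close> requires bounds free of written arrays.\<close>

definition init :: prog where
  "init = PSeq
     (PFor ''i'' nE (PAssign ''row'' (Add (var ''i'') (Const 1)) (Add (Cell ''row'' (var ''i'')) nE)))
     (PFor ''i'' rE (PAssign ''tb'' (Add (var ''i'') (Const 1)) (Add (Cell ''tb'' (var ''i'')) (Cell ''row'' nE))))"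

text \<open>The output array is the working copy: exchanges are made in it in place, and the input
  stays intact for computing the ranks.\<close>

definition copy_trees :: prog where
  "copy_trees = PFor ''i'' (Cell ''tb'' rE) (PAssign ''out'' (var ''i'')
     (Cell ''in'' (Add (Add (Const 6) (Cell ''row'' nE)) (var ''i''))))"

definition body :: prog where
  "body = PSeq copy_trees (PSeq (PAssign ''outlen'' (Const 0) (Cell ''tb'' rE)) main_loop)"

lemma counters_ok_init: "counters_ok init"
  by (simp add: init_def)

lemma counters_ok_body: "counters_ok body"
  by (simp add: body_def copy_trees_def main_loop_def level_def cut_body_def test_cut_def measure_cut_def
      weigh_def raise_def run_stage_def run_phase_def search_def try_all_def attempt_def test_swap_def
      swap_def set_out_def load_def set_edge_def reach_def scan_def check_def)

lemma bounds_init: "bounds init \<subseteq> {nE, rE}"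
  by (simp add: init_def)

lemma bounds_body: "bounds body \<subseteq> {nE, rE, Cell ''row'' nE, Cell ''tb'' rE}"
  by (simp add: body_def copy_trees_def main_loop_def level_def cut_body_def test_cut_def measure_cut_def
      weigh_def raise_def run_stage_def run_phase_def search_def try_all_def attempt_def test_swap_def
      swap_def set_out_def load_def set_edge_def reach_def scan_def check_def)

lemma writes_init: "writes init = {''i'', ''row'', ''tb''}"
  by (auto simp: init_def)

lemma writes_main: "''in'' \<notin> writes main_loop" "''row'' \<notin> writes main_loop" "''tb'' \<notin> writes main_loop"
  "''outlen'' \<notin> writes main_loop"
  by (simp_all add: main_loop_def)

lemma writes_body: "''in'' \<notin> writes body" "''row'' \<notin> writes body" "''tb'' \<notin> writes body"
  using writes_main by (simp_all add: body_def copy_trees_def)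

lemma (in machine) init_spec:
  assumes "\<sigma> ''in'' = inp" "\<sigma> ''row'' 0 = 0" "\<sigma> ''tb'' 0 = 0"
  shows "base (den init \<sigma>)"
proof -
  let ?a = "PAssign ''row'' (Add (var ''i'') (Const 1)) (Add (Cell ''row'' (var ''i'')) nE)"
  let ?b = "PAssign ''tb'' (Add (var ''i'') (Const 1)) (Add (Cell ''tb'' (var ''i'')) (Cell ''row'' nE))"
  define \<sigma>1 where "\<sigma>1 = den (PFor ''i'' nE ?a) \<sigma>"
  have "\<sigma>1 ''in'' = \<sigma> ''in''" "\<sigma>1 ''tb'' = \<sigma> ''tb''"
    unfolding \<sigma>1_def by (rule den_frame; simp)+
  then have in1: "\<sigma>1 ''in'' = inp" "\<sigma>1 ''tb'' 0 = 0" using assms by simp_all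
  have row1: "\<forall>m \<le> n. \<sigma>1 ''row'' (int m) = int m * int n"
    unfolding \<sigma>1_def
  proof (rule for_rule_setv[where I = "\<lambda>i \<tau>. \<forall>m \<le> i. \<tau> ''row'' (int m) = int m * int n"])
    fix i \<tau>
    assume i: "\<forall>m \<le> i. \<tau> ''row'' (int m) = int m * int n" "\<tau> ''i'' 0 = int i"
      and frame: "\<And>A. A \<noteq> ''i'' \<Longrightarrow> A \<notin> writes ?a \<Longrightarrow> \<tau> A = \<sigma> A"
    have "\<tau> ''in'' = inp" using frame[of "''in''"] assms(1) by simp
    then show "\<forall>m \<le> Suc i. den ?a \<tau> ''row'' (int m) = int m * int n"
      using i by (auto simp: le_Suc_eq inp algebra_simps)
  qed (use assms in \<open>auto simp: inp\<close>)
  have "\<forall>m \<le> r. den (PFor ''i'' rE ?b) \<sigma>1 ''tb'' (int m) = int m * int n * int n"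
  proof (rule for_rule_setv[where I = "\<lambda>i \<tau>. \<forall>m \<le> i. \<tau> ''tb'' (int m) = int m * int n * int n"])
    fix i \<tau>
    assume i: "\<forall>m \<le> i. \<tau> ''tb'' (int m) = int m * int n * int n" "\<tau> ''i'' 0 = int i"
      and frame: "\<And>A. A \<noteq> ''i'' \<Longrightarrow> A \<notin> writes ?b \<Longrightarrow> \<tau> A = \<sigma>1 A"
    have "\<tau> ''in'' = inp" "\<tau> ''row'' (int n) = int n * int n"
      using frame[of "''in''"] frame[of "''row''"] in1 row1 by simp_all
    then show "\<forall>m \<le> Suc i. den ?b \<tau> ''tb'' (int m) = int m * int n * int n"
      using i by (auto simp: le_Suc_eq inp algebra_simps)
  qed (use in1 in \<open>auto simp: inp\<close>)
  moreover have "den (PFor ''i'' rE ?b) \<sigma>1 ''in'' = \<sigma>1 ''in''"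
    "den (PFor ''i'' rE ?b) \<sigma>1 ''row'' = \<sigma>1 ''row''"
    by (rule den_frame; simp)+
  moreover have "den init \<sigma> = den (PFor ''i'' rE ?b) \<sigma>1" by (simp add: init_def \<sigma>1_def)
  ultimately show ?thesis using row1 in1 by (simp only: base_def)
qed

context machine_instance
begin

lemma body_spec:
  assumes "base \<sigma>" "\<sigma> ''jd'' 0 = 0"
  shows "\<exists>S'. reassembled {..<n} xs eps r S0 S' \<and> represents (den body \<sigma>) S' \<and>
    (\<forall>k \<in> {1..r}. S' k \<in> spanning_trees {..<n}) \<and> den body \<sigma> ''outlen'' 0 = int (r * n * n)"
proof -
  define \<sigma>1 where "\<sigma>1 = den copy_trees \<sigma>"
  define \<sigma>2 where "\<sigma>2 = den (PAssign ''outlen'' (Const 0) (Cell ''tb'' rE)) \<sigma>1"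
  let ?p = "PAssign ''out'' (var ''i'') (Cell ''in'' (Add (Add (Const 6) (Cell ''row'' nE)) (var ''i'')))"
  have "\<forall>m < r * n * n. \<sigma>1 ''out'' (int m) = inp (6 + int n * int n + int m)"
    unfolding \<sigma>1_def copy_trees_def
  proof (rule for_rule_setv[where I = "\<lambda>i \<tau>. \<forall>m < i. \<tau> ''out'' (int m) = inp (6 + int n * int n + int m)"])
    have "aval (Cell ''tb'' rE) \<sigma> = int (r * n * n)" using assms(1) by (simp add: inp)
    then show "nat (aval (Cell ''tb'' rE) \<sigma>) = r * n * n" by (simp only: nat_int)
  next
    fix i \<tau>
    assume i: "\<forall>m < i. \<tau> ''out'' (int m) = inp (6 + int n * int n + int m)" "\<tau> ''i'' 0 = int i"
      and frame: "\<And>A. A \<noteq> ''i'' \<Longrightarrow> A \<notin> writes ?p \<Longrightarrow> \<tau> A = \<sigma> A"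
    have "\<tau> ''in'' = inp" "\<tau> ''row'' (int n) = int n * int n"
      using frame[of "''in''"] frame[of "''row''"] assms(1) by simp_all
    then show "\<forall>m < Suc i. den ?p \<tau> ''out'' (int m) = inp (6 + int n * int n + int m)"
      using i by (auto simp: less_Suc_eq inp)
  qed auto
  then have out: "\<sigma>1 ''out'' (int k * int n * int n + (int u * int n + int v)) =
      (if {u, v} \<in> S0 (Suc k) then 1 else 0)" if "k < r" "u < n" "v < n" for k u v
  proof -
    have "k * n * n + (u * n + v) < r * n * n"
      using pair_index_less[OF pair_index_less[OF that(1,2)] that(3)] by (simp add: algebra_simps)
    from \<open>\<forall>m < r * n * n. _\<close>[rule_format, OF this]
    show ?thesis using inp_S[OF that] by simp
  qed
  have b1: "base \<sigma>1" unfolding \<sigma>1_def by (rule base_den[OF assms(1)]) (simp_all add: copy_trees_def)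
  have b2: "base \<sigma>2" unfolding \<sigma>2_def by (rule base_den[OF b1]) simp_all
  have rep: "represents \<sigma>2 S0" using out by (simp add: represents_def \<sigma>2_def)
  have jd: "\<sigma>2 ''jd'' 0 = 0"
  proof -
    have "\<sigma>1 ''jd'' = \<sigma> ''jd''" unfolding \<sigma>1_def by (rule den_frame) (simp add: copy_trees_def)
    then show ?thesis using assms(2) by (simp add: \<sigma>2_def)
  qed
  obtain S' where S': "done_upto r S'" "represents (den main_loop \<sigma>2) S'"
    using main_loop_spec[OF b2 jd rep] by blast
  have body: "den body \<sigma> = den main_loop \<sigma>2" by (simp add: body_def \<sigma>1_def \<sigma>2_def)
  have "den body \<sigma> ''outlen'' = \<sigma>2 ''outlen''" unfolding body by (rule den_frame[OF writes_main(4)])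
  then have "den body \<sigma> ''outlen'' 0 = int (r * n * n)" using b1 by (simp add: \<sigma>2_def inp)
  moreover have "S' k \<in> spanning_trees {..<n}" if "k \<in> {1..r}" for k
    using S'(1) ok_tree that by (auto simp: done_upto_def)
  ultimately show ?thesis using reassembled_if_done[OF S'(1)] S'(2) body by auto
qed

end

section \<open>Encodings\<close>

lemma concat_blocks:
  assumes "\<And>u. u < m \<Longrightarrow> length (F u) = l"
  shows "length (concat (map F [0..<m])) = m * l"
    and "u < m \<Longrightarrow> v < l \<Longrightarrow> concat (map F [0..<m]) ! (u * l + v) = F u ! v"
proof -
  have "length (concat (map F [0..<m])) = m * l \<and>
    (\<forall>u < m. \<forall>v < l. concat (map F [0..<m]) ! (u * l + v) = F u ! v)"
    using assms
  proof (induction m)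
    case (Suc m)
    then have IH: "length (concat (map F [0..<m])) = m * l"
      "\<forall>u < m. \<forall>v < l. concat (map F [0..<m]) ! (u * l + v) = F u ! v" by auto
    have "concat (map F [0..<Suc m]) ! (u * l + v) = F u ! v" if "u < Suc m" "v < l" for u v
    proof (cases "u < m")
      case True
      then show ?thesis using IH pair_index_less[OF True that(2)] that(2) by (simp add: nth_append)
    next
      case False
      then have "u = m" using that(1) by simp
      then show ?thesis using IH(1) by (simp add: nth_append)
    qed
    then show ?case using IH(1) Suc.prems by simp
  qed simp
  then show "length (concat (map F [0..<m])) = m * l"
    "u < m \<Longrightarrow> v < l \<Longrightarrow> concat (map F [0..<m]) ! (u * l + v) = F u ! v" by auto
qed

lemma enc_edge_vector_nth:
  shows "length (enc_edge_vector n f) = n * n"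
    and "u < n \<Longrightarrow> v < n \<Longrightarrow> enc_edge_vector n f ! (u * n + v) = (if u = v then 0 else f {u, v})"
  unfolding enc_edge_vector_def
  using concat_blocks[of n "\<lambda>u. map (\<lambda>v. if u = v then 0 else f {u, v}) [0..<n]" n] by simp_all

lemma enc_trees_nth:
  shows "length (enc_trees n r S) = r * n * n"
    and "k < r \<Longrightarrow> u < n \<Longrightarrow> v < n \<Longrightarrow> enc_trees n r S ! (k * n * n + (u * n + v)) =
      (if u = v then 0 else indicator (S (Suc k)) {u, v})"
proof -
  have "map (\<lambda>j. enc_edge_vector n (indicator (S j))) [1..<Suc r] =
      map (\<lambda>k. enc_edge_vector n (indicator (S (Suc k)))) [0..<r]"
    using map_Suc_upt[of 0 r, symmetric] by (simp add: comp_def)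
  then have e: "enc_trees n r S = concat (map (\<lambda>k. enc_edge_vector n (indicator (S (Suc k)))) [0..<r])"
    unfolding enc_trees_def by (rule arg_cong)
  show "length (enc_trees n r S) = r * n * n"
    unfolding e by (subst concat_blocks(1)[of r _ "n * n"]) (simp_all add: enc_edge_vector_nth(1))
  assume k: "k < r" "u < n" "v < n"
  show "enc_trees n r S ! (k * n * n + (u * n + v)) = (if u = v then 0 else indicator (S (Suc k)) {u, v})"
    unfolding e
    using concat_blocks(2)[of r "\<lambda>k. enc_edge_vector n (indicator (S (Suc k)))" "n * n",
        OF enc_edge_vector_nth(1) k(1) pair_index_less[OF k(2,3)]] enc_edge_vector_nth(2)[OF k(2,3)]
    by (simp add: mult.assoc)
qed

lemma length_le_word_bits: "length w \<le> word_bits w"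
  unfolding word_bits_def by (induction w) auto

lemma triple_index:
  fixes i r n :: nat
  assumes "i < r * n * n"
  obtains k u v where "i = k * n * n + (u * n + v)" "k < r" "u < n" "v < n"
proof -
  have n: "n > 0" using assms by (cases n) auto
  have "i div n < r * n" using assms n by (simp add: div_less_iff_less_mult)
  then have "i div n div n < r" using n by (simp add: div_less_iff_less_mult)
  moreover have "i = (i div n div n) * n * n + ((i div n mod n) * n + i mod n)"
    by (metis add.assoc add_mult_distrib div_mult_mod_eq)
  ultimately show ?thesis using that[of "i div n div n" "i div n mod n" "i mod n"] n by simp
qed

lemma program_correct:
  fixes n s t r :: nat and D b :: int and a :: "nat set \<Rightarrow> int" and S :: "nat \<Rightarrow> nat set set"
  defines "w \<equiv> enc_instance n s t D a b r S"
  assumes D: "D > 0"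
    and inst: "reassembly_instance {..<n} s t (\<lambda>e. real_of_int (a e) / real_of_int D)
      (real_of_int b / real_of_int D) r S"
  shows "\<exists>S' k. computes (Seq (compile init) (compile body)) w (enc_trees n r S') k \<and>
    k \<le> poly (cost init + cost body) (word_bits w) \<and>
    reassembled {..<n} (\<lambda>e. real_of_int (a e) / real_of_int D) (real_of_int b / real_of_int D) r S S'"
proof -
  have s: "s < n" and tree: "\<And>k. k \<in> {1..r} \<Longrightarrow> S k \<in> spanning_trees {..<n}" and r: "r \<ge> 1"
    using inst by (auto simp: reassembly_instance_def)
  define inp where "inp = input_store w ''in''"
  let ?h = "[int n, int s, int t, int r, D, b]"
  have w: "w = ?h @ enc_edge_vector n a @ enc_trees n r S" by (simp add: w_def enc_instance_def)
  have len: "length w = 6 + n * n + r * n * n"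
    by (simp add: w enc_edge_vector_nth(1) enc_trees_nth(1))
  have nth: "inp (int i) = w ! i" if "i < length w" for i
    using that by (simp add: inp_def input_store_def)
  have head: "inp 0 = int n" "inp 1 = int s" "inp 3 = int r" "inp 4 = D" "inp 5 = b"
    using nth[of 0] nth[of 1] nth[of 3] nth[of 4] nth[of 5] len by (simp_all add: w)
  have edge: "inp (6 + (int u * int n + int v)) = a {u, v}" if "u < n" "v < n" "u \<noteq> v" for u v
  proof -
    have lt: "u * n + v < n * n" by (rule pair_index_less[OF that(1,2)])
    then have "inp (int (6 + (u * n + v))) = w ! (6 + (u * n + v))" by (intro nth) (simp add: len)
    also have "\<dots> = enc_edge_vector n a ! (u * n + v)"
      using lt by (simp add: w nth_append enc_edge_vector_nth(1))
    finally show ?thesis using enc_edge_vector_nth(2)[OF that(1,2), of a] that(3) by simp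
  qed
  \<comment> \<open>The encoding has zeros on the diagonal, where \<open>{u, u}\<close> is the
    singleton \<open>{u}\<close>. As no tree contains one, the formula for the matrix entries holds
    there too.\<close>
  have loop: "{u} \<notin> S (Suc k)" if "k < r" for u k
  proof
    assume "{u} \<in> S (Suc k)"
    then have "{u, u} \<in> complete_edges {..<n}"
      using tree[of "Suc k"] that by (auto simp: spanning_trees_def)
    then show False by (simp only: complete_edges_iff) simp
  qed
  have trees: "inp (6 + int n * int n + (int k * int n * int n + (int u * int n + int v))) =
      (if {u, v} \<in> S (Suc k) then 1 else 0)" if "k < r" "u < n" "v < n" for k u v
  proof -
    have lt: "k * n * n + (u * n + v) < r * n * n"
      using pair_index_less[OF pair_index_less[OF that(1,2)] that(3)] by (simp add: algebra_simps)
    then have "inp (int (6 + n * n + (k * n * n + (u * n + v)))) = w ! (6 + n * n + (k * n * n + (u * n + v)))"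
      by (intro nth) (simp add: len)
    also have "\<dots> = enc_trees n r S ! (k * n * n + (u * n + v))"
      by (simp add: w nth_append enc_edge_vector_nth(1))
    finally show ?thesis
      using enc_trees_nth(2)[OF that, of S] loop[OF that(1)] by (auto simp: indicator_def)
  qed
  interpret machine_instance n s t r "\<lambda>e. real_of_int (a e) / real_of_int D"
    "real_of_int b / real_of_int D" S inp D b a
    by unfold_locales (use inst D s head edge trees in auto)
  define \<sigma>0 where "\<sigma>0 = input_store w"
  define \<sigma>1 where "\<sigma>1 = den init \<sigma>0"
  have b1: "base \<sigma>1"
    unfolding \<sigma>1_def by (rule init_spec) (simp_all add: \<sigma>0_def inp_def input_store_def)
  have "\<sigma>1 ''jd'' 0 = 0"
    by (simp add: \<sigma>1_def den_frame writes_init \<sigma>0_def input_store_def)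
  from body_spec[OF b1 this] obtain S' where S':
    "reassembled {..<n} (\<lambda>e. real_of_int (a e) / real_of_int D) (real_of_int b / real_of_int D) r S S'"
    "represents (den body \<sigma>1) S'" "\<forall>k \<in> {1..r}. S' k \<in> spanning_trees {..<n}"
    "den body \<sigma>1 ''outlen'' 0 = int (r * n * n)" by blast
  let ?M = "word_bits w"
  have n1: "n \<ge> 1" using s by simp
  have M: "n * n \<le> ?M" "r * n * n \<le> ?M" "n \<le> ?M" "r \<le> ?M"
  proof -
    \<comment> \<open>The matrices are written out in the input, so the largest loop bound,
      \<open>r * n * n\<close>, is at most the input length; this makes the cost polynomial in the
      input size.\<close>
    show 1: "n * n \<le> ?M" "r * n * n \<le> ?M" using length_le_word_bits[of w] len by simp_all
    have "n \<le> n * n" using n1 by simp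
    then show "n \<le> ?M" using 1(1) by (rule order_trans)
    have "r \<le> r * n * n" using n1 by simp
    then show "r \<le> ?M" using 1(2) by (rule order_trans)
  qed
  have "\<exists>k. exec (compile init) \<sigma>0 k (den init \<sigma>0) \<and> k \<le> poly (cost init) ?M"
  proof (rule exec_den[OF counters_ok_init])
    fix B assume "B \<in> bounds init"
    then have "B = nE \<or> B = rE" using bounds_init by auto
    then show "aval B \<sigma>0 \<le> int ?M \<and> anames B \<inter> writes init = {}"
      using M head by (auto simp: writes_init \<sigma>0_def inp_def)
  qed
  then obtain k where k: "exec (compile init) \<sigma>0 k \<sigma>1" "k \<le> poly (cost init) ?M"
    unfolding \<sigma>1_def by blast
  have "\<exists>l. exec (compile body) \<sigma>1 l (den body \<sigma>1) \<and> l \<le> poly (cost body) ?M"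
  proof (rule exec_den[OF counters_ok_body])
    fix B assume "B \<in> bounds body"
    then have "B \<in> {nE, rE, Cell ''row'' nE, Cell ''tb'' rE}" using bounds_body by blast
    moreover have "aval nE \<sigma>1 = int n" "aval rE \<sigma>1 = int r" "aval (Cell ''row'' nE) \<sigma>1 = int (n * n)"
      "aval (Cell ''tb'' rE) \<sigma>1 = int (r * n * n)"
      using b1 by (simp_all add: head)
    ultimately have "aval B \<sigma>1 \<le> int ?M" using M by (metis empty_iff insert_iff of_nat_le_iff)
    moreover have "anames B \<inter> writes body = {}"
      using \<open>B \<in> {nE, rE, Cell ''row'' nE, Cell ''tb'' rE}\<close> writes_body by auto
    ultimately show "aval B \<sigma>1 \<le> int ?M \<and> anames B \<inter> writes body = {}" ..
  qed
  then obtain l where l: "exec (compile body) \<sigma>1 l (den body \<sigma>1)" "l \<le> poly (cost body) ?M" by blast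
  have "den body \<sigma>1 ''out'' (int i) = enc_trees n r S' ! i" if i: "i < r * n * n" for i
  proof -
    obtain k u v where k: "i = k * n * n + (u * n + v)" "k < r" "u < n" "v < n"
      using triple_index[OF i] .
    have "{u} \<notin> S' (Suc k)"
    proof
      assume "{u} \<in> S' (Suc k)"
      then have "{u, u} \<in> complete_edges {..<n}"
        using S'(3) k(2) by (force simp: spanning_trees_def)
      then show False by (simp only: complete_edges_iff) simp
    qed
    then show ?thesis
      using S'(2) k(2-4) enc_trees_nth(2)[OF k(2-4), of S']
      by (auto simp: k(1) represents_def indicator_def)
  qed
  then have "computes (Seq (compile init) (compile body)) w (enc_trees n r S') (k + l)"
    unfolding computes_def enc_trees_nth(1)
    using exec_Seq[OF k(1) l(1)] S'(4) unfolding \<sigma>0_def by blast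
  moreover have "k + l \<le> poly (cost init + cost body) ?M" using k(2) l(2) by simp
  ultimately show ?thesis using S'(1) by blast
qed

theorem theorem4:
  shows
    "(\<forall>(V :: 'a set) (s :: 'a) (t :: 'a) (xstar :: 'a set \<Rightarrow> real) (eps :: real)
        (r :: nat) (S :: nat \<Rightarrow> 'a set set).
        reassembly_instance V s t xstar eps r S \<longrightarrow>
        (\<exists>S' :: nat \<Rightarrow> 'a set set. reassembled V xstar eps r S S'))
     \<and>
     (\<exists>(c :: com) (p :: nat poly).
        \<forall>(n :: nat) (s :: nat) (t :: nat) (D :: int) (a :: nat set \<Rightarrow> int) (b :: int)
         (r :: nat) (S :: nat \<Rightarrow> nat set set).
          D > 0 \<and>
          reassembly_instance {..<n} s t (\<lambda>e. real_of_int (a e) / real_of_int D)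
            (real_of_int b / real_of_int D) r S \<longrightarrow>
          (\<exists>(S' :: nat \<Rightarrow> nat set set) (k :: nat).
             computes c (enc_instance n s t D a b r S) (enc_trees n r S') k \<and>
             k \<le> poly p (word_bits (enc_instance n s t D a b r S)) \<and>
             reassembled {..<n} (\<lambda>e. real_of_int (a e) / real_of_int D)
               (real_of_int b / real_of_int D) r S S'))"
proof (rule conjI, goal_cases)
  case 1
  show ?case
  proof (intro allI impI)
    fix V :: "'a set" and s t xstar eps r S
    assume "reassembly_instance V s t xstar eps r S"
    then interpret reassembly V s t xstar eps r S by unfold_locales
    show "\<exists>S'. reassembled V xstar eps r S S'" by (rule reassembly_exists)
  qed
next
  case 2
  show ?case
    by (intro exI[of _ "Seq (compile init) (compile body)"] exI[of _ "cost init + cost body"] allI impI)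
      (rule program_correct; simp)
qed

end
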